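(* Let $d\ge 3$ and let $x_1,\ldots,x_d$ be a homogeneous system of parameters of $S$. Then $$\mathfrak q_{d-1}\subseteq\operatorname{ann}_S\frac{(x_1,\ldots,x_{t-1})\colon x_t}{(x_1,\ldots,x_{t-1})}\qquad\text{for } t=1,\ldots,d.$$
   Context: Let $q=p^s$ be a power of a prime $p$, $\mathbb F_q$ the field with $q$ elements, $V$ a $d$-dimensional $\mathbb F_q$-vector space, and $G$ a subgroup of $GL(V)$. Let $R=\mathbb F_q[V]=\operatorname{Sym}_{\mathbb F_q}(V^* )$, graded with $V^*$ in degree $1$, with the natural action of $G$, and let $S=R^G$; $S_+$ is the ideal of $S$ generated by homogeneous elements of positive degree, and $H^j_{S_+}(S)$ is the $j$-th local cohomology module. $S$ contains the Dickson algebra $D^*(d)=R^{GL(V)}$, which is the polynomial ring $\mathbb F_q[\mathbf d_{d,0},\ldots,\mathbf d_{d,d-1}]$, where $\mathbf d_{d,i}$ ($0\le i\le d-1$) is the Dickson polynomial of degree $q^d-q^i$, given by $\prod_{v\in V^*}(X+v)=X^{q^d}+\sum_{i=0}^{d-1}(-1)^{d-i}\mathbf d_{d,i}X^{q^i}$. For $0\le j\le d-1$ let $a_j\ge 0$ be the smallest integer such that $(\mathbf d_{d,0},\mathbf d_{d,1},\mathbf d_{d,2})^{a_j}\subseteq\operatorname{ann}_S H^j_{S_+}(S)$ (ideal powers in $S$; such an integer exists), and for $0\le i\le d-1$ set $\mathfrak q_i=\prod_{j=0}^{i}(\mathbf d_{d,0},\mathbf d_{d,1},\mathbf d_{d,2})^{a_j}$,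 an ideal of $S$. *)

theory Defs
  imports
    "HOL-Analysis.Determinants"
    "HOL-Library.Poly_Mapping"
    "HOL-Computational_Algebra.Polynomial"
    "HOL-Algebra.Module"
    "HOL-Algebra.QuotRing"
    "HOL-Algebra.Ideal_Product"
begin

section \<open>Modules\<close>

text \<open>In a module record only the additive part and the scalar multiplication are meaningful;
  the fields \<open>mult\<close> and \<open>one\<close> are inherited from the record type and play no role.\<close>

definition regular_module :: "('a, 'c) ring_scheme \<Rightarrow> ('a, 'a) module" where
  "regular_module R =
     \<lparr>carrier = carrier R, mult = mult R, one = one R, zero = zero R, add = add R,
      smult = mult R\<rparr>"

text \<open>\<open>subquotient M Z B\<close> is \<open>Z / B\<close> for submodules \<open>B \<subseteq> Z\<close> of \<open>M\<close>.\<close>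

definition subquotient :: "('a, 'b) module \<Rightarrow> 'b set \<Rightarrow> 'b set \<Rightarrow> ('a, 'b set) module" where
  "subquotient M Z B =
     \<lparr>carrier = a_rcosets\<^bsub>M\<lparr>carrier := Z\<rparr>\<^esub> B, mult = undefined, one = undefined,
      zero = B, add = set_add M,
      smult = (\<lambda>r X. \<Union>x\<in>X. B +>\<^bsub>M\<^esub> (r \<odot>\<^bsub>M\<^esub> x))\<rparr>"

definition annihilator :: "('a, 'c) ring_scheme \<Rightarrow> ('a, 'b) module \<Rightarrow> 'a set" where
  "annihilator R M = {r \<in> carrier R. \<forall>x \<in> carrier M. r \<odot>\<^bsub>M\<^esub> x = \<zero>\<^bsub>M\<^esub>}"

definition mod_hom ::
  "('a, 'c) ring_scheme \<Rightarrow> ('a, 'b1) module \<Rightarrow> ('a, 'b2) module \<Rightarrow> ('b1 \<Rightarrow> 'b2) set" where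
  "mod_hom R M N =
     {h \<in> hom (add_monoid M) (add_monoid N).
        \<forall>r \<in> carrier R. \<forall>x \<in> carrier M. h (r \<odot>\<^bsub>M\<^esub> x) = r \<odot>\<^bsub>N\<^esub> h x}"


section \<open>Ideals\<close>

definition ideal_power :: "('a, 'c) ring_scheme \<Rightarrow> 'a set \<Rightarrow> nat \<Rightarrow> 'a set" where
  "ideal_power R I n = I [^]\<^bsub>ideals_set R\<^esub> n"

definition ideal_colon :: "('a, 'c) ring_scheme \<Rightarrow> 'a set \<Rightarrow> 'a \<Rightarrow> 'a set" where
  "ideal_colon R I y = {r \<in> carrier R. r \<otimes>\<^bsub>R\<^esub> y \<in> I}"


section \<open>Local cohomology\<close>

text \<open>The usual lifting property. HOL cannot quantify over all types of modules, so the test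
  modules \<open>A\<close>, \<open>B\<close> have their elements in the type of the ring. These include the inclusions of
  ideals into the ring, so by Baer's criterion this is no restriction.\<close>

definition injective_module :: "('a, 'c) ring_scheme \<Rightarrow> ('a, 'b) module \<Rightarrow> bool" where
  "injective_module R E \<longleftrightarrow> Module.module R E \<and>
     (\<forall>(A :: ('a, 'a) module) (B :: ('a, 'a) module) i f.
        Module.module R A \<and> Module.module R B \<and>
        i \<in> mod_hom R A B \<and> inj_on i (carrier A) \<and> f \<in> mod_hom R A E \<longrightarrow>
        (\<exists>g \<in> mod_hom R B E. \<forall>x \<in> carrier A. g (i x) = f x))"

text \<open>\<open>0 \<rightarrow> M \<rightarrow> E 0 \<rightarrow> E 1 \<rightarrow> \<dots>\<close> with augmentation \<open>\<epsilon>\<close> and differentials \<open>\<delta>\<close>.\<close>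

definition injective_resolution ::
  "('a, 'c) ring_scheme \<Rightarrow> ('a, 'm) module \<Rightarrow>
   (nat \<Rightarrow> ('a, 'b) module) \<Rightarrow> (nat \<Rightarrow> 'b \<Rightarrow> 'b) \<Rightarrow> ('m \<Rightarrow> 'b) \<Rightarrow> bool" where
  "injective_resolution R M E \<delta> \<epsilon> \<longleftrightarrow>
     (\<forall>n. injective_module R (E n)) \<and>
     \<epsilon> \<in> mod_hom R M (E 0) \<and> inj_on \<epsilon> (carrier M) \<and>
     (\<forall>n. \<delta> n \<in> mod_hom R (E n) (E (Suc n))) \<and>
     \<epsilon> ` carrier M = a_kernel (E 0) (E 1) (\<delta> 0) \<and>
     (\<forall>n. \<delta> n ` carrier (E n) = a_kernel (E (Suc n)) (E (Suc (Suc n))) (\<delta> (Suc n)))"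

definition torsion :: "('a, 'c) ring_scheme \<Rightarrow> 'a set \<Rightarrow> ('a, 'b) module \<Rightarrow> 'b set" where
  "torsion R I M =
     {x \<in> carrier M. \<exists>n. \<forall>r \<in> ideal_power R I n. r \<odot>\<^bsub>M\<^esub> x = \<zero>\<^bsub>M\<^esub>}"

text \<open>The \<open>j\<close>-th right derived functor of the \<open>I\<close>-torsion functor, computed from an injective
  resolution \<open>(E, \<delta>)\<close>: the cohomology in degree \<open>j\<close> of the complex
  \<open>0 \<rightarrow> torsion R I (E 0) \<rightarrow> torsion R I (E 1) \<rightarrow> \<dots>\<close>.\<close>

definition local_cohomology ::
  "('a, 'c) ring_scheme \<Rightarrow> 'a set \<Rightarrow> (nat \<Rightarrow> ('a, 'b) module) \<Rightarrow> (nat \<Rightarrow> 'b \<Rightarrow> 'b) \<Rightarrow> nat \<Rightarrow>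
   ('a, 'b set) module" where
  "local_cohomology R I E \<delta> j =
     subquotient (E j)
       {x \<in> torsion R I (E j). \<delta> j x = \<zero>\<^bsub>E (Suc j)\<^esub>}
       (case j of 0 \<Rightarrow> {\<zero>\<^bsub>E 0\<^esub>} | Suc i \<Rightarrow> \<delta> i ` torsion R I (E i))"


section \<open>Polynomials and the action of the general linear group\<close>

text \<open>\<open>('i, 'k) mpol\<close> is the polynomial ring over \<open>'k\<close> in variables indexed by \<open>'i\<close>.\<close>

type_synonym ('i, 'k) mpol = "('i \<Rightarrow>\<^sub>0 nat) \<Rightarrow>\<^sub>0 'k"

definition Cst :: "'k::zero \<Rightarrow> ('i, 'k) mpol" where
  "Cst c = Poly_Mapping.single 0 c"

definition Var :: "'i \<Rightarrow> ('i, 'k::zero_neq_one) mpol" where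
  "Var i = Poly_Mapping.single (Poly_Mapping.single i 1) 1"

definition poly_subst ::
  "('j \<Rightarrow> ('i, 'k::comm_ring_1) mpol) \<Rightarrow> ('j, 'k) mpol \<Rightarrow> ('i, 'k) mpol" where
  "poly_subst \<sigma> p =
     (\<Sum>m \<in> Poly_Mapping.keys p.
        Cst (Poly_Mapping.lookup p m) *
        (\<Prod>j \<in> Poly_Mapping.keys m. \<sigma> j ^ Poly_Mapping.lookup m j))"

definition homogeneous :: "nat \<Rightarrow> ('i::finite, 'k::zero) mpol \<Rightarrow> bool" where
  "homogeneous n f \<longleftrightarrow>
     (\<forall>m \<in> Poly_Mapping.keys f. (\<Sum>i\<in>UNIV. Poly_Mapping.lookup m i) = n)"

text \<open>Here \<open>V = 'k ^ 'n\<close>, so that \<open>Sym(V\<^sup>*)\<close> is \<open>('n, 'k) mpol\<close>, with \<open>Var i\<close> the \<open>i\<close>-th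
  coordinate function.\<close>

definition GL :: "('k::field ^ 'n ^ 'n) monoid" where
  "GL = \<lparr>carrier = {g. invertible g}, mult = (**), one = mat 1\<rparr>"

definition linear_form :: "'k::comm_ring_1 ^ 'n \<Rightarrow> ('n::finite, 'k) mpol" where
  "linear_form c = (\<Sum>i\<in>UNIV. Cst (c $ i) * Var i)"

text \<open>\<open>(g \<cdot> f)(v) = f(g\<^sup>-\<^sup>1 v)\<close>: the \<open>i\<close>-th coordinate function is sent to the linear form given by
  the \<open>i\<close>-th row of the inverse of \<open>g\<close>.\<close>

definition act :: "'k::field ^ 'n ^ 'n \<Rightarrow> ('n::finite, 'k) mpol \<Rightarrow> ('n, 'k) mpol" where
  "act g = poly_subst (\<lambda>i. linear_form (matrix_inv g $ i))"

definition invariant_ring :: "('k::field ^ 'n ^ 'n) set \<Rightarrow> ('n::finite, 'k) mpol ring" where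
  "invariant_ring G =
     \<lparr>carrier = {f. \<forall>g\<in>G. act g f = f}, mult = (*), one = 1, zero = 0, add = (+)\<rparr>"

definition irrelevant_ideal :: "('k::field ^ 'n ^ 'n) set \<Rightarrow> ('n::finite, 'k) mpol set" where
  "irrelevant_ideal G =
     Idl\<^bsub>invariant_ring G\<^esub> {f \<in> carrier (invariant_ring G). \<exists>n>0. homogeneous n f}"


section \<open>Dickson polynomials\<close>

text \<open>Comparing coefficients in \<open>\<Prod>v\<in>V\<^sup>*. (X + v) = X^(q^d) + (\<Sum>i<d. (-1)^(d-i) * \<d>\<^sub>i * X^(q^i))\<close>,
  where \<open>q = CARD('k)\<close> and \<open>d = CARD('n)\<close>.\<close>

definition dickson :: "nat \<Rightarrow> ('n::finite, 'k::{field,finite}) mpol" where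
  "dickson i =
     (-1) ^ (CARD('n) - i) *
     poly.coeff (\<Prod>v \<in> (range linear_form :: ('n, 'k) mpol set). [:v, 1:]) (CARD('k) ^ i)"

definition dickson_ideal ::
  "('k::{field,finite} ^ 'n ^ 'n) set \<Rightarrow> ('n::finite, 'k) mpol set" where
  "dickson_ideal G = Idl\<^bsub>invariant_ring G\<^esub> {dickson 0, dickson 1, dickson 2}"

definition frak_q ::
  "('k::{field,finite} ^ 'n ^ 'n) set \<Rightarrow> (nat \<Rightarrow> nat) \<Rightarrow> nat \<Rightarrow> ('n::finite, 'k) mpol set" where
  "frak_q G a i =
     (\<Otimes>\<^bsub>ideals_set (invariant_ring G)\<^esub> j \<in> {..i}.
        ideal_power (invariant_ring G) (dickson_ideal G) (a j))"


section \<open>Homogeneous systems of parameters\<close>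

text \<open>Polynomials in the variables \<open>1, \<dots>, d\<close>; their images under \<open>poly_subst x\<close> form the
  subalgebra generated by \<open>x 1, \<dots>, x d\<close>.\<close>

definition polys_in :: "nat \<Rightarrow> (nat, 'k::zero) mpol set" where
  "polys_in d = {p. \<forall>m \<in> Poly_Mapping.keys p. Poly_Mapping.keys m \<subseteq> {1..d}}"

definition hsop ::
  "('k::field ^ 'n ^ 'n) set \<Rightarrow> (nat \<Rightarrow> ('n::finite, 'k) mpol) \<Rightarrow> bool" where
  "hsop G x \<longleftrightarrow>
     (\<forall>i \<in> {1..CARD('n)}. x i \<in> carrier (invariant_ring G) \<and> (\<exists>n>0. homogeneous n (x i))) \<and>
     inj_on (poly_subst x) (polys_in CARD('n)) \<and>
     (\<exists>B. finite B \<and> B \<subseteq> carrier (invariant_ring G) \<and>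
        (\<forall>f \<in> carrier (invariant_ring G). \<exists>c.
           (\<forall>b\<in>B. c b \<in> poly_subst x ` polys_in CARD('n)) \<and> f = (\<Sum>b\<in>B. c b * b)))"

end

theory Submission
  imports Defs "HOL-Library.Function_Algebras"
begin

text \<open>
  Let \<open>S\<close> be the ring of invariants and \<open>d\<close> the number of variables. The statement is about a
  relation \<open>r * x t = (\<Sum>j\<in>{1..<t}. s j * x j)\<close> in \<open>S\<close>: it says that \<open>r\<close> moves into the ideal of
  \<open>x 1, \<dots>, x (t - 1)\<close> after multiplication by \<open>c 0 * \<dots> * c (d - 1)\<close>, whenever \<open>c j\<close> annihilates
  the \<open>j\<close>-th local cohomology module.

  A relation \<open>(\<Sum>j\<in>{1..d}. s j * y j) = 0\<close> is a cocycle of degree \<open>d - 1\<close> in \<open>Hom(K, S)\<close>, where \<open>K\<close> is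
  the Koszul complex of \<open>y\<close>, and if a multiple of the cocycle is a coboundary then the same multiple
  of \<open>s t\<close> lies in the ideal of the other \<open>y j\<close>. So it suffices that \<open>c 0 * \<dots> * c (d - 1)\<close>
  annihilates \<open>H\<^sup>d\<^sup>-\<^sup>1(Hom(K, S))\<close>, for suitable sequences \<open>y\<close>. Let \<open>Z q\<close> be the kernel of \<open>\<delta> q\<close> on
  the injective module \<open>E q\<close>, let \<open>T q\<close> be the torsion of \<open>E q\<close>, and let \<open>U q\<close> be the quotient
  of \<open>Z q\<close> by \<open>\<delta> (q - 1)\<close> applied to \<open>T (q - 1)\<close>, so that \<open>U 0 = S\<close>. There are exact sequences
  \<open>0 \<rightarrow> H q \<rightarrow> U q \<rightarrow> E q / T q \<rightarrow> U (q + 1) \<rightarrow> 0\<close> in which \<open>H q\<close> is the \<open>q\<close>-th local cohomology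
  module. The complexes \<open>Hom(K, E q / T q)\<close> are acyclic, and so the \<open>p\<close>-th cohomology of
  \<open>Hom(K, U q)\<close> differs from the \<open>(p - 1)\<close>-st cohomology of \<open>Hom(K, U (q + 1))\<close> only by something
  annihilated by \<open>c q\<close>. Induction on \<open>p\<close> shows that \<open>c q * \<dots> * c (q + p)\<close> annihilates the \<open>p\<close>-th
  cohomology of \<open>Hom(K, U q)\<close>; this is \<open>torsion_approximation.annihilate\<close>, and the case
  \<open>q = 0\<close>, \<open>p = d - 1\<close> is the one needed.

  The acyclicity is \<open>koszul_torsion_approximation\<close>. A homomorphism \<open>u\<close> from \<open>K\<close> to an injective
  module that is torsion on the boundaries of \<open>K\<close> is torsion on its cycles, since each \<open>y j\<close>
  maps cycles to boundaries. By the Artin-Rees property it vanishes on the cycles of high degree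
  (\<open>graded_artin_rees\<close>), so its restriction to the cycles extends by \<open>0\<close> on all elements of high
  degree, and then by injectivity to a torsion homomorphism on \<open>K\<close>. The difference of \<open>u\<close> and this
  homomorphism vanishes on the cycles and therefore factors through the differential. The Artin-Rees
  property rests on a form of Hilbert's basis theorem, \<open>op_noetherian\<close>.

  Finally \<open>y\<close> is taken to be \<open>x 1, \<dots>, x t\<close> followed by the \<open>N\<close>-th powers of \<open>x (t + 1), \<dots>, x d\<close>.
  This puts \<open>c 0 * \<dots> * c (d - 1) * r\<close> into the ideal of \<open>x 1, \<dots>, x (t - 1)\<close> and of these powers,
  for every \<open>N\<close>, and for reasons of degree the powers can be dropped
  (\<open>mem_genideal_if_mem_modulo_powers\<close>).
\<close>

section \<open>Finitely generated modules over commuting operators\<close>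

definition op_stable :: "('m::ab_group_add \<Rightarrow> 'm) set \<Rightarrow> 'm set \<Rightarrow> bool" where
  "op_stable F Z \<longleftrightarrow> 0 \<in> Z \<and> (\<forall>a\<in>Z. \<forall>b\<in>Z. a - b \<in> Z) \<and> (\<forall>f\<in>F. \<forall>a\<in>Z. f a \<in> Z)"

inductive_set op_span :: "('m::ab_group_add \<Rightarrow> 'm) set \<Rightarrow> 'm set \<Rightarrow> 'm set"
  for F X where
    zero: "0 \<in> op_span F X"
  | base: "a \<in> X \<Longrightarrow> a \<in> op_span F X"
  | diff: "a \<in> op_span F X \<Longrightarrow> b \<in> op_span F X \<Longrightarrow> a - b \<in> op_span F X"
  | op: "f \<in> F \<Longrightarrow> a \<in> op_span F X \<Longrightarrow> f a \<in> op_span F X"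

lemma op_stableI:
  assumes "0 \<in> Z" "\<And>a b. a \<in> Z \<Longrightarrow> b \<in> Z \<Longrightarrow> a - b \<in> Z" "\<And>f a. f \<in> F \<Longrightarrow> a \<in> Z \<Longrightarrow> f a \<in> Z"
  shows "op_stable F Z"
  using assms by (auto simp: op_stable_def)

lemma op_stable_diff: "op_stable F Z \<Longrightarrow> a \<in> Z \<Longrightarrow> b \<in> Z \<Longrightarrow> a - b \<in> Z"
  and op_stable_op: "op_stable F Z \<Longrightarrow> f \<in> F \<Longrightarrow> a \<in> Z \<Longrightarrow> f a \<in> Z"
  by (auto simp: op_stable_def)

lemma op_stable_span: "op_stable F (op_span F X)"
  by (auto simp: op_stable_def intro: op_span.intros)

lemma op_span_least:
  assumes "op_stable F Z" "X \<subseteq> Z" shows "op_span F X \<subseteq> Z"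
proof
  fix a assume "a \<in> op_span F X"
  then show "a \<in> Z" using assms by induct (auto simp: op_stable_def)
qed

lemma op_stable_add:
  assumes "op_stable F Z" "a \<in> Z" "b \<in> Z" shows "a + b \<in> Z"
proof -
  have "0 - b \<in> Z" using assms unfolding op_stable_def by blast
  then have "a - (0 - b) \<in> Z" using assms unfolding op_stable_def by blast
  then show ?thesis by simp
qed

lemma op_stable_mono: "op_stable F Z \<Longrightarrow> F' \<subseteq> F \<Longrightarrow> op_stable F' Z"
  by (auto simp: op_stable_def)

lemma op_stable_Un_chain:
  assumes "\<And>i::nat. op_stable F (L i)" "\<And>i. L i \<subseteq> L (Suc i)"
  shows "op_stable F (\<Union>i. L i)"
proof -
  have mono: "i \<le> j \<Longrightarrow> L i \<subseteq> L j" for i j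
    using assms(2) by (rule lift_Suc_mono_le)
  show ?thesis
  proof (rule op_stableI)
    show "0 \<in> (\<Union>i. L i)" using assms(1) by (auto simp: op_stable_def)
  next
    fix a b assume "a \<in> (\<Union>i. L i)" "b \<in> (\<Union>i. L i)"
    then obtain i j where ij: "a \<in> L i" "b \<in> L j" by auto
    have "a \<in> L (max i j)" "b \<in> L (max i j)"
      using ij mono[of i "max i j"] mono[of j "max i j"] by auto
    then have "a - b \<in> L (max i j)" using op_stable_diff[OF assms(1)] by simp
    then show "a - b \<in> (\<Union>i. L i)" by (rule UN_I[OF UNIV_I])
  next
    fix f a assume "f \<in> F" "a \<in> (\<Union>i. L i)"
    then show "f a \<in> (\<Union>i. L i)" using op_stable_op[OF assms(1)] by auto
  qed
qed

text \<open>Hilbert's basis theorem for the polynomial ring in the operators, with a finite group of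
  coefficients; the finite group takes the place of a module over a finite field. When \<open>f\<close> is added to \<open>F\<close>,
  the elements of the span are polynomials in \<open>f\<close> with coefficients in the span of \<open>F\<close>. The
  leading coefficients of the elements of \<open>Z\<close> of degree at most \<open>i\<close> form an ascending chain of
  \<open>F\<close>-stable subgroups. By induction the chain becomes stationary and its members are finitely
  generated, and elements of \<open>Z\<close> with these generators as leading coefficients generate \<open>Z\<close>.\<close>
theorem op_noetherian:
  fixes F :: "('m::ab_group_add \<Rightarrow> 'm) set"
  assumes "finite F"
    and "\<And>f a b. f \<in> F \<Longrightarrow> f (a - b) = f a - f b"
    and "\<And>f g a. f \<in> F \<Longrightarrow> g \<in> F \<Longrightarrow> f (g a) = g (f a)"
    and "finite M"
    and "op_stable {} M"
    and "op_stable F Z"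
    and "Z \<subseteq> op_span F M"
  shows "\<exists>X. finite X \<and> X \<subseteq> Z \<and> Z \<subseteq> op_span F X"
  using assms
proof (induction F arbitrary: Z rule: finite_induct)
  case empty
  have "op_span {} M \<subseteq> M" using empty by (intro op_span_least) auto
  then have "Z \<subseteq> M" using empty by auto
  then have "finite Z" using \<open>finite M\<close> finite_subset by blast
  then show ?case using op_span.base by blast
next
  case (insert f F)
  note IH = insert.IH
  have f_diff: "f (a - b) = f a - f b" for a b using insert.prems(1) by simp
  have f_0: "f 0 = 0" using f_diff[of 0 0] by simp
  have f_add: "f (a + b) = f a + f b" for a b
    using f_diff[of a "0 - b"] f_diff[of 0 b] f_0 by simp
  have g_diff: "g (a - b) = g a - g b" if "g \<in> F" for a b g using insert.prems(1) that by simp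
  have g_add: "g (a + b) = g a + g b" if "g \<in> F" for a b g
    using g_diff[OF that, of a "0 - b"] g_diff[OF that, of 0 b] g_diff[OF that, of 0 0] by simp
  have gf: "g (f a) = f (g a)" if "g \<in> F" for a g using insert.prems(2) that by simp
  have pow_diff: "(f ^^ i) (a - b) = (f ^^ i) a - (f ^^ i) b" for i a b
    by (induction i) (auto simp: f_diff)
  have pow_add: "(f ^^ i) (a + b) = (f ^^ i) a + (f ^^ i) b" for i a b
    by (induction i) (auto simp: f_add)
  have pow_0: "(f ^^ i) 0 = 0" for i by (induction i) (auto simp: f_0)
  have pow_g: "g ((f ^^ i) a) = (f ^^ i) (g a)" if "g \<in> F" for g i a
    by (induction i) (auto simp: gf that)
  define N where "N = op_span F M"
  have N: "op_stable F N" by (simp add: N_def op_stable_span)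
  \<comment> \<open>the polynomials in \<open>f\<close> of degree less than \<open>i\<close> with coefficients in \<open>N\<close>\<close>
  define P where "P = rec_nat {0} (\<lambda>i Q. {a + (f ^^ i) m |a m. a \<in> Q \<and> m \<in> N})"
  have P0: "P 0 = {0}" and PS: "\<And>i. P (Suc i) = {a + (f ^^ i) m |a m. a \<in> P i \<and> m \<in> N}"
    by (simp_all add: P_def)
  have P: "op_stable F (P i)" for i
  proof (induction i)
    case 0 show ?case using g_diff[of _ 0 0] by (auto simp: P0 op_stable_def)
  next
    case (Suc i)
    have "a - b \<in> P (Suc i)" if ab: "a \<in> P (Suc i)" "b \<in> P (Suc i)" for a b
    proof -
      obtain a' m b' n where *: "a = a' + (f ^^ i) m" "b = b' + (f ^^ i) n"
        "a' \<in> P i" "b' \<in> P i" "m \<in> N" "n \<in> N" using ab unfolding PS by blast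
      have "a - b = (a' - b') + (f ^^ i) (m - n)" by (simp add: * pow_diff)
      moreover have "a' - b' \<in> P i" "m - n \<in> N"
        using * Suc N unfolding op_stable_def by blast+
      ultimately show ?thesis unfolding PS by blast
    qed
    moreover have "g a \<in> P (Suc i)" if ga: "g \<in> F" "a \<in> P (Suc i)" for g a
    proof -
      obtain a' m where *: "a = a' + (f ^^ i) m" "a' \<in> P i" "m \<in> N"
        using ga unfolding PS by blast
      have "g a = g a' + (f ^^ i) (g m)" by (simp add: * g_add pow_g ga)
      moreover have "g a' \<in> P i" "g m \<in> N"
        using * Suc N ga unfolding op_stable_def by blast+
      ultimately show ?thesis unfolding PS by blast
    qed
    moreover have "0 \<in> P (Suc i)"
    proof -
      have "0 = 0 + (f ^^ i) 0" "0 \<in> P i" "0 \<in> N"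
        using pow_0 Suc N unfolding op_stable_def by auto
      then show ?thesis unfolding PS by blast
    qed
    ultimately show ?case unfolding op_stable_def by blast
  qed
  have N0: "0 \<in> N" using N by (simp add: op_stable_def)
  have Pmono: "P i \<subseteq> P (Suc i)" for i
  proof
    fix a assume "a \<in> P i"
    moreover have "a = a + (f ^^ i) 0" by (simp add: pow_0)
    ultimately show "a \<in> P (Suc i)" unfolding PS using N0 by blast
  qed
  have Pf: "a \<in> P i \<Longrightarrow> f a \<in> P (Suc i)" for a i
  proof (induction i arbitrary: a)
    case 0 then show ?case using Pmono[of 0] by (auto simp: P0 f_0)
  next
    case (Suc i)
    obtain a' m where *: "a = a' + (f ^^ i) m" "a' \<in> P i" "m \<in> N"
      using Suc.prems unfolding PS by blast
    have "f a = f a' + (f ^^ Suc i) m" by (simp add: * f_add)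
    with Suc.IH[OF *(2)] *(3) show ?case unfolding PS[of "Suc i"] by blast
  qed
  have Pfpow: "a \<in> P i \<Longrightarrow> (f ^^ k) a \<in> P (k + i)" for a i k
    by (induction k) (auto intro: Pf)
  have spanP: "op_span (insert f F) M \<subseteq> (\<Union>i. P i)"
  proof (rule op_span_least)
    have "op_stable F (\<Union>i. P i)" using P Pmono by (rule op_stable_Un_chain)
    then show "op_stable (insert f F) (\<Union>i. P i)" using Pf by (fastforce simp: op_stable_def)
    have "m \<in> P 1" if "m \<in> M" for m
    proof -
      have "m \<in> N" using that by (simp add: N_def op_span.base)
      moreover have "m = 0 + (f ^^ 0) m" by simp
      ultimately show ?thesis unfolding One_nat_def PS P0 by blast
    qed
    then show "M \<subseteq> (\<Union>i. P i)" by blast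
  qed
  have Zf: "op_stable F Z" using insert.prems(5) by (rule op_stable_mono) auto
  have Z_diff: "a - b \<in> Z" if "a \<in> Z" "b \<in> Z" for a b
    using Zf that by (auto simp: op_stable_def)
  have Z_f: "f a \<in> Z" if "a \<in> Z" for a
    using insert.prems(5) that by (auto simp: op_stable_def)
  \<comment> \<open>the coefficients of \<open>f ^^ i\<close> in the elements of \<open>Z\<close> of degree at most \<open>i\<close>\<close>
  define L where "L i = {m \<in> N. \<exists>a \<in> P i. a + (f ^^ i) m \<in> Z}" for i
  have L: "op_stable F (L i)" for i
  proof -
    have "m - n \<in> L i" if mn: "m \<in> L i" "n \<in> L i" for m n
    proof -
      obtain a b where *: "a \<in> P i" "b \<in> P i" "a + (f ^^ i) m \<in> Z" "b + (f ^^ i) n \<in> Z"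
        "m \<in> N" "n \<in> N" using mn unfolding L_def by blast
      have "(a + (f ^^ i) m) - (b + (f ^^ i) n) \<in> Z" using Z_diff * by blast
      then have "(a - b) + (f ^^ i) (m - n) \<in> Z" by (simp add: pow_diff algebra_simps)
      moreover have "a - b \<in> P i" "m - n \<in> N" using P[of i] N * unfolding op_stable_def by blast+
      ultimately show ?thesis unfolding L_def by blast
    qed
    moreover have "g m \<in> L i" if gm: "g \<in> F" "m \<in> L i" for g m
    proof -
      obtain a where *: "a \<in> P i" "a + (f ^^ i) m \<in> Z" "m \<in> N" using gm unfolding L_def by blast
      have "g (a + (f ^^ i) m) \<in> Z" using Zf * gm unfolding op_stable_def by blast
      then have "g a + (f ^^ i) (g m) \<in> Z" by (simp add: g_add gm pow_g)
      moreover have "g a \<in> P i" "g m \<in> N" using P[of i] N * gm unfolding op_stable_def by blast+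
      ultimately show ?thesis unfolding L_def by blast
    qed
    moreover have "0 \<in> L i"
    proof -
      have "0 + (f ^^ i) 0 \<in> Z" "0 \<in> P i" using Zf P[of i] by (auto simp: pow_0 op_stable_def)
      then show ?thesis unfolding L_def using N0 by blast
    qed
    ultimately show ?thesis unfolding op_stable_def by blast
  qed
  have Lmono: "L i \<subseteq> L (Suc i)" for i
  proof
    fix m assume "m \<in> L i"
    then obtain a where *: "a \<in> P i" "a + (f ^^ i) m \<in> Z" "m \<in> N" unfolding L_def by blast
    then have "f a + (f ^^ Suc i) m \<in> Z" using Z_f[of "a + (f ^^ i) m"] by (simp add: f_add)
    then show "m \<in> L (Suc i)" using Pf[OF *(1)] *(3) unfolding L_def by blast
  qed
  have Lle: "i \<le> j \<Longrightarrow> L i \<subseteq> L j" for i j using Lmono by (rule lift_Suc_mono_le)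
  have IH': "\<exists>X. finite X \<and> X \<subseteq> Q \<and> Q \<subseteq> op_span F X" if "op_stable F Q" "Q \<subseteq> N" for Q
    using insert.prems that by (intro IH) (auto simp: N_def)
  have "\<exists>X. finite X \<and> X \<subseteq> (\<Union>i. L i) \<and> (\<Union>i. L i) \<subseteq> op_span F X"
  proof (rule IH')
    show "op_stable F (\<Union>i. L i)" using L Lmono by (rule op_stable_Un_chain)
  qed (auto simp: L_def)
  then obtain U where U: "finite U" "U \<subseteq> (\<Union>i. L i)" "(\<Union>i. L i) \<subseteq> op_span F U" by blast
  obtain s where s: "U \<subseteq> L s"
  proof -
    have "\<forall>u\<in>U. \<exists>i. u \<in> L i" using U by blast
    then obtain k where k: "\<And>u. u \<in> U \<Longrightarrow> u \<in> L (k u)" by metis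
    have "u \<in> L (Max (k ` U))" if "u \<in> U" for u
      using k[OF that] Lle[of "k u" "Max (k ` U)"] U(1) that by auto
    then show thesis using that by blast
  qed
  have Ls: "L i \<subseteq> L s" for i
    using U(3) op_span_least[OF L s] by blast
  have "\<forall>i. \<exists>X. finite X \<and> X \<subseteq> L i \<and> L i \<subseteq> op_span F X"
    using L by (intro allI IH') (auto simp: L_def)
  then obtain X where X: "\<And>i. finite (X i)" "\<And>i. X i \<subseteq> L i" "\<And>i. L i \<subseteq> op_span F (X i)"
    by metis
  have "\<forall>i m. \<exists>a. m \<in> L i \<longrightarrow> a \<in> P i \<and> a + (f ^^ i) m \<in> Z" unfolding L_def by blast
  then obtain lo where lo: "\<And>i m. m \<in> L i \<Longrightarrow> lo i m \<in> P i \<and> lo i m + (f ^^ i) m \<in> Z"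
    by metis
  define G where "G = (\<Union>i\<le>s. (\<lambda>m. lo i m + (f ^^ i) m) ` X i)"
  have G: "finite G" "G \<subseteq> Z"
    unfolding G_def using X(1) subsetD[OF X(2)] lo by auto
  define Y where "Y = op_span (insert f F) G"
  have Y: "op_stable (insert f F) Y" by (simp add: Y_def op_stable_span)
  have YZ: "Y \<subseteq> Z" unfolding Y_def using insert.prems(5) G(2) by (rule op_span_least)
  have lift: "\<exists>a \<in> P i. a + (f ^^ i) m \<in> Y" if "i \<le> s" "m \<in> op_span F (X i)" for i m
    using that(2)
  proof induct
    case zero
    have "0 + (f ^^ i) 0 \<in> Y" "0 \<in> P i" using Y P[of i] by (auto simp: pow_0 op_stable_def)
    then show ?case by blast
  next
    case (base m)
    then have "lo i m + (f ^^ i) m \<in> G" using that(1) unfolding G_def by blast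
    moreover have "lo i m \<in> P i" using base X(2) lo by blast
    ultimately show ?case unfolding Y_def using op_span.base by blast
  next
    case (diff m n)
    then obtain a b where *: "a \<in> P i" "b \<in> P i" "a + (f ^^ i) m \<in> Y" "b + (f ^^ i) n \<in> Y"
      by blast
    have "(a + (f ^^ i) m) - (b + (f ^^ i) n) \<in> Y" using Y * unfolding op_stable_def by blast
    then have "(a - b) + (f ^^ i) (m - n) \<in> Y" by (simp add: pow_diff algebra_simps)
    moreover have "a - b \<in> P i" using P[of i] * unfolding op_stable_def by blast
    ultimately show ?case by blast
  next
    case (op g m)
    then obtain a where *: "a \<in> P i" "a + (f ^^ i) m \<in> Y" by blast
    have "g (a + (f ^^ i) m) \<in> Y" using Y * op(1) unfolding op_stable_def by blast
    then have "g a + (f ^^ i) (g m) \<in> Y" by (simp add: g_add op(1) pow_g)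
    moreover have "g a \<in> P i" using P[of i] * op(1) unfolding op_stable_def by blast
    ultimately show ?case by blast
  qed
  have "Z \<inter> P i \<subseteq> Y" for i
  proof (induction i)
    case 0 then show ?case using Y by (auto simp: P0 op_stable_def)
  next
    case (Suc i)
    show ?case
    proof
      fix w assume w: "w \<in> Z \<inter> P (Suc i)"
      then obtain a m where *: "w = a + (f ^^ i) m" "a \<in> P i" "m \<in> N" unfolding PS by blast
      then have "m \<in> L i" using w unfolding L_def by blast
      then have "m \<in> L (min i s)" using Ls by (auto simp: min_def)
      then obtain b where b: "b \<in> P (min i s)" "b + (f ^^ (min i s)) m \<in> Y"
        using lift[of "min i s" m] X(3) by auto
      \<comment> \<open>from \<open>s\<close> on, an element with a given leading coefficient is obtained from one of degree \<open>s\<close>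
        by applying \<open>f\<close>\<close>
      define k where "k = i - min i s"
      have ki: "k + min i s = i" by (auto simp: k_def)
      have "(f ^^ k) (b + (f ^^ (min i s)) m) \<in> Y"
        using b(2) Y by (induction k) (auto simp: op_stable_def)
      moreover have "(f ^^ k) ((f ^^ (min i s)) m) = (f ^^ i) m"
        using funpow_add[of k "min i s" f] ki by (metis comp_apply)
      ultimately have y: "(f ^^ k) b + (f ^^ i) m \<in> Y" by (simp add: pow_add)
      have "(f ^^ k) b \<in> P i" using Pfpow[OF b(1), of k] by (simp add: ki)
      then have "a - (f ^^ k) b \<in> P i" using P[of i] * unfolding op_stable_def by blast
      moreover have "a - (f ^^ k) b = w - ((f ^^ k) b + (f ^^ i) m)" by (simp add: *)
      moreover have "w - ((f ^^ k) b + (f ^^ i) m) \<in> Z" using Z_diff w y YZ by blast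
      ultimately have "w - ((f ^^ k) b + (f ^^ i) m) \<in> Y" using Suc by auto
      from op_stable_add[OF Y this y] show "w \<in> Y" by simp
    qed
  qed
  then have "Z \<subseteq> Y" using spanP insert.prems(6) by blast
  then show ?case using G unfolding Y_def by blast
qed

section \<open>Graded polynomials and the ring of invariants\<close>

abbreviation "keys \<equiv> Poly_Mapping.keys"
abbreviation "lookup \<equiv> Poly_Mapping.lookup"
abbreviation "single \<equiv> Poly_Mapping.single"

definition tdeg :: "('i::finite \<Rightarrow>\<^sub>0 nat) \<Rightarrow> nat" where
  "tdeg m = (\<Sum>i\<in>UNIV. lookup m i)"

lemma tdeg_add: "tdeg (m + m') = tdeg m + tdeg m'"
  by (simp add: tdeg_def lookup_add sum.distrib)

lemma homogeneous_iff: "homogeneous n f \<longleftrightarrow> (\<forall>m\<in>keys f. tdeg m = n)"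
  by (simp add: homogeneous_def tdeg_def)

definition deg_le :: "nat \<Rightarrow> ('i::finite, 'k::zero) mpol \<Rightarrow> bool" where
  "deg_le n f \<longleftrightarrow> (\<forall>m\<in>keys f. tdeg m \<le> n)"

definition deg_ge :: "nat \<Rightarrow> ('i::finite, 'k::zero) mpol \<Rightarrow> bool" where
  "deg_ge n f \<longleftrightarrow> (\<forall>m\<in>keys f. n \<le> tdeg m)"

lemma deg_le_exists: "\<exists>n. deg_le n f"
proof -
  have "\<forall>m\<in>keys f. tdeg m \<le> Max (tdeg ` keys f)" by auto
  then show ?thesis unfolding deg_le_def by blast
qed

lemma deg_le_mono: "deg_le n f \<Longrightarrow> n \<le> n' \<Longrightarrow> deg_le n' f"
  by (force simp: deg_le_def)

lemma deg_le_0 [simp]: "deg_le n 0" and deg_ge_0 [simp]: "deg_ge n 0"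
  by (simp_all add: deg_le_def deg_ge_def)

lemma deg_le_diff:
  fixes f g :: "('i::finite, 'k::ab_group_add) mpol"
  shows "deg_le n f \<Longrightarrow> deg_le n g \<Longrightarrow> deg_le n (f - g)"
  unfolding deg_le_def by (auto simp: in_keys_iff lookup_minus)

lemma deg_ge_add: "deg_ge n f \<Longrightarrow> deg_ge n g \<Longrightarrow> deg_ge n (f + g)"
  unfolding deg_ge_def using keys_add[of f g] by blast

lemma deg_ge_mult:
  fixes f g :: "('i::finite, 'k::semiring_0) mpol"
  assumes "deg_ge n f" "deg_ge n' g" shows "deg_ge (n + n') (f * g)"
  unfolding deg_ge_def
proof
  fix m assume "m \<in> keys (f * g)"
  then obtain a b where "m = a + b" "a \<in> keys f" "b \<in> keys g" using keys_mult[of f g] by blast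
  then show "n + n' \<le> tdeg m" using assms by (simp add: tdeg_add deg_ge_def add_mono)
qed

lemma deg_le_mult:
  fixes f g :: "('i::finite, 'k::semiring_0) mpol"
  assumes "deg_le n f" "deg_le n' g" shows "deg_le (n + n') (f * g)"
  unfolding deg_le_def
proof
  fix m assume "m \<in> keys (f * g)"
  then obtain a b where "m = a + b" "a \<in> keys f" "b \<in> keys g" using keys_mult[of f g] by blast
  then show "tdeg m \<le> n + n'" using assms by (simp add: tdeg_add deg_le_def add_mono)
qed

lemma homogeneous_mult:
  fixes f g :: "('i::finite, 'k::semiring_0) mpol"
  assumes "homogeneous n f" "homogeneous n' g" shows "homogeneous (n + n') (f * g)"
  unfolding homogeneous_iff
proof
  fix m assume "m \<in> keys (f * g)"
  then obtain a b where "m = a + b" "a \<in> keys f" "b \<in> keys g" using keys_mult[of f g] by blast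
  then show "tdeg m = n + n'" using assms by (simp add: tdeg_add homogeneous_iff)
qed

lemma homogeneous_0 [simp]: "homogeneous n 0" by (simp add: homogeneous_iff)

lemma homogeneous_1: "homogeneous 0 (1 :: ('i::finite, 'k::zero_neq_one) mpol)"
  by (simp add: homogeneous_iff tdeg_def)

lemma homogeneous_add: "homogeneous n f \<Longrightarrow> homogeneous n g \<Longrightarrow> homogeneous n (f + g)"
  unfolding homogeneous_iff using keys_add[of f g] by blast

lemma homogeneous_sum: "(\<And>i. i \<in> I \<Longrightarrow> homogeneous n (f i)) \<Longrightarrow> homogeneous n (sum f I)"
  by (induction I rule: infinite_finite_induct) (auto intro: homogeneous_add)

lemma homogeneous_power:
  fixes f :: "('i::finite, 'k::comm_semiring_1) mpol"
  shows "homogeneous n f \<Longrightarrow> homogeneous (k * n) (f ^ k)"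
  by (induction k) (auto intro: homogeneous_mult homogeneous_1)

lemma homogeneous_Cst: "homogeneous 0 (Cst c)"
  by (simp add: homogeneous_iff Cst_def tdeg_def)

lemma homogeneous_deg_le: "homogeneous n f \<Longrightarrow> deg_le n f"
  and homogeneous_deg_ge: "homogeneous n f \<Longrightarrow> deg_ge n f"
  by (simp_all add: homogeneous_iff deg_le_def deg_ge_def)

definition hpart :: "nat \<Rightarrow> ('i::finite, 'k::zero) mpol \<Rightarrow> ('i, 'k) mpol" where
  "hpart n f = Poly_Mapping.mapp (\<lambda>m c. c when tdeg m = n) f"

lemma lookup_hpart: "lookup (hpart n f) m = (if tdeg m = n then lookup f m else 0)"
  by (auto simp: hpart_def lookup_mapp in_keys_iff when_def)

lemma hpart_0 [simp]: "hpart n 0 = 0" by (simp add: poly_mapping_eq_iff fun_eq_iff lookup_hpart)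

lemma hpart_add: "hpart n (f + g) = hpart n f + hpart n g"
  by (simp add: poly_mapping_eq_iff fun_eq_iff lookup_hpart lookup_add)

lemma hpart_diff:
  fixes f g :: "('i::finite, 'k::ab_group_add) mpol"
  shows "hpart n (f - g) = hpart n f - hpart n g"
  by (simp add: poly_mapping_eq_iff fun_eq_iff lookup_hpart lookup_minus)

lemma hpart_sum: "hpart n (sum f I) = (\<Sum>i\<in>I. hpart n (f i))"
  by (induction I rule: infinite_finite_induct) (simp_all add: hpart_add)

lemma homogeneous_hpart: "homogeneous n (hpart n f)"
  by (auto simp: homogeneous_iff in_keys_iff lookup_hpart split: if_splits)

lemma hpart_homogeneous: "homogeneous n f \<Longrightarrow> hpart k f = (if k = n then f else 0)"
  by (auto simp: poly_mapping_eq_iff fun_eq_iff lookup_hpart homogeneous_iff in_keys_iff)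

lemma hpart_eq_0_deg_le: "deg_le n f \<Longrightarrow> n < k \<Longrightarrow> hpart k f = 0"
  by (force simp: poly_mapping_eq_iff fun_eq_iff lookup_hpart deg_le_def in_keys_iff)

lemma hpart_eq_0_deg_ge: "deg_ge n f \<Longrightarrow> k < n \<Longrightarrow> hpart k f = 0"
  by (force simp: poly_mapping_eq_iff fun_eq_iff lookup_hpart deg_ge_def in_keys_iff)

lemma sum_hpart: "deg_le n f \<Longrightarrow> (\<Sum>k\<le>n. hpart k f) = f"
proof -
  assume f: "deg_le n f"
  have "(\<Sum>k\<le>n. if tdeg m = k then lookup f m else 0) = lookup f m" for m
  proof (cases "tdeg m \<le> n")
    case True then show ?thesis by simp
  next
    case False
    then have "lookup f m = 0" using f by (auto simp: deg_le_def in_keys_iff)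
    then show ?thesis by simp
  qed
  then have "lookup (\<Sum>k\<le>n. hpart k f) m = lookup f m" for m
    unfolding lookup_sum lookup_hpart .
  then show ?thesis by (intro poly_mapping_eqI)
qed

lemma hpart_mult:
  fixes f y :: "('i::finite, 'k::comm_ring_1) mpol"
  assumes y: "homogeneous n y"
  shows "hpart e (y * f) = (if n \<le> e then y * hpart (e - n) f else 0)"
proof -
  obtain B where B: "deg_le B f" using deg_le_exists by blast
  then have B': "deg_le (B + e) f" by (rule deg_le_mono) simp
  have "hpart e (y * f) = hpart e (\<Sum>k\<le>B+e. y * hpart k f)"
    by (simp add: sum_distrib_left[symmetric] sum_hpart[OF B'])
  also have "\<dots> = (\<Sum>k\<le>B+e. if e = n + k then y * hpart k f else 0)"
    unfolding hpart_sum
    by (intro sum.cong refl hpart_homogeneous homogeneous_mult y homogeneous_hpart)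
  also have "\<dots> = (\<Sum>k\<le>B+e. if k = e - n then (if n \<le> e then y * hpart k f else 0) else 0)"
    by (intro sum.cong refl) auto
  also have "\<dots> = (if n \<le> e then y * hpart (e - n) f else 0)"
    by (auto simp: sum.delta intro: le_trans[OF diff_le_self])
  finally show ?thesis .
qed

lemma finite_tdeg_le: "finite {m :: 'i::finite \<Rightarrow>\<^sub>0 nat. tdeg m \<le> n}"
proof (rule inj_on_finite[where f = lookup])
  show "inj_on lookup {m. tdeg m \<le> n}" by (rule inj_onI, rule poly_mapping_eqI) simp
  show "lookup ` {m :: 'i \<Rightarrow>\<^sub>0 nat. tdeg m \<le> n} \<subseteq> PiE UNIV (\<lambda>_. {..n})"
  proof (rule image_subsetI, rule PiE_I)
    fix m :: "'i \<Rightarrow>\<^sub>0 nat" and i assume "m \<in> {m. tdeg m \<le> n}"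
    moreover have "lookup m i \<le> tdeg m"
      unfolding tdeg_def by (rule member_le_sum) auto
    ultimately show "lookup m i \<in> {..n}" by simp
  qed simp
  show "finite (PiE (UNIV::'i set) (\<lambda>_. {..n}))" by (intro finite_PiE) auto
qed

lemma finite_deg_le: "finite {f :: ('i::finite, 'k::{finite,zero}) mpol. deg_le n f}"
proof (rule inj_on_finite[where f = "\<lambda>f. restrict (lookup f) {m. tdeg m \<le> n}"])
  show "inj_on (\<lambda>f. restrict (lookup f) {m. tdeg m \<le> n}) {f :: ('i, 'k) mpol. deg_le n f}"
  proof (rule inj_onI)
    fix f g :: "('i, 'k) mpol"
    assume f: "f \<in> {f. deg_le n f}" and g: "g \<in> {f. deg_le n f}"
      and eq: "restrict (lookup f) {m. tdeg m \<le> n} = restrict (lookup g) {m. tdeg m \<le> n}"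
    have "lookup f m = lookup g m" for m
    proof (cases "tdeg m \<le> n")
      case True then show ?thesis using fun_cong[OF eq, of m] by simp
    next
      case False
      then have "m \<notin> keys f" "m \<notin> keys g" using f g by (auto simp: deg_le_def)
      then show ?thesis by (simp add: in_keys_iff)
    qed
    then show "f = g" by (rule poly_mapping_eqI)
  qed
  show "finite (PiE {m :: 'i \<Rightarrow>\<^sub>0 nat. tdeg m \<le> n} (\<lambda>_. UNIV :: 'k set))"
    using finite_tdeg_le by (intro finite_PiE) auto
  show "(\<lambda>f. restrict (lookup f) {m. tdeg m \<le> n}) ` {f :: ('i, 'k) mpol. deg_le n f}
    \<subseteq> PiE {m. tdeg m \<le> n} (\<lambda>_. UNIV)"
    by (rule image_subsetI) (rule restrict_PiE_iff[THEN iffD2], simp)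
qed

lemma countable_mpol: "countable (UNIV :: ('i::finite, 'k::{finite,zero}) mpol set)"
proof -
  have "(UNIV :: ('i, 'k) mpol set) = (\<Union>n. {f :: ('i, 'k) mpol. deg_le n f})"
    using deg_le_exists by blast
  moreover have "countable (\<Union>n. {f :: ('i, 'k) mpol. deg_le n f})"
    by (intro countable_UN countable_finite finite_deg_le countableI_type)
  ultimately show ?thesis by simp
qed

lemma inj_power_Var: "inj (\<lambda>n. single (single i n) 1 :: ('i, 'k::zero_neq_one) mpol)"
proof (rule injI)
  fix a b
  assume "single (single i a) (1::'k) = single (single i b) 1"
  then have "single i a = single i b"
    by (metis lookup_single_eq lookup_single_not_eq zero_neq_one)
  then show "a = b" by (metis lookup_single_eq)
qed

definition mono_subst :: "('j \<Rightarrow> 'a::comm_monoid_mult) \<Rightarrow> ('j \<Rightarrow>\<^sub>0 nat) \<Rightarrow> 'a" where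
  "mono_subst \<sigma> m = (\<Prod>j\<in>keys m. \<sigma> j ^ lookup m j)"

lemma mono_subst_superset:
  "finite A \<Longrightarrow> keys m \<subseteq> A \<Longrightarrow> mono_subst \<sigma> m = (\<Prod>j\<in>A. \<sigma> j ^ lookup m j)"
  unfolding mono_subst_def by (rule prod.mono_neutral_left) (auto simp: in_keys_iff)

lemma mono_subst_add: "mono_subst \<sigma> (m + m') = mono_subst \<sigma> m * mono_subst \<sigma> m'"
proof -
  let ?A = "keys m \<union> keys m'"
  have "mono_subst \<sigma> (m + m') = (\<Prod>j\<in>?A. \<sigma> j ^ lookup (m + m') j)"
    by (rule mono_subst_superset) (use keys_add[of m m'] in auto)
  also have "\<dots> = mono_subst \<sigma> m * mono_subst \<sigma> m'"
    by (simp add: mono_subst_superset[of ?A m] mono_subst_superset[of ?A m'] lookup_add power_add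
        prod.distrib)
  finally show ?thesis .
qed

lemma mono_subst_0 [simp]: "mono_subst \<sigma> 0 = 1" by (simp add: mono_subst_def)

lemma poly_subst_eq: "poly_subst \<sigma> p = (\<Sum>m\<in>keys p. Cst (lookup p m) * mono_subst \<sigma> m)"
  by (simp add: poly_subst_def mono_subst_def)

lemma Cst_0 [simp]: "Cst 0 = 0" and Cst_1 [simp]: "Cst 1 = 1"
  and Cst_add: "Cst (a + b) = Cst a + Cst b"
  by (simp_all add: Cst_def single_add)

lemma Cst_sum: "Cst (sum f A) = (\<Sum>a\<in>A. Cst (f a))"
  by (induction A rule: infinite_finite_induct) (simp_all add: Cst_add)

lemma Cst_mult: "Cst (a * b) = Cst a * Cst b"
  by (simp add: Cst_def mult_single)

lemma poly_subst_add: "poly_subst \<sigma> (p + q) = poly_subst \<sigma> p + poly_subst \<sigma> q"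
  unfolding poly_subst_eq
  by (rule setsum_keys_plus_distrib) (simp_all add: Cst_add algebra_simps)

lemma poly_subst_0 [simp]: "poly_subst \<sigma> 0 = 0" by (simp add: poly_subst_eq)

lemma poly_subst_diff: "poly_subst \<sigma> (p - q) = poly_subst \<sigma> p - poly_subst \<sigma> q"
  using poly_subst_add[of \<sigma> "p - q" q] by simp

lemma poly_subst_sum: "poly_subst \<sigma> (sum p I) = (\<Sum>i\<in>I. poly_subst \<sigma> (p i))"
  by (induction I rule: infinite_finite_induct) (simp_all add: poly_subst_add)

lemma poly_subst_single: "poly_subst \<sigma> (single m c) = Cst c * mono_subst \<sigma> m"
  by (simp add: poly_subst_eq)

lemma poly_subst_Cst [simp]: "poly_subst \<sigma> (Cst c) = Cst c"
  using poly_subst_single[of \<sigma> 0 c] by (simp add: Cst_def)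

lemma poly_subst_1 [simp]: "poly_subst \<sigma> 1 = 1"
  using poly_subst_Cst[of \<sigma> 1] by simp

lemma poly_subst_Var: "poly_subst \<sigma> (Var i) = \<sigma> i"
  by (simp add: Var_def poly_subst_single mono_subst_def)

lemma sum_singles: "(\<Sum>m\<in>keys p. single m (lookup p m)) = p"
proof -
  have "(\<Sum>m\<in>keys p. if m = k then lookup p m else 0) = lookup p k" for k
    by (simp add: in_keys_iff)
  then show ?thesis
    by (simp add: poly_mapping_eq_iff fun_eq_iff lookup_sum lookup_single when_def)
qed

lemma poly_subst_mult: "poly_subst \<sigma> (p * q) = poly_subst \<sigma> p * poly_subst \<sigma> q"
proof -
  have "p * q = (\<Sum>m\<in>keys p. \<Sum>m'\<in>keys q. single (m + m') (lookup p m * lookup q m'))"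
    unfolding mult_single[symmetric] sum_product[symmetric] by (simp add: sum_singles)
  also have "poly_subst \<sigma> \<dots> = poly_subst \<sigma> p * poly_subst \<sigma> q"
    unfolding poly_subst_sum poly_subst_single poly_subst_eq[of \<sigma> p] poly_subst_eq[of \<sigma> q]
      sum_product
    by (simp add: Cst_mult mono_subst_add mult_ac)
  finally show ?thesis .
qed

lemma homogeneous_mono_subst:
  assumes "\<And>j. homogeneous 1 (\<sigma> j :: ('i::finite, 'k::comm_ring_1) mpol)"
  shows "homogeneous (\<Sum>j\<in>keys m. lookup m j) (mono_subst \<sigma> m)"
proof -
  have "finite A \<Longrightarrow> homogeneous (\<Sum>j\<in>A. lookup m j) (\<Prod>j\<in>A. \<sigma> j ^ lookup m j)" for A
  proof (induction A rule: finite_induct)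
    case empty then show ?case by (simp add: homogeneous_1)
  next
    case (insert a A)
    have "homogeneous (lookup m a * 1) (\<sigma> a ^ lookup m a)"
      by (intro homogeneous_power assms)
    with insert show ?case by (simp add: homogeneous_mult)
  qed
  then show ?thesis by (simp add: mono_subst_def)
qed

lemma homogeneous_linear_form: "homogeneous 1 (linear_form c :: ('n::finite, 'k::comm_ring_1) mpol)"
  unfolding linear_form_def
proof (rule homogeneous_sum)
  fix i :: 'n
  have "homogeneous 1 (Var i :: ('n, 'k) mpol)"
    by (simp add: homogeneous_iff Var_def tdeg_def lookup_single when_def)
  from homogeneous_mult[OF homogeneous_Cst this]
  show "homogeneous 1 (Cst (c $ i) * Var i)" by simp
qed

lemma act_add: "act g (p + q) = act g p + act g q"
  and act_diff: "act g (p - q) = act g p - act g q"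
  and act_mult: "act g (p * q) = act g p * act g q"
  and act_0 [simp]: "act g 0 = 0" and act_1 [simp]: "act g 1 = 1"
  and act_Cst [simp]: "act g (Cst c) = Cst c"
  and act_sum: "act g (sum f I) = (\<Sum>i\<in>I. act g (f i))"
  by (simp_all add: act_def poly_subst_add poly_subst_diff poly_subst_mult poly_subst_sum)

lemma homogeneous_act:
  assumes "homogeneous n f" shows "homogeneous n (act g f)"
  unfolding act_def poly_subst_eq
proof (rule homogeneous_sum)
  fix m assume m: "m \<in> keys f"
  let ?\<sigma> = "\<lambda>i. linear_form (matrix_inv g $ i)"
  have "(\<Sum>j\<in>keys m. lookup m j) = tdeg m"
    unfolding tdeg_def by (rule sum.mono_neutral_left) (auto simp: in_keys_iff)
  then have "homogeneous n (mono_subst ?\<sigma> m)"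
    using homogeneous_mono_subst[of ?\<sigma> m] homogeneous_linear_form assms m
    by (auto simp: homogeneous_iff[of n f])
  from homogeneous_mult[OF homogeneous_Cst this]
  show "homogeneous n (Cst (lookup f m) * mono_subst ?\<sigma> m)" by simp
qed

text \<open>The action preserves degrees, so that the ring of invariants is graded.\<close>
lemma act_hpart: "act g (hpart e f) = hpart e (act g f)"
proof -
  obtain B where "deg_le B f" using deg_le_exists by blast
  then have B: "deg_le (B + e) f" by (rule deg_le_mono) simp
  have "hpart e (act g f) = hpart e (act g (\<Sum>k\<le>B+e. hpart k f))" by (simp add: sum_hpart[OF B])
  also have "\<dots> = (\<Sum>k\<le>B+e. if e = k then act g (hpart k f) else 0)"
    unfolding act_sum hpart_sum
    by (intro sum.cong refl hpart_homogeneous homogeneous_act homogeneous_hpart)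
  also have "\<dots> = act g (hpart e f)" by simp
  finally show ?thesis ..
qed

lemma invariant_simps [simp]:
  "zero (invariant_ring G) = 0" "one (invariant_ring G) = 1"
  "add (invariant_ring G) = (+)" "mult (invariant_ring G) = (*)"
  by (simp_all add: invariant_ring_def)

lemma carrier_invariant: "f \<in> carrier (invariant_ring G) \<longleftrightarrow> (\<forall>g\<in>G. act g f = f)"
  by (simp add: invariant_ring_def)

lemma invariant_closed:
  "0 \<in> carrier (invariant_ring G)" "1 \<in> carrier (invariant_ring G)"
  "Cst c \<in> carrier (invariant_ring G)"
  "f \<in> carrier (invariant_ring G) \<Longrightarrow> h \<in> carrier (invariant_ring G) \<Longrightarrow>
    f + h \<in> carrier (invariant_ring G)"
  "f \<in> carrier (invariant_ring G) \<Longrightarrow> h \<in> carrier (invariant_ring G) \<Longrightarrow>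
    f - h \<in> carrier (invariant_ring G)"
  "f \<in> carrier (invariant_ring G) \<Longrightarrow> h \<in> carrier (invariant_ring G) \<Longrightarrow>
    f * h \<in> carrier (invariant_ring G)"
  "f \<in> carrier (invariant_ring G) \<Longrightarrow> hpart e f \<in> carrier (invariant_ring G)"
  by (simp_all add: carrier_invariant act_add act_diff act_mult act_hpart)

lemma cring_invariant: "cring (invariant_ring G)"
proof (rule cringI)
  show "abelian_group (invariant_ring G)"
  proof (rule abelian_groupI)
    fix x assume "x \<in> carrier (invariant_ring G)"
    then have "0 - x \<in> carrier (invariant_ring G)" by (intro invariant_closed)
    then show "\<exists>y\<in>carrier (invariant_ring G). y \<oplus>\<^bsub>invariant_ring G\<^esub> x = \<zero>\<^bsub>invariant_ring G\<^esub>"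
      by (intro bexI[of _ "0 - x"]) simp_all
  qed (simp_all add: invariant_closed add_ac)
  show "comm_monoid (invariant_ring G)"
    by (rule comm_monoidI) (simp_all add: invariant_closed mult_ac)
qed (simp_all add: algebra_simps)

lemma act_linear_form:
  fixes c :: "'k::field ^ 'n::finite"
  shows "act g (linear_form c) = linear_form (c v* matrix_inv g)"
proof -
  have "act g (linear_form c) = (\<Sum>i\<in>UNIV. Cst (c $ i) * linear_form (matrix_inv g $ i))"
    by (simp add: linear_form_def[of c] act_sum act_mult) (simp add: act_def poly_subst_Var)
  also have "\<dots> = (\<Sum>i\<in>UNIV. \<Sum>j\<in>UNIV. Cst (c $ i * matrix_inv g $ i $ j) * Var j)"
    by (simp add: linear_form_def sum_distrib_left Cst_mult mult_ac)
  also have "\<dots> = (\<Sum>j\<in>UNIV. \<Sum>i\<in>UNIV. Cst (c $ i * matrix_inv g $ i $ j) * Var j)"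
    by (rule sum.swap)
  also have "\<dots> = linear_form (c v* matrix_inv g)"
  proof -
    show ?thesis
      by (simp add: linear_form_def vector_matrix_mult_def sum_distrib_right Cst_sum mult.commute
        sum_distrib_left)
  qed
  finally show ?thesis .
qed

lemma act_image_linear_form:
  assumes "invertible g"
  shows "act g ` range linear_form = range linear_form"
proof -
  let ?h = "matrix_inv g"
  have "?h ** g = mat 1" "g ** ?h = mat 1"
    using someI_ex[of "\<lambda>A. g ** A = mat 1 \<and> A ** g = mat 1"] assms
    unfolding invertible_def matrix_inv_def by auto
  then have "c = (c v* g) v* ?h" for c
    by (simp add: vector_matrix_mul_assoc)
  then have "linear_form c \<in> act g ` range linear_form" for c
    by (metis act_linear_form rangeI image_eqI)
  then show ?thesis by (auto simp: act_linear_form)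
qed

text \<open>An invertible matrix permutes the linear forms, hence the factors of \<open>\<Prod>v. X + v\<close>, and so it
  fixes the coefficients of this product.\<close>
lemma dickson_invariant:
  fixes G :: "('k::{field,finite} ^ 'n::finite ^ 'n) set"
  assumes "subgroup G GL"
  shows "dickson i \<in> carrier (invariant_ring G)"
  unfolding carrier_invariant
proof
  fix g assume "g \<in> G"
  then have g: "invertible g" using subgroup.subset[OF assms] by (auto simp: GL_def)
  let ?V = "range linear_form :: ('n, 'k) mpol set"
  have map_prod: "map_poly (act g) (\<Prod>v\<in>A. [:v, 1:]) = (\<Prod>v\<in>A. [:act g v, 1:])" for A
  proof -
    have m: "map_poly (act g) (p * q) = map_poly (act g) p * map_poly (act g) q" for p q
      by (rule poly_eqI) (simp add: coeff_map_poly coeff_mult act_sum act_mult)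
    have "map_poly (act g) [:v, 1:] = [:act g v, 1:]" for v
      by (rule poly_eqI) (simp add: coeff_map_poly coeff_pCons split: nat.split)
    note b = this
    show ?thesis
      by (induction A rule: infinite_finite_induct)
        (simp_all only: m b prod.insert prod.empty prod.infinite not_False_eq_True map_poly_1' act_1)
  qed
  have fin: "finite ?V" by simp
  have inj: "inj_on (act g) ?V"
    using act_image_linear_form[OF g] fin by (metis eq_card_imp_inj_on)
  have "map_poly (act g) (\<Prod>v\<in>?V. [:v, 1:]) = (\<Prod>v\<in>act g ` ?V. [:v, 1:])"
    by (simp only: map_prod prod.reindex[OF inj] o_def)
  then have P: "map_poly (act g) (\<Prod>v\<in>?V. [:v, 1:]) = (\<Prod>v\<in>?V. [:v, 1:])"
    by (simp only: act_image_linear_form[OF g])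
  have c: "act g (poly.coeff (\<Prod>v\<in>?V. [:v, 1:]) k) = poly.coeff (\<Prod>v\<in>?V. [:v, 1:]) k" for k
    using coeff_map_poly[of "act g", OF act_0, of "\<Prod>v\<in>?V. [:v, 1:]" k] unfolding P by (rule sym)
  have "act g (- 1) = - 1" using act_diff[of g 0 1] by simp
  then have "act g ((- 1) ^ k) = (- 1) ^ k" for k
    by (simp add: minus_one_power_iff)
  then show "act g (dickson i) = dickson i"
    unfolding dickson_def act_mult c by simp
qed

section \<open>The Koszul complex\<close>

lemma sum_apply: "(\<Sum>i\<in>I. f i) x = (\<Sum>i\<in>I. f i x)"
  by (induction I rule: infinite_finite_induct) simp_all

definition fsmult :: "'a \<Rightarrow> ('j \<Rightarrow> 'a::times) \<Rightarrow> 'j \<Rightarrow> 'a" where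
  "fsmult r f = (\<lambda>J. r * f J)"

lemma fsmult_apply [simp]: "fsmult r f J = r * f J" by (simp add: fsmult_def)

definition koszul_sign :: "nat \<Rightarrow> nat set \<Rightarrow> 'a::comm_ring_1" where
  "koszul_sign j L = (-1) ^ card {i\<in>L. i < j}"

text \<open>An element of the Koszul complex is an element of the exterior algebra on \<open>d\<close> generators:
  \<open>f J\<close> is the coefficient of the wedge product of the generators with index in \<open>J\<close>. The terms of
  the complex are not kept apart; \<open>trunc\<close> gives access to them where the exterior degree matters.\<close>
definition koszul :: "'a::comm_ring_1 set \<Rightarrow> nat \<Rightarrow> (nat set \<Rightarrow> 'a) set" where
  "koszul S d = {f. (\<forall>J. f J \<in> S) \<and> (\<forall>J. \<not> J \<subseteq> {1..d} \<longrightarrow> f J = 0)}"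

text \<open>Contraction with the linear functional that maps the \<open>j\<close>-th generator to \<open>y j\<close>.\<close>
definition koszul_d :: "nat \<Rightarrow> (nat \<Rightarrow> 'a::comm_ring_1) \<Rightarrow> (nat set \<Rightarrow> 'a) \<Rightarrow> nat set \<Rightarrow> 'a" where
  "koszul_d d y f = (\<lambda>L. if L \<subseteq> {1..d}
     then \<Sum>j\<in>{1..d} - L. koszul_sign j L * y j * f (insert j L) else 0)"

text \<open>Exterior multiplication by the \<open>i\<close>-th generator.\<close>
definition koszul_wedge :: "nat \<Rightarrow> (nat set \<Rightarrow> 'a::comm_ring_1) \<Rightarrow> nat set \<Rightarrow> 'a" where
  "koszul_wedge i f = (\<lambda>J. if i \<in> J then koszul_sign i (J - {i}) * f (J - {i}) else 0)"

definition trunc :: "nat \<Rightarrow> (nat set \<Rightarrow> 'a::zero) \<Rightarrow> nat set \<Rightarrow> 'a" where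
  "trunc m f = (\<lambda>J. if card J < m then f J else 0)"

lemma koszul_sign_sq [simp]: "koszul_sign i L * koszul_sign i L = 1"
  by (simp add: koszul_sign_def power_add[symmetric] mult_2[symmetric])

lemma koszul_sign_insert:
  assumes "finite L" "j \<notin> L"
  shows "koszul_sign k (insert j L) = (if j < k then - koszul_sign k L else koszul_sign k L)"
proof -
  have "{i \<in> insert j L. i < k} = (if j < k then insert j {i\<in>L. i < k} else {i\<in>L. i < k})"
    by auto
  then show ?thesis using assms by (simp add: koszul_sign_def)
qed

lemma koszul_sign_swap:
  assumes "finite L" "j \<notin> L" "k \<notin> L" "j \<noteq> k"
  shows "koszul_sign j L * koszul_sign k (insert j L) =
    - (koszul_sign k L * koszul_sign j (insert k L))"
  using assms by (auto simp: koszul_sign_insert)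

lemma sum_antisym_off_diagonal:
  fixes F :: "nat \<Rightarrow> nat \<Rightarrow> 'a::ab_group_add"
  assumes "finite A" "\<And>j k. j \<in> A \<Longrightarrow> k \<in> A \<Longrightarrow> j \<noteq> k \<Longrightarrow> F j k = - F k j"
  shows "(\<Sum>j\<in>A. \<Sum>k\<in>A - {j}. F j k) = 0"
proof -
  have split: "(\<Sum>k\<in>A - {j}. F j k) = (\<Sum>k\<in>{k\<in>A. k < j}. F j k) + (\<Sum>k\<in>{k\<in>A. j < k}. F j k)" for j
  proof -
    have "A - {j} = {k\<in>A. k < j} \<union> {k\<in>A. j < k}" by auto
    then show ?thesis using assms(1) by (simp add: sum.union_disjoint disjoint_iff)
  qed
  have "(\<Sum>j\<in>A. \<Sum>k\<in>{k\<in>A. k < j}. F j k) = (\<Sum>k\<in>A. \<Sum>j\<in>{j\<in>A. k < j}. F j k)"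
    using assms(1) by (rule sum.swap_restrict) (rule assms(1))
  also have "\<dots> = (\<Sum>k\<in>A. \<Sum>j\<in>{j\<in>A. k < j}. - F k j)"
    by (intro sum.cong refl assms(2)) auto
  also have "\<dots> = - (\<Sum>j\<in>A. \<Sum>k\<in>{k\<in>A. j < k}. F j k)"
    by (simp add: sum_negf)
  finally show ?thesis by (simp add: split sum.distrib)
qed

lemma koszul_d_add: "koszul_d d y (f + g) = koszul_d d y f + koszul_d d y g"
  by (auto simp: koszul_d_def fun_eq_iff algebra_simps sum.distrib)

lemma koszul_d_diff: "koszul_d d y (f - g) = koszul_d d y f - koszul_d d y g"
  using koszul_d_add[of d y "f - g" g] by simp

lemma koszul_d_0 [simp]: "koszul_d d y 0 = 0"
  using koszul_d_diff[of d y 0 0] by simp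

lemma koszul_d_fsmult: "koszul_d d y (fsmult r f) = fsmult r (koszul_d d y f)"
  by (auto simp: koszul_d_def fun_eq_iff sum_distrib_left mult_ac intro!: sum.cong)

lemma koszul_d_d: "koszul_d d y (koszul_d d y f) = 0"
proof
  fix L :: "nat set"
  show "koszul_d d y (koszul_d d y f) L = 0 L"
  proof (cases "L \<subseteq> {1..d}")
    case True
    let ?A = "{1..d} - L"
    have fin: "finite L" using True finite_subset by blast
    let ?F = "\<lambda>j k. koszul_sign j L * y j * (koszul_sign k (insert j L) * y k * f (insert k (insert j L)))"
    have "koszul_d d y (koszul_d d y f) L = (\<Sum>j\<in>?A. \<Sum>k\<in>?A - {j}. ?F j k)"
      using True by (auto simp: koszul_d_def sum_distrib_left Diff_insert[symmetric] insert_commute intro!: sum.cong)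
    also have "\<dots> = 0"
    proof (rule sum_antisym_off_diagonal)
      fix j k assume jk: "j \<in> ?A" "k \<in> ?A" "j \<noteq> k"
      have "?F j k = (koszul_sign j L * koszul_sign k (insert j L)) * (y j * y k * f (insert k (insert j L)))"
        by (simp add: mult_ac)
      also have "\<dots> = - ((koszul_sign k L * koszul_sign j (insert k L)) * (y j * y k * f (insert k (insert j L))))"
        using jk fin by (subst koszul_sign_swap) auto
      also have "\<dots> = - ?F k j" by (simp add: mult_ac insert_commute)
      finally show "?F j k = - ?F k j" .
    qed simp
    finally show ?thesis by simp
  qed (simp add: koszul_d_def)
qed

text \<open>Contraction is an antiderivation of the exterior algebra, so exterior multiplication by the
  \<open>i\<close>-th generator is a homotopy between \<open>0\<close> and multiplication by \<open>y i\<close>.\<close>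
lemma koszul_homotopy:
  assumes i: "i \<in> {1..d}" and f: "\<And>J. \<not> J \<subseteq> {1..d} \<Longrightarrow> f J = 0"
  shows "koszul_d d y (koszul_wedge i f) + koszul_wedge i (koszul_d d y f) = fsmult (y i) f"
proof
  fix L :: "nat set"
  show "(koszul_d d y (koszul_wedge i f) + koszul_wedge i (koszul_d d y f)) L = fsmult (y i) f L"
  proof (cases "L \<subseteq> {1..d}")
    case L: True
    have fin: "finite L" using L finite_subset by blast
    show ?thesis
    proof (cases "i \<in> L")
      case False
      have "koszul_d d y (koszul_wedge i f) L =
        (\<Sum>j\<in>{1..d} - L. if j = i then y i * f L else 0)"
      proof -
        have "koszul_sign j L * y j * koszul_wedge i f (insert j L) = (if j = i then y i * f L else 0)"
          if "j \<in> {1..d} - L" for j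
        proof (cases "j = i")
          case True
          have "koszul_sign i L * y i * (koszul_sign i L * f L)
             = (koszul_sign i L * koszul_sign i L) * (y i * f L)" by (simp only: mult_ac)
          then show ?thesis using True False that by (simp add: koszul_wedge_def)
        next
          case j: False
          then show ?thesis using False by (simp add: koszul_wedge_def)
        qed
        then show ?thesis using L by (simp add: koszul_d_def)
      qed
      also have "\<dots> = y i * f L" using i False by simp
      finally show ?thesis using False by (simp add: koszul_wedge_def)
    next
      case True
      define L' where "L' = L - {i}"
      have L': "L = insert i L'" "i \<notin> L'" "finite L'" "L' \<subseteq> {1..d}" using True fin L by (auto simp: L'_def)
      have eq: "{1..d} - L' = insert i ({1..d} - L)" using i L' by auto
      have "koszul_d d y f L' = (\<Sum>j\<in>insert i ({1..d} - L). koszul_sign j L' * y j * f (insert j L'))"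
        using L'(4) by (simp only: koszul_d_def eq if_True)
      also have "\<dots> = koszul_sign i L' * y i * f (insert i L') +
          (\<Sum>j\<in>{1..d} - L. koszul_sign j L' * y j * f (insert j L'))"
        using True by (intro sum.insert) auto
      finally have "koszul_wedge i (koszul_d d y f) L =
         koszul_sign i L' * (koszul_sign i L' * y i * f L +
           (\<Sum>j\<in>{1..d} - L. koszul_sign j L' * y j * f (insert j L')))"
        using True by (simp add: koszul_wedge_def L'_def[symmetric] L'(1)[symmetric])
      also have "\<dots> = (koszul_sign i L' * koszul_sign i L') * (y i * f L) +
         (\<Sum>j\<in>{1..d} - L. koszul_sign i L' * (koszul_sign j L' * y j * f (insert j L')))"
        by (simp only: distrib_left sum_distrib_left mult_ac)
      finally have a: "koszul_wedge i (koszul_d d y f) L = y i * f L +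
         (\<Sum>j\<in>{1..d} - L. koszul_sign i L' * (koszul_sign j L' * y j * f (insert j L')))" by simp
      have b: "koszul_d d y (koszul_wedge i f) L =
        (\<Sum>j\<in>{1..d} - L. - (koszul_sign i L' * (koszul_sign j L' * y j * f (insert j L'))))"
      proof -
        have "koszul_sign j L * y j * koszul_wedge i f (insert j L) =
            - (koszul_sign i L' * (koszul_sign j L' * y j * f (insert j L')))"
          if j: "j \<in> {1..d} - L" for j
        proof -
          have ji: "j \<noteq> i" "j \<notin> L'" using j True L' by auto
          have "insert j L - {i} = insert j L'" using ji L' by auto
          then have "koszul_sign j L * y j * koszul_wedge i f (insert j L)
            = (koszul_sign j (insert i L') * koszul_sign i (insert j L')) * (y j * f (insert j L'))"
            using True by (simp add: koszul_wedge_def L'(1)[symmetric] mult_ac)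
          also have "koszul_sign j (insert i L') * koszul_sign i (insert j L') =
             - (koszul_sign i L' * koszul_sign j L' :: 'a)"
            using ji L' by (auto simp: koszul_sign_insert mult_ac)
          finally show ?thesis by (simp add: mult_ac)
        qed
        then show ?thesis using L by (simp add: koszul_d_def)
      qed
      show ?thesis by (simp add: a b sum_negf)
    qed
  next
    case False
    then have "\<not> L - {i} \<subseteq> {1..d}" using i by auto
    then show ?thesis using False f by (simp add: koszul_d_def koszul_wedge_def)
  qed
qed

lemma trunc_koszul_d: "trunc m (koszul_d d y f) = koszul_d d y (trunc (Suc m) f)"
proof
  fix L :: "nat set"
  show "trunc m (koszul_d d y f) L = koszul_d d y (trunc (Suc m) f) L"
  proof (cases "L \<subseteq> {1..d}")
    case True
    then have "finite L" using finite_subset by blast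
    then have "card (insert j L) = Suc (card L)" if "j \<in> {1..d} - L" for j using that by simp
    then show ?thesis using True by (auto simp: trunc_def koszul_d_def)
  qed (simp add: trunc_def koszul_d_def)
qed

lemma trunc_add: "trunc m (f + g) = trunc m f + trunc m (g :: nat set \<Rightarrow> 'a::monoid_add)"
  and trunc_fsmult: "trunc m (fsmult r h) = fsmult r (trunc m (h :: nat set \<Rightarrow> 'b::mult_zero))"
  and trunc_0: "trunc 0 k = 0" and trunc_trunc [simp]: "trunc m (trunc m k) = trunc m k"
  by (auto simp: trunc_def fun_eq_iff)

locale subring_set =
  fixes S :: "'a::comm_ring_1 set"
  assumes S_0: "0 \<in> S" and S_1: "1 \<in> S" and S_add: "\<And>a b. a \<in> S \<Longrightarrow> b \<in> S \<Longrightarrow> a + b \<in> S"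
    and S_diff: "\<And>a b. a \<in> S \<Longrightarrow> b \<in> S \<Longrightarrow> a - b \<in> S"
    and S_mult: "\<And>a b. a \<in> S \<Longrightarrow> b \<in> S \<Longrightarrow> a * b \<in> S"
begin

lemma S_sum: "(\<And>i. i \<in> I \<Longrightarrow> f i \<in> S) \<Longrightarrow> sum f I \<in> S"
  by (induction I rule: infinite_finite_induct) (auto intro: S_0 S_add)

lemma S_prod: "(\<And>i. i \<in> I \<Longrightarrow> f i \<in> S) \<Longrightarrow> prod f I \<in> S"
  by (induction I rule: infinite_finite_induct) (auto intro: S_1 S_mult)

lemma S_power: "a \<in> S \<Longrightarrow> a ^ k \<in> S"
  by (induction k) (auto intro: S_1 S_mult)

lemma S_sign: "koszul_sign i L \<in> S"
proof -
  have "0 - 1 \<in> S" by (intro S_diff S_0 S_1)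
  then show ?thesis unfolding koszul_sign_def by (intro S_power) simp
qed

lemma koszul_0: "0 \<in> koszul S d"
  and koszul_add: "f \<in> koszul S d \<Longrightarrow> g \<in> koszul S d \<Longrightarrow> f + g \<in> koszul S d"
  and koszul_diff: "f \<in> koszul S d \<Longrightarrow> g \<in> koszul S d \<Longrightarrow> f - g \<in> koszul S d"
  and koszul_fsmult: "r \<in> S \<Longrightarrow> f \<in> koszul S d \<Longrightarrow> fsmult r f \<in> koszul S d"
  and koszul_trunc: "f \<in> koszul S d \<Longrightarrow> trunc m f \<in> koszul S d"
  by (auto simp: koszul_def trunc_def S_0 S_add S_diff S_mult)

lemma koszul_koszul_d:
  assumes "\<And>i. i \<in> {1..d} \<Longrightarrow> y i \<in> S" "f \<in> koszul S d"
  shows "koszul_d d y f \<in> koszul S d"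
  using assms unfolding koszul_def koszul_d_def
  by (auto intro!: S_sum S_mult S_sign S_0)

lemma koszul_koszul_wedge:
  assumes "i \<in> {1..d}" "f \<in> koszul S d"
  shows "koszul_wedge i f \<in> koszul S d"
proof -
  have "\<not> J - {i} \<subseteq> {1..d}" if "\<not> J \<subseteq> {1..d}" for J using that assms(1) by auto
  then show ?thesis
    using assms(2) unfolding koszul_def koszul_wedge_def by (auto intro!: S_mult S_sign S_0)
qed

lemma koszul_cycle_mult:
  assumes "i \<in> {1..d}" "f \<in> koszul S d" "koszul_d d y f = 0"
  shows "koszul_wedge i f \<in> koszul S d" "koszul_d d y (koszul_wedge i f) = fsmult (y i) f"
proof -
  show "koszul_wedge i f \<in> koszul S d" using assms by (intro koszul_koszul_wedge)
  have "koszul_wedge i 0 = (0 :: nat set \<Rightarrow> 'a)" by (simp add: koszul_wedge_def fun_eq_iff)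
  then show "koszul_d d y (koszul_wedge i f) = fsmult (y i) f"
    using koszul_homotopy[of i d f y] assms by (simp add: koszul_def)
qed

end

section \<open>The grading of the Koszul complex and the Artin-Rees property\<close>

definition kpart :: "(nat \<Rightarrow> nat) \<Rightarrow> nat \<Rightarrow> (nat set \<Rightarrow> ('i::finite, 'k::zero) mpol) \<Rightarrow> nat set \<Rightarrow> ('i, 'k) mpol" where
  "kpart n e f = (\<lambda>J. if sum n J \<le> e then hpart (e - sum n J) (f J) else 0)"

lemma kpart_add: "kpart n e (f + g) = kpart n e f + kpart n e g"
  by (auto simp: kpart_def fun_eq_iff hpart_add)

lemma kpart_diff: "kpart n e (f - g) = kpart n e f - kpart n e (g :: _ \<Rightarrow> ('i::finite, 'k::ab_group_add) mpol)"
  by (auto simp: kpart_def fun_eq_iff hpart_diff)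

lemma kpart_0 [simp]: "kpart n e 0 = 0"
  by (auto simp: kpart_def fun_eq_iff)

lemma kpart_sum: "kpart n e (sum f I) = (\<Sum>i\<in>I. kpart n e (f i))"
  by (auto simp: fun_eq_iff kpart_def sum_apply hpart_sum)

lemma kpart_fsmult:
  fixes f :: "nat set \<Rightarrow> ('i::finite, 'k::comm_ring_1) mpol"
  assumes "homogeneous k y"
  shows "kpart n e (fsmult y f) = (if k \<le> e then fsmult y (kpart n (e - k) f) else 0)"
proof
  fix J
  show "kpart n e (fsmult y f) J = (if k \<le> e then fsmult y (kpart n (e - k) f) else 0) J"
  proof (cases "k + sum n J \<le> e")
    case True
    then have "e - sum n J - k = e - k - sum n J" by simp
    then show ?thesis using True by (auto simp: kpart_def hpart_mult[OF assms])
  next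
    case False
    then show ?thesis by (auto simp: kpart_def hpart_mult[OF assms])
  qed
qed

lemma homogeneous_koszul_sign: "homogeneous 0 (koszul_sign j L :: ('i::finite, 'k::comm_ring_1) mpol)"
proof -
  have "homogeneous 0 (-1 :: ('i, 'k) mpol)"
    using homogeneous_Cst[of "-1 :: 'k"] by (simp add: Cst_def single_uminus)
  from homogeneous_power[OF this, of "card {i\<in>L. i < j}"] show ?thesis
    by (simp add: koszul_sign_def)
qed

text \<open>Placing the basis vector of \<open>J\<close> in degree \<open>\<Sum>i\<in>J. n i\<close> makes the differential
  homogeneous of degree \<open>0\<close>.\<close>
lemma kpart_koszul_d:
  fixes f :: "nat set \<Rightarrow> ('i::finite, 'k::comm_ring_1) mpol"
  assumes y: "\<And>j. j \<in> {1..d} \<Longrightarrow> homogeneous (n j) (y j)"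
  shows "kpart n e (koszul_d d y f) = koszul_d d y (kpart n e f)"
proof
  fix L
  show "kpart n e (koszul_d d y f) L = koszul_d d y (kpart n e f) L"
  proof (cases "L \<subseteq> {1..d}")
    case True
    then have fin: "finite L" using finite_subset by blast
    have *: "(if sum n L \<le> e then hpart (e - sum n L) (koszul_sign j L * y j * f (insert j L)) else 0)
        = koszul_sign j L * y j * kpart n e f (insert j L)" if j: "j \<in> {1..d} - L" for j
    proof -
      have hom: "homogeneous (n j) (koszul_sign j L * y j)"
        using homogeneous_mult[OF homogeneous_koszul_sign y[of j]] j by simp
      have s: "sum n (insert j L) = n j + sum n L" using j fin by simp
      show ?thesis
      proof (cases "n j + sum n L \<le> e")
        case True
        then have "e - sum n L - n j = e - (n j + sum n L)" by simp
        then show ?thesis using True by (auto simp: hpart_mult[OF hom] kpart_def s)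
      next
        case False
        then show ?thesis by (auto simp: hpart_mult[OF hom] kpart_def s)
      qed
    qed
    have "kpart n e (koszul_d d y f) L = (\<Sum>j\<in>{1..d} - L.
        if sum n L \<le> e then hpart (e - sum n L) (koszul_sign j L * y j * f (insert j L)) else 0)"
      using True by (simp add: kpart_def koszul_d_def hpart_sum)
    also have "\<dots> = koszul_d d y (kpart n e f) L"
      using True by (simp add: koszul_d_def *)
    finally show ?thesis .
  qed (simp add: kpart_def koszul_d_def)
qed

lemma sum_kpart:
  assumes "\<And>J. deg_le B (f J)" "\<And>J. f J \<noteq> 0 \<Longrightarrow> sum n J \<le> W"
  shows "(\<Sum>e\<le>B + W. kpart n e f) = f"
proof
  fix J
  show "(\<Sum>e\<le>B + W. kpart n e f) J = f J"
  proof (cases "f J = 0")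
    case True
    then have "kpart n e f J = 0" for e by (simp add: kpart_def)
    with True show ?thesis by (simp add: sum_apply)
  next
    case False
    let ?w = "sum n J"
    have w: "?w \<le> W" using assms(2) False by blast
    have "(\<Sum>e\<le>B + W. kpart n e f) J = (\<Sum>e\<in>{?w..B + W}. hpart (e - ?w) (f J))"
      unfolding sum_apply kpart_def by (rule sum.mono_neutral_cong_right) auto
    also have "\<dots> = (\<Sum>e\<le>B + W - ?w. hpart e (f J))"
      by (rule sum.reindex_bij_witness[of _ "\<lambda>e. e + ?w" "\<lambda>e. e - ?w"]) (use w in auto)
    also have "\<dots> = f J"
      by (rule sum_hpart) (rule deg_le_mono[OF assms(1)], use w in simp)
    finally show ?thesis .
  qed
qed

locale graded_subring = subring_set S for S :: "('i::finite, 'k::{field,finite}) mpol set" +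
  assumes S_hpart: "f \<in> S \<Longrightarrow> hpart e f \<in> S" and S_Cst: "Cst c \<in> S"
begin

lemma koszul_kpart: "f \<in> koszul S d \<Longrightarrow> kpart n e f \<in> koszul S d"
  by (auto simp: koszul_def kpart_def S_hpart S_0)

lemma koszul_finite_degree:
  assumes "f \<in> koszul S d" shows "\<exists>B. \<forall>J. deg_le B (f J)"
proof -
  have "\<forall>J. \<exists>b. deg_le b (f J)" using deg_le_exists by blast
  then obtain b where b: "\<And>J. deg_le (b J) (f J)" by metis
  have "deg_le (Max (b ` Pow {1..d})) (f J)" for J
  proof (cases "J \<subseteq> {1..d}")
    case True
    then show ?thesis by (intro deg_le_mono[OF b]) simp
  next
    case False
    then show ?thesis using assms by (simp add: koszul_def)
  qed
  then show ?thesis by blast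
qed

lemma koszul_weight:
  fixes n :: "nat \<Rightarrow> nat"
  assumes "f \<in> koszul S d" "f J \<noteq> 0" shows "sum n J \<le> sum n {1..d}"
proof -
  have "J \<subseteq> {1..d}" using assms by (auto simp: koszul_def)
  then show ?thesis by (intro sum_mono2) auto
qed

lemma finite_koszul_deg_le: "finite {f \<in> koszul S d. \<forall>J. deg_le B (f J)}"
proof (rule inj_on_finite[where f = "\<lambda>f. restrict f (Pow {1..d})"])
  show "inj_on (\<lambda>f. restrict f (Pow {1..d})) {f \<in> koszul S d. \<forall>J. deg_le B (f J)}"
  proof (rule inj_onI)
    fix f g :: "nat set \<Rightarrow> ('i, 'k) mpol"
    assume f: "f \<in> {f \<in> koszul S d. \<forall>J. deg_le B (f J)}"
      and g: "g \<in> {f \<in> koszul S d. \<forall>J. deg_le B (f J)}"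
      and eq: "restrict f (Pow {1..d}) = restrict g (Pow {1..d})"
    show "f = g"
    proof
      fix J show "f J = g J"
        using f g fun_cong[OF eq, of J] by (cases "J \<subseteq> {1..d}") (auto simp: koszul_def)
    qed
  qed
  show "(\<lambda>f. restrict f (Pow {1..d})) ` {f \<in> koszul S d. \<forall>J. deg_le B (f J)}
     \<subseteq> PiE (Pow {1..d}) (\<lambda>_. {f. deg_le B f})"
    by (rule image_subsetI) (rule restrict_PiE_iff[THEN iffD2], simp)
  show "finite (PiE (Pow {1..d}) (\<lambda>_. {f :: ('i, 'k) mpol. deg_le B f}))"
    by (intro finite_PiE finite_deg_le) simp
qed

lemma deg_le_mono_subst:
  fixes d :: nat
  assumes "\<And>j. j \<in> {1..d} \<Longrightarrow> homogeneous (n j) (x j :: ('i, 'k) mpol)"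
    and "keys m \<subseteq> {1..d}" "\<And>j. lookup m j \<le> L"
  shows "deg_le (\<Sum>j\<in>{1..d}. L * n j) (mono_subst x m)"
proof -
  have "finite A \<Longrightarrow> A \<subseteq> {1..d} \<Longrightarrow> deg_le (\<Sum>j\<in>A. L * n j) (\<Prod>j\<in>A. x j ^ lookup m j)" for A
  proof (induction A rule: finite_induct)
    case empty then show ?case by (simp add: homogeneous_deg_le[OF homogeneous_1])
  next
    case (insert a A)
    have "homogeneous (lookup m a * n a) (x a ^ lookup m a)"
      using insert.prems by (intro homogeneous_power assms) simp
    then have "deg_le (lookup m a * n a) (x a ^ lookup m a)" by (rule homogeneous_deg_le)
    then have "deg_le (L * n a) (x a ^ lookup m a)" by (rule deg_le_mono) (simp add: assms(3))
    with insert show ?case by (simp add: deg_le_mult)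
  qed
  from this[of "{1..d}"] show ?thesis
    using mono_subst_superset[of "{1..d}" m x] assms(2) by simp
qed

text \<open>Every monomial in the \<open>x j\<close> is a product of powers of the \<open>x j ^ L\<close> and a monomial with
  exponents at most \<open>L\<close>, and the latter have bounded degree. Hence a module that is finite over the
  algebra generated by the \<open>x j\<close> is generated, under multiplication by the \<open>x j ^ L\<close>, by its
  elements of bounded degree; these form a finite group because the field is finite.\<close>
lemma koszul_subset_op_span:
  fixes x :: "nat \<Rightarrow> ('i, 'k) mpol"
  assumes x: "\<And>j. j \<in> {1..d} \<Longrightarrow> homogeneous (n j) (x j)" "\<And>j. j \<in> {1..d} \<Longrightarrow> x j \<in> S"
    and B: "finite B" "B \<subseteq> S"
      "\<And>f. f \<in> S \<Longrightarrow> \<exists>c. (\<forall>b\<in>B. c b \<in> poly_subst x ` polys_in d) \<and> f = (\<Sum>b\<in>B. c b * b)"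
    and L: "0 < L"
  shows "\<exists>D. koszul S d \<subseteq> op_span ((\<lambda>i. fsmult (x i ^ L)) ` {1..d}) {f \<in> koszul S d. \<forall>J. deg_le D (f J)}"
proof -
  have "\<forall>f :: ('i, 'k) mpol. \<exists>b. deg_le b f" using deg_le_exists by blast
  then obtain b where b: "\<And>f. deg_le (b f) (f :: ('i, 'k) mpol)" by metis
  \<comment> \<open>a bound for the degree of a monomial with exponents at most \<open>L\<close> times an element of \<open>B\<close>\<close>
  define D where "D = (\<Sum>j\<in>{1..d}. L * n j) + Max (b ` B)"
  let ?M = "{f \<in> koszul S d. \<forall>J. deg_le D (f J)}"
  let ?F = "(\<lambda>i. fsmult (x i ^ L)) ` {1..d}"
  let ?W = "op_span ?F ?M"
  define e where "e J f = (\<lambda>J'. if J' = J then f else 0)" for J :: "nat set" and f :: "('i, 'k) mpol"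
  have W: "op_stable ?F ?W" by (rule op_stable_span)
  have W_sum: "(\<And>i. i \<in> I \<Longrightarrow> f i \<in> ?W) \<Longrightarrow> sum f I \<in> ?W" for f and I :: "'z set"
  proof (induction I rule: infinite_finite_induct)
    case (insert i I)
    then have "sum f I \<in> ?W" "f i \<in> ?W" by blast+
    then have "f i + sum f I \<in> ?W" by (rule op_stable_add[OF W, rotated])
    then show ?case by (simp only: sum.insert[OF insert.hyps])
  qed (simp_all only: sum.empty sum.infinite op_span.zero not_False_eq_True)
  have mono_in: "mono_subst x m \<in> S" if "keys m \<subseteq> {1..d}" for m
    using that unfolding mono_subst_def by (intro S_prod S_power x) auto
  have monomial: "e J (Cst c * mono_subst x m * h) \<in> ?W"
    if "keys m \<subseteq> {1..d}" "J \<subseteq> {1..d}" "h \<in> B" for m c J h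
    using that(1)
  proof (induction "\<Sum>j\<in>{1..d}. lookup m j" arbitrary: m rule: less_induct)
    case less
    show ?case
    proof (cases "\<exists>j. L \<le> lookup m j")
      case True
      then obtain j where j: "L \<le> lookup m j" by blast
      then have "j \<in> keys m" using L by (auto simp: in_keys_iff)
      then have jd: "j \<in> {1..d}" using less.prems by auto
      define m' where "m' = m - single j L"
      have m: "m = single j L + m'"
        by (rule poly_mapping_eqI) (use j in \<open>auto simp: m'_def lookup_add lookup_minus lookup_single when_def\<close>)
      have "keys m' \<subseteq> {1..d}"
        using less.prems by (auto simp: m'_def in_keys_iff lookup_minus)
      moreover have "(\<Sum>j\<in>{1..d}. lookup m' j) < (\<Sum>j\<in>{1..d}. lookup m j)"
        by (rule sum_strict_mono_ex1) (use jd j L in \<open>auto simp: m'_def lookup_minus lookup_single when_def intro!: bexI[of _ j]\<close>)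
      ultimately have "e J (Cst c * mono_subst x m' * h) \<in> ?W" using less.hyps by blast
      then have "fsmult (x j ^ L) (e J (Cst c * mono_subst x m' * h)) \<in> ?W"
        by (rule op_span.op[rotated]) (use jd in blast)
      moreover have "mono_subst x (single j L) = x j ^ L" using L by (simp add: mono_subst_def)
      then have "mono_subst x m = x j ^ L * mono_subst x m'" by (simp add: m mono_subst_add)
      then have "fsmult (x j ^ L) (e J (Cst c * mono_subst x m' * h)) = e J (Cst c * mono_subst x m * h)"
        by (simp add: e_def fun_eq_iff mult_ac)
      ultimately show ?thesis by simp
    next
      case False
      then have le: "lookup m j \<le> L" for j by (meson nle_le)
      have "deg_le (b h) h" by (rule b)
      then have "deg_le (Max (b ` B)) h" by (rule deg_le_mono) (use B that in simp)
      then have "deg_le D (mono_subst x m * h)"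
        unfolding D_def by (intro deg_le_mult deg_le_mono_subst x less.prems le) auto
      then have "deg_le (0 + D) (Cst c * (mono_subst x m * h))"
        by (intro deg_le_mult homogeneous_deg_le[OF homogeneous_Cst])
      moreover have "Cst c * (mono_subst x m * h) \<in> S"
        using B(2) that less.prems by (intro S_mult S_Cst mono_in) auto
      ultimately have "e J (Cst c * mono_subst x m * h) \<in> ?M"
        using that(2) by (auto simp: koszul_def e_def S_0 mult.assoc)
      then show ?thesis by (rule op_span.base)
    qed
  qed
  have e_sum: "e J (sum f I) = (\<Sum>i\<in>I. e J (f i))" for J f and I :: "'z set"
    by (simp add: e_def fun_eq_iff sum_apply)
  have single: "e J f \<in> ?W" if "f \<in> S" "J \<subseteq> {1..d}" for J f
  proof -
    obtain c where c: "\<forall>b\<in>B. c b \<in> poly_subst x ` polys_in d" "f = (\<Sum>b\<in>B. c b * b)"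
      using B(3)[OF \<open>f \<in> S\<close>] by blast
    have "e J (c h * h) \<in> ?W" if h: "h \<in> B" for h
    proof -
      obtain p where p: "p \<in> polys_in d" "c h = poly_subst x p" using c(1) h by auto
      have "c h * h = (\<Sum>m\<in>keys p. Cst (lookup p m) * mono_subst x m * h)"
        by (simp add: p poly_subst_eq sum_distrib_right)
      then have "e J (c h * h) = (\<Sum>m\<in>keys p. e J (Cst (lookup p m) * mono_subst x m * h))"
        by (simp only: e_sum)
      also have "\<dots> \<in> ?W"
        using p(1) h \<open>J \<subseteq> {1..d}\<close> by (intro W_sum monomial) (auto simp: polys_in_def)
      finally show ?thesis .
    qed
    then show ?thesis unfolding c(2) e_sum by (rule W_sum)
  qed
  have "f \<in> ?W" if f: "f \<in> koszul S d" for f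
  proof -
    have "f = (\<Sum>J\<in>Pow {1..d}. e J (f J))"
      using f by (auto simp: fun_eq_iff sum_apply e_def koszul_def)
    moreover have "(\<Sum>J\<in>Pow {1..d}. e J (f J)) \<in> ?W"
      using f by (intro W_sum single) (auto simp: koszul_def)
    ultimately show ?thesis by simp
  qed
  then show ?thesis by blast
qed

text \<open>The Artin-Rees property in the graded case. By \<open>op_noetherian\<close>, \<open>Z\<close> has finitely many
  generators under multiplication by the \<open>x i ^ L\<close>. They have no components of degree \<open>M\<close> or more,
  if \<open>M\<close> is large, so in these degrees only multiples of the \<open>x i ^ L\<close> contribute to an element
  of \<open>Z\<close>.\<close>
theorem graded_artin_rees:
  fixes x :: "nat \<Rightarrow> ('i, 'k) mpol"
  assumes x: "\<And>j. j \<in> {1..d} \<Longrightarrow> homogeneous (nx j) (x j)" "\<And>j. j \<in> {1..d} \<Longrightarrow> x j \<in> S"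
    and B: "finite B" "B \<subseteq> S"
      "\<And>f. f \<in> S \<Longrightarrow> \<exists>c. (\<forall>b\<in>B. c b \<in> poly_subst x ` polys_in d) \<and> f = (\<Sum>b\<in>B. c b * b)"
    and L: "0 < L"
    and Z: "Z \<subseteq> koszul S d" "0 \<in> Z" "\<And>f g. f \<in> Z \<Longrightarrow> g \<in> Z \<Longrightarrow> f - g \<in> Z"
      "\<And>r f. r \<in> S \<Longrightarrow> f \<in> Z \<Longrightarrow> fsmult r f \<in> Z" "\<And>e f. f \<in> Z \<Longrightarrow> kpart n e f \<in> Z"
  shows "\<exists>M. \<forall>w\<in>Z. (\<forall>J. deg_ge M (w J)) \<longrightarrow>
    (\<exists>z. (\<forall>i\<in>{1..d}. z i \<in> Z) \<and> w = (\<Sum>i\<in>{1..d}. fsmult (x i ^ L) (z i)))"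
proof -
  let ?F = "(\<lambda>i. fsmult (x i ^ L)) ` {1..d}"
  obtain D where D: "koszul S d \<subseteq> op_span ?F {f \<in> koszul S d. \<forall>J. deg_le D (f J)}"
    using koszul_subset_op_span[OF x B L] by blast
  have Zst: "op_stable ?F Z"
    by (rule op_stableI) (auto intro!: Z S_power x)
  have Zadd: "f + g \<in> Z" if "f \<in> Z" "g \<in> Z" for f g by (rule op_stable_add[OF Zst that])
  have "\<exists>X. finite X \<and> X \<subseteq> Z \<and> Z \<subseteq> op_span ?F X"
  proof (rule op_noetherian)
    show "op_stable {} {f \<in> koszul S d. \<forall>J. deg_le D (f J)}"
      by (auto simp: op_stable_def intro!: koszul_0 koszul_diff deg_le_diff)
    show "Z \<subseteq> op_span ?F {f \<in> koszul S d. \<forall>J. deg_le D (f J)}" using Z(1) D by blast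
  qed (use Zst finite_koszul_deg_le in \<open>auto simp: fun_eq_iff algebra_simps\<close>)
  then obtain X where X: "finite X" "X \<subseteq> Z" "Z \<subseteq> op_span ?F X" by blast
  have "\<forall>f\<in>X. \<exists>B. \<forall>J. deg_le B (f J)" using X(2) Z(1) koszul_finite_degree by blast
  then obtain b where b: "\<And>f J. f \<in> X \<Longrightarrow> deg_le (b f) (f J)" by metis
  \<comment> \<open>the coefficients of the generators have degree at most \<open>Max (b ` X)\<close>, and the basis elements
    contribute at most \<open>sum n {1..d}\<close>\<close>
  define M where "M = Suc (Max (b ` X) + sum n {1..d})"
  have Xpart: "kpart n e f = 0" if "f \<in> X" "M \<le> e" for e f
  proof
    fix J
    show "kpart n e f J = 0 J"
    proof (cases "f J = 0")
      case False
      then have "sum n J \<le> sum n {1..d}" using that X(2) Z(1) koszul_weight by blast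
      moreover have "b f \<le> Max (b ` X)" using X(1) that by simp
      ultimately have "b f < e - sum n J" using that(2) unfolding M_def by linarith
      from hpart_eq_0_deg_le[OF b[OF that(1)] this] show ?thesis by (simp add: kpart_def)
    qed (simp add: kpart_def)
  qed
  have no_part: "fsmult (x i ^ L) 0 = 0" for i by (simp add: fun_eq_iff)
  have zero_sum: "(\<Sum>i\<in>{1..d}. fsmult (x i ^ L) ((\<lambda>_. 0) i)) = 0"
    by (simp only: no_part sum.neutral_const)
  have decomp: "\<exists>h z. (\<forall>e\<ge>M. kpart n e h = 0) \<and> (\<forall>i\<in>{1..d}. z i \<in> Z) \<and>
      w = h + (\<Sum>i\<in>{1..d}. fsmult (x i ^ L) (z i))" if "w \<in> op_span ?F X" for w
    using that
  proof induct
    case zero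
    show ?case
      by (rule exI[of _ 0], rule exI[of _ "\<lambda>_. 0"])
        (simp only: zero_sum Z(2) kpart_0 add_0_right simp_thms ball_triv)
  next
    case (base f)
    then have "\<forall>e\<ge>M. kpart n e f = 0" using Xpart by blast
    then show ?case
      by (intro exI[of _ f] exI[of _ "\<lambda>_. 0"])
        (simp only: zero_sum Z(2) add_0_right simp_thms ball_triv)
  next
    case (diff v w)
    obtain h z where v: "\<forall>e\<ge>M. kpart n e h = 0" "\<forall>i\<in>{1..d}. z i \<in> Z"
      "v = h + (\<Sum>i\<in>{1..d}. fsmult (x i ^ L) (z i))" using diff by blast
    obtain h' z' where w: "\<forall>e\<ge>M. kpart n e h' = 0" "\<forall>i\<in>{1..d}. z' i \<in> Z"
      "w = h' + (\<Sum>i\<in>{1..d}. fsmult (x i ^ L) (z' i))" using diff by blast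
    have "v - w = (h - h') + (\<Sum>i\<in>{1..d}. fsmult (x i ^ L) (z i - z' i))"
      by (simp add: v w fun_eq_iff sum_apply algebra_simps sum_subtractf)
    moreover have "\<forall>e\<ge>M. kpart n e (h - h') = 0" using v w by (simp add: kpart_diff)
    moreover have "\<forall>i\<in>{1..d}. z i - z' i \<in> Z" using v w Z by blast
    ultimately show ?case by (intro exI[of _ "h - h'"] exI[of _ "\<lambda>i. z i - z' i"]) blast
  next
    case (op f w)
    then obtain i where i: "i \<in> {1..d}" "f = fsmult (x i ^ L)" by auto
    have "w \<in> Z" using op(2) op_span_least[OF Zst X(2)] by blast
    then have "\<forall>j\<in>{1..d}. (if j = i then w else 0) \<in> Z" using Z(2) by simp
    moreover have "f w = 0 + (\<Sum>j\<in>{1..d}. fsmult (x j ^ L) (if j = i then w else 0))"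
    proof -
      have "fsmult (x j ^ L) (if j = i then w else 0) = (if j = i then f w else 0)" for j
        by (simp add: i no_part)
      then show ?thesis
        by (simp only: sum.delta finite_atLeastAtMost i(1) if_True add_0_left)
    qed
    moreover have "\<forall>e\<ge>M. kpart n e 0 = 0" by (simp only: kpart_0 simp_thms)
    ultimately show ?case
      by (intro exI[of _ 0] exI[of _ "\<lambda>j. if j = i then w else 0"] conjI)
  qed
  have "\<exists>z. (\<forall>i\<in>{1..d}. z i \<in> Z) \<and> w = (\<Sum>i\<in>{1..d}. fsmult (x i ^ L) (z i))"
    if w: "w \<in> Z" "\<forall>J. deg_ge M (w J)" for w
  proof -
    obtain h z where hz: "\<forall>e\<ge>M. kpart n e h = 0" "\<forall>i\<in>{1..d}. z i \<in> Z"
      "w = h + (\<Sum>i\<in>{1..d}. fsmult (x i ^ L) (z i))" using decomp X(3) w(1) by blast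
    obtain b where b: "\<And>J. deg_le b (w J)" using koszul_finite_degree w(1) Z(1) by blast
    define N where "N = b + sum n {1..d}"
    define z' where "z' i = (\<Sum>e\<in>{e. e \<le> N \<and> M \<le> e \<and> L * nx i \<le> e}. kpart n (e - L * nx i) (z i))" for i
    have "w = (\<Sum>e\<le>N. kpart n e w)"
      unfolding N_def using w(1) Z(1) b by (intro sum_kpart[symmetric] koszul_weight) auto
    also have "\<dots> = (\<Sum>e\<in>{e. e \<le> N \<and> M \<le> e}. kpart n e w)"
    proof (rule sum.mono_neutral_right)
      show "\<forall>e\<in>{..N} - {e. e \<le> N \<and> M \<le> e}. kpart n e w = 0"
      proof
        fix e assume "e \<in> {..N} - {e. e \<le> N \<and> M \<le> e}"
        then have "e < M" by auto
        then have "hpart (e - k) (w J) = 0" for k J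
          using w(2) hpart_eq_0_deg_ge[of M "w J" "e - k"] by auto
        then show "kpart n e w = 0" by (auto simp: kpart_def fun_eq_iff)
      qed
    qed auto
    also have "\<dots> = (\<Sum>e\<in>{e. e \<le> N \<and> M \<le> e}. \<Sum>i\<in>{1..d}.
        if L * nx i \<le> e then fsmult (x i ^ L) (kpart n (e - L * nx i) (z i)) else 0)"
    proof (intro sum.cong refl)
      fix e assume "e \<in> {e. e \<le> N \<and> M \<le> e}"
      then have "kpart n e w = (\<Sum>i\<in>{1..d}. kpart n e (fsmult (x i ^ L) (z i)))"
        using hz by (simp add: kpart_add kpart_sum)
      then show "kpart n e w = (\<Sum>i\<in>{1..d}.
          if L * nx i \<le> e then fsmult (x i ^ L) (kpart n (e - L * nx i) (z i)) else 0)"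
        by (simp only:) (intro sum.cong refl kpart_fsmult homogeneous_power x)
    qed
    also have "\<dots> = (\<Sum>i\<in>{1..d}. \<Sum>e\<in>{e. e \<le> N \<and> M \<le> e}.
        if L * nx i \<le> e then fsmult (x i ^ L) (kpart n (e - L * nx i) (z i)) else 0)"
      by (rule sum.swap)
    also have "\<dots> = (\<Sum>i\<in>{1..d}. fsmult (x i ^ L) (z' i))"
    proof (intro sum.cong refl)
      fix i
      have "(\<Sum>e\<in>{e. e \<le> N \<and> M \<le> e}.
        if L * nx i \<le> e then fsmult (x i ^ L) (kpart n (e - L * nx i) (z i)) else 0)
        = (\<Sum>e\<in>{e. e \<le> N \<and> M \<le> e \<and> L * nx i \<le> e}. fsmult (x i ^ L) (kpart n (e - L * nx i) (z i)))"
        by (rule sum.mono_neutral_cong_right) auto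
      also have "\<dots> = fsmult (x i ^ L) (z' i)"
        by (simp add: z'_def fun_eq_iff sum_apply sum_distrib_left)
      finally show "(\<Sum>e\<in>{e. e \<le> N \<and> M \<le> e}.
        if L * nx i \<le> e then fsmult (x i ^ L) (kpart n (e - L * nx i) (z i)) else 0) =
        fsmult (x i ^ L) (z' i)" .
    qed
    finally have "w = (\<Sum>i\<in>{1..d}. fsmult (x i ^ L) (z' i))" .
    moreover have "z' i \<in> Z" if "i \<in> {1..d}" for i
    proof -
      have "sum f I \<in> Z" if "\<And>e. e \<in> I \<Longrightarrow> f e \<in> Z" for f and I :: "nat set"
        using that
      proof (induction I rule: infinite_finite_induct)
        case (insert i I)
        then have "sum f I \<in> Z" "f i \<in> Z" by blast+
        then have "f i + sum f I \<in> Z" by (rule Zadd[rotated])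
        then show ?case by (simp only: sum.insert[OF insert.hyps])
      qed (simp_all only: sum.empty sum.infinite Z(2) not_False_eq_True)
      moreover have "kpart n e (z i) \<in> Z" for e using Z(5) hz(2) that by blast
      ultimately show ?thesis unfolding z'_def by simp
    qed
    ultimately show ?thesis by blast
  qed
  then show ?thesis by blast
qed

end

section \<open>Module homomorphisms and injective modules\<close>

lemma (in abelian_group) minus_zero_eq: "\<ominus> \<zero> = \<zero>"
  by (metis a_inv_closed l_neg r_zero zero_closed)

lemma (in abelian_group) eq_if_minus_eq_zero:
  assumes "a \<ominus> b = \<zero>" "a \<in> carrier G" "b \<in> carrier G" shows "a = b"
  using assms minus_equality[of a "\<ominus> b"] by (simp add: a_minus_def)

lemma mod_hom_iff:
  "h \<in> mod_hom R M N \<longleftrightarrow>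
    (\<forall>x\<in>carrier M. h x \<in> carrier N) \<and>
    (\<forall>x\<in>carrier M. \<forall>y\<in>carrier M. h (x \<oplus>\<^bsub>M\<^esub> y) = h x \<oplus>\<^bsub>N\<^esub> h y) \<and>
    (\<forall>r\<in>carrier R. \<forall>x\<in>carrier M. h (r \<odot>\<^bsub>M\<^esub> x) = r \<odot>\<^bsub>N\<^esub> h x)"
  by (auto simp: mod_hom_def hom_def)

lemma mod_hom_closed: "h \<in> mod_hom R M N \<Longrightarrow> x \<in> carrier M \<Longrightarrow> h x \<in> carrier N"
  and mod_hom_add: "h \<in> mod_hom R M N \<Longrightarrow> x \<in> carrier M \<Longrightarrow> y \<in> carrier M \<Longrightarrow>
    h (x \<oplus>\<^bsub>M\<^esub> y) = h x \<oplus>\<^bsub>N\<^esub> h y"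
  and mod_hom_smult: "h \<in> mod_hom R M N \<Longrightarrow> r \<in> carrier R \<Longrightarrow> x \<in> carrier M \<Longrightarrow>
    h (r \<odot>\<^bsub>M\<^esub> x) = r \<odot>\<^bsub>N\<^esub> h x"
  by (auto simp: mod_hom_iff)

lemma mod_hom_zero:
  assumes "Module.module R M" "Module.module R N" "h \<in> mod_hom R M N"
  shows "h \<zero>\<^bsub>M\<^esub> = \<zero>\<^bsub>N\<^esub>"
proof -
  interpret M: Module.module R M by fact
  interpret N: Module.module R N by fact
  have "h (\<zero>\<^bsub>R\<^esub> \<odot>\<^bsub>M\<^esub> \<zero>\<^bsub>M\<^esub>) = \<zero>\<^bsub>R\<^esub> \<odot>\<^bsub>N\<^esub> h \<zero>\<^bsub>M\<^esub>"
    by (rule mod_hom_smult[OF assms(3)]) auto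
  then show ?thesis using mod_hom_closed[OF assms(3), of "\<zero>\<^bsub>M\<^esub>"] by simp
qed

lemma mod_hom_minus:
  assumes "Module.module R M" "Module.module R N" "h \<in> mod_hom R M N" "x \<in> carrier M" "y \<in> carrier M"
  shows "h (x \<ominus>\<^bsub>M\<^esub> y) = h x \<ominus>\<^bsub>N\<^esub> h y"
proof -
  interpret M: Module.module R M by fact
  interpret N: Module.module R N by fact
  have "h (\<ominus>\<^bsub>M\<^esub> y) = h ((\<ominus>\<^bsub>R\<^esub> \<one>\<^bsub>R\<^esub>) \<odot>\<^bsub>M\<^esub> y)" using assms by (simp add: M.smult_l_minus)
  also have "\<dots> = \<ominus>\<^bsub>N\<^esub> h y"
    using assms by (simp add: mod_hom_smult[OF assms(3)] N.smult_l_minus mod_hom_closed[OF assms(3)])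
  finally show ?thesis
    using assms by (simp add: a_minus_def mod_hom_add[OF assms(3)])
qed

lemma mod_hom_comp:
  "g \<in> mod_hom R N P \<Longrightarrow> f \<in> mod_hom R M N \<Longrightarrow> (\<lambda>x. g (f x)) \<in> mod_hom R M P"
  by (simp add: mod_hom_iff)

lemma mod_hom_diff:
  assumes "Module.module R M" "Module.module R N" "f \<in> mod_hom R M N" "g \<in> mod_hom R M N"
  shows "(\<lambda>x. f x \<ominus>\<^bsub>N\<^esub> g x) \<in> mod_hom R M N"
proof -
  interpret N: Module.module R N by fact
  have fg: "f x \<in> carrier N" "g x \<in> carrier N" if "x \<in> carrier M" for x
    using assms that by (auto simp: mod_hom_closed)
  show ?thesis
    unfolding mod_hom_iff
  proof (intro conjI ballI)
    fix x y assume "x \<in> carrier M" "y \<in> carrier M"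
    then show "f (x \<oplus>\<^bsub>M\<^esub> y) \<ominus>\<^bsub>N\<^esub> g (x \<oplus>\<^bsub>M\<^esub> y) = (f x \<ominus>\<^bsub>N\<^esub> g x) \<oplus>\<^bsub>N\<^esub> (f y \<ominus>\<^bsub>N\<^esub> g y)"
      using fg by (simp add: mod_hom_add[OF assms(3)] mod_hom_add[OF assms(4)] a_minus_def
          N.M.minus_add N.M.a_ac)
  next
    fix r x assume "r \<in> carrier R" "x \<in> carrier M"
    then show "f (r \<odot>\<^bsub>M\<^esub> x) \<ominus>\<^bsub>N\<^esub> g (r \<odot>\<^bsub>M\<^esub> x) = r \<odot>\<^bsub>N\<^esub> (f x \<ominus>\<^bsub>N\<^esub> g x)"
      using fg by (simp add: mod_hom_smult[OF assms(3)] mod_hom_smult[OF assms(4)] a_minus_def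
          N.smult_r_distr N.smult_r_minus)
  qed (use fg in simp)
qed

lemma mod_hom_scale:
  assumes "Module.module R N" "f \<in> mod_hom R M N" "c \<in> carrier R"
  shows "(\<lambda>x. c \<odot>\<^bsub>N\<^esub> f x) \<in> mod_hom R M N"
proof -
  interpret N: Module.module R N by fact
  have f: "f x \<in> carrier N" if "x \<in> carrier M" for x using assms that by (auto simp: mod_hom_closed)
  show ?thesis
    unfolding mod_hom_iff
  proof (intro conjI ballI)
    fix r x assume r: "r \<in> carrier R" "x \<in> carrier M"
    have "c \<odot>\<^bsub>N\<^esub> (r \<odot>\<^bsub>N\<^esub> f x) = r \<odot>\<^bsub>N\<^esub> (c \<odot>\<^bsub>N\<^esub> f x)"
      using r f assms(3) by (simp add: N.smult_assoc1[symmetric] N.R.m_comm)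
    then show "c \<odot>\<^bsub>N\<^esub> f (r \<odot>\<^bsub>M\<^esub> x) = r \<odot>\<^bsub>N\<^esub> (c \<odot>\<^bsub>N\<^esub> f x)"
      using r by (simp add: mod_hom_smult[OF assms(2)])
  qed (use f assms(3) in \<open>simp_all add: mod_hom_add[OF assms(2)] N.smult_r_distr\<close>)
qed

text \<open>The structure of \<open>K\<close> carried over to the image of \<open>K\<close> under \<open>\<phi>\<close>, with inverse \<open>\<psi>\<close>.\<close>
definition transported :: "('m \<Rightarrow> 'a) \<Rightarrow> ('a \<Rightarrow> 'm) \<Rightarrow> ('r, 'm) module \<Rightarrow> ('r, 'a) module" where
  "transported \<phi> \<psi> K =
     \<lparr>carrier = \<phi> ` carrier K, mult = undefined, one = undefined, zero = \<phi> \<zero>\<^bsub>K\<^esub>,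
      add = (\<lambda>a b. \<phi> (\<psi> a \<oplus>\<^bsub>K\<^esub> \<psi> b)), smult = (\<lambda>r a. \<phi> (r \<odot>\<^bsub>K\<^esub> \<psi> a))\<rparr>"

lemma transported_module:
  assumes "Module.module R K" "\<And>x. x \<in> carrier K \<Longrightarrow> \<psi> (\<phi> x) = x"
  shows "Module.module R (transported \<phi> \<psi> K)"
proof -
  interpret K: Module.module R K by fact
  note [simp] = assms(2)
  show ?thesis
  proof (rule moduleI)
    show "cring R" by (rule K.R.is_cring)
    show "abelian_group (transported \<phi> \<psi> K)"
    proof (rule abelian_groupI)
      fix x assume "x \<in> carrier (transported \<phi> \<psi> K)"
      then obtain y where y: "y \<in> carrier K" "x = \<phi> y" by (auto simp: transported_def)
      then show "\<exists>y\<in>carrier (transported \<phi> \<psi> K). y \<oplus>\<^bsub>transported \<phi> \<psi> K\<^esub> x = \<zero>\<^bsub>transported \<phi> \<psi> K\<^esub>"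
        by (intro bexI[of _ "\<phi> (\<ominus>\<^bsub>K\<^esub> y)"]) (auto simp: transported_def K.M.l_neg)
    qed (auto simp: transported_def K.M.a_ac)
  qed (auto simp: transported_def K.smult_l_distr K.smult_r_distr K.smult_assoc1)
qed

text \<open>The lifting property that defines \<open>injective_module\<close> is about modules whose elements have the
  type of the ring. An injection of \<open>K\<close> into this type makes it applicable to \<open>K\<close>.\<close>
lemma injective_module_extend:
  fixes R :: "('a, 'c) ring_scheme" and E :: "('a, 'b) module" and K :: "('a, 'm) module"
    and \<phi> :: "'m \<Rightarrow> 'a"
  assumes "injective_module R E" "Module.module R K" "inj_on \<phi> (carrier K)"
    and "submodule A R K" "f \<in> mod_hom R (K\<lparr>carrier := A\<rparr>) E"
  shows "\<exists>g \<in> mod_hom R K E. \<forall>x\<in>A. g x = f x"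
proof -
  interpret K: Module.module R K by fact
  let ?A = "K\<lparr>carrier := A\<rparr>"
  define \<psi> where "\<psi> = inv_into (carrier K) \<phi>"
  have \<psi>: "\<psi> (\<phi> x) = x" if "x \<in> carrier K" for x
    using that assms(3) by (simp add: \<psi>_def)
  have A: "A \<subseteq> carrier K" "Module.module R ?A"
    using K.submoduleE(1) submodule.submodule_is_module assms(2,4) by blast+
  have "Module.module R (transported \<phi> \<psi> ?A)"
    using A \<psi> by (intro transported_module) auto
  moreover have "Module.module R (transported \<phi> \<psi> K)"
    using assms(2) \<psi> by (intro transported_module) auto
  moreover have "id \<in> mod_hom R (transported \<phi> \<psi> ?A) (transported \<phi> \<psi> K)"
    using A(1) by (auto simp: mod_hom_iff transported_def)
  moreover have "inj_on id (carrier (transported \<phi> \<psi> ?A))" by simp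
  moreover have "(\<lambda>a. f (\<psi> a)) \<in> mod_hom R (transported \<phi> \<psi> ?A) E"
  proof -
    interpret A: Module.module R ?A by fact
    have *: "x \<oplus>\<^bsub>K\<^esub> y \<in> A" "r \<odot>\<^bsub>K\<^esub> x \<in> A" if "x \<in> A" "y \<in> A" "r \<in> carrier R" for x y r
      using K.submoduleE[OF assms(4)] that by auto
    show ?thesis
      unfolding mod_hom_iff
    proof (intro conjI ballI)
      fix a b assume "a \<in> carrier (transported \<phi> \<psi> ?A)" "b \<in> carrier (transported \<phi> \<psi> ?A)"
      then obtain x y where "x \<in> A" "y \<in> A" "a = \<phi> x" "b = \<phi> y" by (auto simp: transported_def)
      then show "f (\<psi> (a \<oplus>\<^bsub>transported \<phi> \<psi> ?A\<^esub> b)) = f (\<psi> a) \<oplus>\<^bsub>E\<^esub> f (\<psi> b)"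
        using A(1) mod_hom_add[OF assms(5), of x y] by (simp add: transported_def \<psi> subset_iff)
    next
      fix r a assume "r \<in> carrier R" "a \<in> carrier (transported \<phi> \<psi> ?A)"
      then obtain x where "x \<in> A" "a = \<phi> x" "r \<in> carrier R" by (auto simp: transported_def)
      then show "f (\<psi> (r \<odot>\<^bsub>transported \<phi> \<psi> ?A\<^esub> a)) = r \<odot>\<^bsub>E\<^esub> f (\<psi> a)"
        using A(1) mod_hom_smult[OF assms(5), of r x] by (simp add: transported_def \<psi> subset_iff)
    next
      fix a assume "a \<in> carrier (transported \<phi> \<psi> ?A)"
      then obtain x where "x \<in> A" "a = \<phi> x" by (auto simp: transported_def)
      then show "f (\<psi> a) \<in> carrier E"
        using A(1) mod_hom_closed[OF assms(5), of x] by (simp add: \<psi> subset_iff)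
    qed
  qed
  ultimately obtain g where g: "g \<in> mod_hom R (transported \<phi> \<psi> K) E"
    "\<forall>a\<in>carrier (transported \<phi> \<psi> ?A). g (id a) = f (\<psi> a)"
    using assms(1) unfolding injective_module_def by blast
  have "(\<lambda>x. g (\<phi> x)) \<in> mod_hom R K E"
  proof -
    have "\<phi> \<in> mod_hom R K (transported \<phi> \<psi> K)"
      by (auto simp: mod_hom_iff transported_def \<psi>)
    from mod_hom_comp[OF g(1) this] show ?thesis .
  qed
  moreover have "g (\<phi> x) = f x" if "x \<in> A" for x
    using g(2) that A(1) \<psi> by (auto simp: transported_def)
  ultimately show ?thesis by (intro bexI[of _ "\<lambda>x. g (\<phi> x)"] ballI)
qed

text \<open>A homomorphism on a submodule is given here by its graph \<open>\<Gamma>\<close>. This suits homomorphisms on a sum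
  or on an image, which are well defined only after a choice of summands or preimages.\<close>
lemma injective_module_extend_graph:
  fixes R :: "('a, 'c) ring_scheme" and E :: "('a, 'b) module" and K :: "('a, 'm) module"
    and \<phi> :: "'m \<Rightarrow> 'a"
  assumes E: "injective_module R E" and K: "Module.module R K" and \<phi>: "inj_on \<phi> (carrier K)"
    and \<Gamma>: "\<Gamma> \<subseteq> carrier K \<times> carrier E" "(\<zero>\<^bsub>K\<^esub>, \<zero>\<^bsub>E\<^esub>) \<in> \<Gamma>"
      "\<And>x e y f. (x, e) \<in> \<Gamma> \<Longrightarrow> (y, f) \<in> \<Gamma> \<Longrightarrow> (x \<oplus>\<^bsub>K\<^esub> y, e \<oplus>\<^bsub>E\<^esub> f) \<in> \<Gamma>"
      "\<And>r x e. r \<in> carrier R \<Longrightarrow> (x, e) \<in> \<Gamma> \<Longrightarrow> (r \<odot>\<^bsub>K\<^esub> x, r \<odot>\<^bsub>E\<^esub> e) \<in> \<Gamma>"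
      "\<And>e. (\<zero>\<^bsub>K\<^esub>, e) \<in> \<Gamma> \<Longrightarrow> e = \<zero>\<^bsub>E\<^esub>"
  shows "\<exists>g \<in> mod_hom R K E. \<forall>(x, e)\<in>\<Gamma>. g x = e"
proof -
  interpret K: Module.module R K by fact
  interpret E: Module.module R E using E by (simp add: injective_module_def)
  have single_valued: "e = f" if "(x, e) \<in> \<Gamma>" "(x, f) \<in> \<Gamma>" for x e f
  proof -
    have car: "x \<in> carrier K" "e \<in> carrier E" "f \<in> carrier E" using \<Gamma>(1) that by auto
    have "((\<ominus>\<^bsub>R\<^esub> \<one>\<^bsub>R\<^esub>) \<odot>\<^bsub>K\<^esub> x, (\<ominus>\<^bsub>R\<^esub> \<one>\<^bsub>R\<^esub>) \<odot>\<^bsub>E\<^esub> f) \<in> \<Gamma>" using that by (intro \<Gamma>(4)) auto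
    then have "(\<ominus>\<^bsub>K\<^esub> x, \<ominus>\<^bsub>E\<^esub> f) \<in> \<Gamma>" using car by (simp add: K.smult_l_minus E.smult_l_minus)
    from \<Gamma>(3)[OF that(1) this] have "e \<oplus>\<^bsub>E\<^esub> \<ominus>\<^bsub>E\<^esub> f = \<zero>\<^bsub>E\<^esub>"
      using car by (intro \<Gamma>(5)) (simp add: K.M.r_neg)
    then show ?thesis using car by (metis E.M.minus_equality E.M.a_inv_closed E.M.minus_minus)
  qed
  define A where "A = fst ` \<Gamma>"
  define f where "f x = (THE e. (x, e) \<in> \<Gamma>)" for x
  have f: "f x = e" if "(x, e) \<in> \<Gamma>" for x e
    unfolding f_def using that single_valued by (intro the_equality) auto
  have A: "x \<in> A \<longleftrightarrow> (x, f x) \<in> \<Gamma>" for x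
    using f by (force simp: A_def)
  have AI: "x \<in> A" if "(x, e) \<in> \<Gamma>" for x e
    using that by (force simp: A_def)
  have "submodule A R K"
  proof (rule K.submoduleI)
    show sub: "A \<subseteq> carrier K" using \<Gamma>(1) by (auto simp: A_def)
    fix a assume a: "a \<in> A"
    then have "((\<ominus>\<^bsub>R\<^esub> \<one>\<^bsub>R\<^esub>) \<odot>\<^bsub>K\<^esub> a, (\<ominus>\<^bsub>R\<^esub> \<one>\<^bsub>R\<^esub>) \<odot>\<^bsub>E\<^esub> f a) \<in> \<Gamma>" using A by (intro \<Gamma>(4)) auto
    then show "\<ominus>\<^bsub>K\<^esub> a \<in> A" using AI a sub by (auto simp: K.smult_l_minus)
  next
    show "\<zero>\<^bsub>K\<^esub> \<in> A" by (rule AI[OF \<Gamma>(2)])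
  next
    fix a b assume "a \<in> A" "b \<in> A"
    then show "a \<oplus>\<^bsub>K\<^esub> b \<in> A" unfolding A by (rule AI[OF \<Gamma>(3), unfolded A])
  next
    fix r a assume "r \<in> carrier R" "a \<in> A"
    then show "r \<odot>\<^bsub>K\<^esub> a \<in> A" unfolding A by (rule AI[OF \<Gamma>(4), unfolded A])
  qed
  moreover have "f \<in> mod_hom R (K\<lparr>carrier := A\<rparr>) E"
    unfolding mod_hom_iff
  proof (intro conjI ballI)
    fix x assume "x \<in> carrier (K\<lparr>carrier := A\<rparr>)"
    then show "f x \<in> carrier E" using A \<Gamma>(1) by auto
  next
    fix x y assume "x \<in> carrier (K\<lparr>carrier := A\<rparr>)" "y \<in> carrier (K\<lparr>carrier := A\<rparr>)"
    then show "f (x \<oplus>\<^bsub>K\<lparr>carrier := A\<rparr>\<^esub> y) = f x \<oplus>\<^bsub>E\<^esub> f y" using A \<Gamma>(3) by (auto intro!: f)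
  next
    fix r x assume "r \<in> carrier R" "x \<in> carrier (K\<lparr>carrier := A\<rparr>)"
    then show "f (r \<odot>\<^bsub>K\<lparr>carrier := A\<rparr>\<^esub> x) = r \<odot>\<^bsub>E\<^esub> f x" using A \<Gamma>(4) by (auto intro!: f)
  qed
  ultimately obtain g where "g \<in> mod_hom R K E" "\<forall>x\<in>A. g x = f x"
    using injective_module_extend[OF E K \<phi>] by blast
  then show ?thesis using f by (force simp: A_def)
qed

section \<open>Submodules, subquotients and torsion\<close>

lemma (in Module.module) submodule_zero: "submodule B R M \<Longrightarrow> \<zero>\<^bsub>M\<^esub> \<in> B"
  using subgroup.one_closed[OF submodule.axioms(1)] by fastforce

lemma (in Module.module) submodule_minus:
  assumes "submodule B R M" "a \<in> B" "b \<in> B" shows "a \<ominus>\<^bsub>M\<^esub> b \<in> B"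
  unfolding a_minus_def using submoduleE(3,5)[OF assms(1)] assms by blast

lemma ideal_power_0: "ideal_power R I 0 = carrier R"
  and ideal_power_Suc: "ideal_power R I (Suc n) = ideal_prod R (ideal_power R I n) I"
  by (simp_all add: ideal_power_def nat_pow_def ideals_set_def)

lemma (in ring) ideal_power_ideal: "ideal I R \<Longrightarrow> ideal (ideal_power R I n) R"
  by (induction n) (simp_all add: ideal_power_0 ideal_power_Suc oneideal ideal_prod_is_ideal)

lemma (in ring) ideal_power_antimono:
  assumes "ideal I R" "m \<le> n" shows "ideal_power R I n \<subseteq> ideal_power R I m"
proof -
  have "ideal_power R I (Suc k) \<subseteq> ideal_power R I k" for k
    using ideal_prod_inter[OF ideal_power_ideal[OF assms(1)] assms(1), of k]
    by (simp add: ideal_power_Suc)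
  then show ?thesis using assms(2) by (rule lift_Suc_antimono_le)
qed

lemma a_rcosets_carrier_update: "a_rcosets\<^bsub>M\<lparr>carrier := Z\<rparr>\<^esub> B = {B +>\<^bsub>M\<^esub> z | z. z \<in> Z}"
  by (auto simp: A_RCOSETS_def' a_r_coset_def')

lemma annihilator_subquotientD:
  assumes "Module.module R M" "submodule B R M" "Z \<subseteq> carrier M"
    and c: "c \<in> annihilator R (subquotient M Z B)" and z: "z \<in> Z"
  shows "c \<odot>\<^bsub>M\<^esub> z \<in> B"
proof -
  interpret M: Module.module R M by fact
  have c': "c \<in> carrier R" using c by (simp add: annihilator_def)
  have z': "z \<in> carrier M" "\<zero>\<^bsub>M\<^esub> \<in> B" using assms M.submodule_zero by auto
  have mem: "x \<in> B +>\<^bsub>M\<^esub> x" if "x \<in> carrier M" for x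
    using z'(2) that M.M.l_zero[OF that] by (force simp: a_r_coset_def')
  have "(\<Union>x\<in>B +>\<^bsub>M\<^esub> z. B +>\<^bsub>M\<^esub> (c \<odot>\<^bsub>M\<^esub> x)) = B"
    using c z by (auto simp: annihilator_def subquotient_def a_rcosets_carrier_update)
  then have "B +>\<^bsub>M\<^esub> (c \<odot>\<^bsub>M\<^esub> z) \<subseteq> B" using mem[OF z'(1)] by blast
  then show ?thesis using mem[of "c \<odot>\<^bsub>M\<^esub> z"] c' z'(1) by auto
qed

lemma annihilator_subquotientI:
  assumes "Module.module R M" "submodule B R M" "Z \<subseteq> carrier M"
    and c: "c \<in> carrier R" "\<And>z. z \<in> Z \<Longrightarrow> c \<odot>\<^bsub>M\<^esub> z \<in> B"
  shows "c \<in> annihilator R (subquotient M Z B)"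
proof -
  interpret M: Module.module R M by fact
  have B: "B \<subseteq> carrier M" using M.submoduleE(1)[OF assms(2)] .
  have coset: "B +>\<^bsub>M\<^esub> b = B" if b: "b \<in> B" for b
  proof
    show "B +>\<^bsub>M\<^esub> b \<subseteq> B" using M.submoduleE(5)[OF assms(2)] b by (auto simp: a_r_coset_def')
    show "B \<subseteq> B +>\<^bsub>M\<^esub> b"
    proof
      fix a assume a: "a \<in> B"
      have "(a \<ominus>\<^bsub>M\<^esub> b) \<oplus>\<^bsub>M\<^esub> b = a" using a b B by (simp add: a_minus_def M.M.a_assoc M.M.l_neg subset_iff)
      then show "a \<in> B +>\<^bsub>M\<^esub> b"
        using M.submodule_minus[OF assms(2) a b] by (force simp: a_r_coset_def')
    qed
  qed
  have "(\<Union>x\<in>B +>\<^bsub>M\<^esub> z. B +>\<^bsub>M\<^esub> (c \<odot>\<^bsub>M\<^esub> x)) = B" if z: "z \<in> Z" for z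
  proof -
    have "c \<odot>\<^bsub>M\<^esub> x \<in> B" if "x \<in> B +>\<^bsub>M\<^esub> z" for x
    proof -
      obtain b where b: "b \<in> B" "x = b \<oplus>\<^bsub>M\<^esub> z" using \<open>x \<in> B +>\<^bsub>M\<^esub> z\<close> by (auto simp: a_r_coset_def')
      have "c \<odot>\<^bsub>M\<^esub> x = c \<odot>\<^bsub>M\<^esub> b \<oplus>\<^bsub>M\<^esub> c \<odot>\<^bsub>M\<^esub> z"
        unfolding b(2) using b(1) B assms(3) z c(1) by (intro M.smult_r_distr) auto
      then show ?thesis using M.submoduleE(4,5)[OF assms(2)] b(1) c(1) c(2)[OF z] by simp
    qed
    then have "B +>\<^bsub>M\<^esub> (c \<odot>\<^bsub>M\<^esub> x) = B" if "x \<in> B +>\<^bsub>M\<^esub> z" for x using coset that by blast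
    moreover have "B +>\<^bsub>M\<^esub> z \<noteq> {}" using M.submodule_zero[OF assms(2)] by (auto simp: a_r_coset_def')
    ultimately show ?thesis by simp
  qed
  then show ?thesis using c(1) by (auto simp: annihilator_def subquotient_def a_rcosets_carrier_update)
qed

lemma mod_hom_image_submodule:
  assumes M: "Module.module R M" and N: "Module.module R N" and h: "h \<in> mod_hom R M N"
    and B: "submodule B R M"
  shows "submodule (h ` B) R N"
proof -
  interpret M: Module.module R M by (rule M)
  interpret N: Module.module R N by (rule N)
  have car: "x \<in> carrier M" if "x \<in> B" for x using M.submoduleE(1)[OF B] that by blast
  show ?thesis
  proof (rule N.submoduleI)
    show "h ` B \<subseteq> carrier N" using car mod_hom_closed[OF h] by blast
    show "\<zero>\<^bsub>N\<^esub> \<in> h ` B"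
      using mod_hom_zero[OF M N h] M.submodule_zero[OF B] by (metis imageI)
    fix a assume "a \<in> h ` B"
    then obtain x where x: "x \<in> B" "a = h x" by blast
    have "h (\<zero>\<^bsub>M\<^esub> \<ominus>\<^bsub>M\<^esub> x) = \<ominus>\<^bsub>N\<^esub> a"
      using mod_hom_closed[OF h car[OF x(1)]] mod_hom_zero[OF M N h]
      by (simp only: mod_hom_minus[OF M N h M.M.zero_closed car[OF x(1)]] x(2)) (simp add: a_minus_def)
    then show "\<ominus>\<^bsub>N\<^esub> a \<in> h ` B"
      using M.submodule_minus[OF B M.submodule_zero[OF B] x(1)] by (metis imageI)
    show "r \<odot>\<^bsub>N\<^esub> a \<in> h ` B" if r: "r \<in> carrier R" for r
      using mod_hom_smult[OF h r car[OF x(1)]] M.submoduleE(4)[OF B r x(1)] x(2) by (metis imageI)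
    fix b assume "b \<in> h ` B"
    then obtain y where y: "y \<in> B" "b = h y" by blast
    show "a \<oplus>\<^bsub>N\<^esub> b \<in> h ` B"
      using mod_hom_add[OF h car[OF x(1)] car[OF y(1)]] M.submoduleE(5)[OF B x(1) y(1)] x(2) y(2)
      by (metis imageI)
  qed
qed

lemma regular_module_simps [simp]:
  "carrier (regular_module R) = carrier R" "zero (regular_module R) = zero R"
  "add (regular_module R) = add R" "smult (regular_module R) = mult R"
  by (simp_all add: regular_module_def)

lemma regular_module_module:
  assumes "cring R" shows "Module.module R (regular_module R)"
proof -
  interpret R: cring R by fact
  show ?thesis
  proof (rule moduleI)
    show "cring R" by fact
    show "abelian_group (regular_module R)"
    proof (rule abelian_groupI)
      fix x assume "x \<in> carrier (regular_module R)"
      then show "\<exists>y\<in>carrier (regular_module R). y \<oplus>\<^bsub>regular_module R\<^esub> x = \<zero>\<^bsub>regular_module R\<^esub>"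
        by (intro bexI[of _ "\<ominus>\<^bsub>R\<^esub> x"]) (auto simp: R.l_neg)
    qed (auto simp: R.a_ac)
  qed (auto simp: R.l_distr R.r_distr R.m_assoc)
qed

lemma ideal_submodule_regular:
  assumes "cring R" "ideal I R" shows "submodule I R (regular_module R)"
proof -
  interpret R: cring R by fact
  interpret I: ideal I R by fact
  interpret M: Module.module R "regular_module R" by (rule regular_module_module) fact
  show ?thesis
  proof (rule M.submoduleI)
    fix a assume a: "a \<in> I"
    have "\<ominus>\<^bsub>regular_module R\<^esub> a = \<ominus>\<^bsub>R\<^esub> a"
      by (simp add: a_inv_def m_inv_def)
    then show "\<ominus>\<^bsub>regular_module R\<^esub> a \<in> I" using a by simp
  qed (auto simp: I.I_l_closed I.Icarr I.a_closed)
qed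

definition torsion_level :: "('a, 'c) ring_scheme \<Rightarrow> 'a set \<Rightarrow> ('a, 'b) module \<Rightarrow> nat \<Rightarrow> 'b set" where
  "torsion_level R I M n = {x \<in> carrier M. \<forall>r\<in>ideal_power R I n. r \<odot>\<^bsub>M\<^esub> x = \<zero>\<^bsub>M\<^esub>}"

lemma torsion_eq_Un: "torsion R I M = (\<Union>n. torsion_level R I M n)"
  by (auto simp: torsion_def torsion_level_def)

lemma torsion_level_mono:
  assumes "ring R" "ideal I R" "m \<le> n"
  shows "torsion_level R I M m \<subseteq> torsion_level R I M n"
  using ring.ideal_power_antimono[OF assms] by (auto simp: torsion_level_def)

lemma torsion_level_submodule:
  assumes "Module.module R M" "ideal I R"
  shows "submodule (torsion_level R I M n) R M"
proof -
  interpret M: Module.module R M by fact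
  have I: "ideal (ideal_power R I n) R" by (rule M.R.ideal_power_ideal) fact
  interpret I: ideal "ideal_power R I n" R by fact
  show ?thesis
  proof (rule M.submoduleI)
    fix c x assume c: "c \<in> carrier R" and x: "x \<in> torsion_level R I M n"
    have "r \<odot>\<^bsub>M\<^esub> (c \<odot>\<^bsub>M\<^esub> x) = \<zero>\<^bsub>M\<^esub>" if r: "r \<in> ideal_power R I n" for r
    proof -
      have "r \<odot>\<^bsub>M\<^esub> (c \<odot>\<^bsub>M\<^esub> x) = (r \<otimes>\<^bsub>R\<^esub> c) \<odot>\<^bsub>M\<^esub> x"
        using c x I.Icarr[OF r] by (simp add: torsion_level_def M.smult_assoc1)
      then show ?thesis using x I.I_r_closed[OF r c] by (simp add: torsion_level_def)
    qed
    then show "c \<odot>\<^bsub>M\<^esub> x \<in> torsion_level R I M n" using c x by (simp add: torsion_level_def)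
  qed (auto simp: torsion_level_def M.smult_r_distr M.smult_r_minus I.Icarr M.M.minus_zero_eq)
qed

lemma torsion_submodule:
  assumes "Module.module R M" "ideal I R"
  shows "submodule (torsion R I M) R M"
proof -
  interpret M: Module.module R M by fact
  note T = M.submoduleE[OF torsion_level_submodule[OF assms]]
  show ?thesis
  proof (rule M.submoduleI)
    show "torsion R I M \<subseteq> carrier M" by (auto simp: torsion_def)
    show "\<zero>\<^bsub>M\<^esub> \<in> torsion R I M"
      using M.submodule_zero[OF torsion_level_submodule[OF assms]] by (auto simp: torsion_eq_Un)
    show "\<ominus>\<^bsub>M\<^esub> a \<in> torsion R I M" if "a \<in> torsion R I M" for a
      using that T(3) by (auto simp: torsion_eq_Un)
    show "c \<odot>\<^bsub>M\<^esub> a \<in> torsion R I M" if "c \<in> carrier R" "a \<in> torsion R I M" for a c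
      using that T(4) by (auto simp: torsion_eq_Un)
    fix a b assume "a \<in> torsion R I M" "b \<in> torsion R I M"
    then obtain m n where mn: "a \<in> torsion_level R I M m" "b \<in> torsion_level R I M n"
      by (auto simp: torsion_eq_Un)
    have "torsion_level R I M m \<subseteq> torsion_level R I M (max m n)"
      "torsion_level R I M n \<subseteq> torsion_level R I M (max m n)"
      by (intro torsion_level_mono[OF M.R.ring_axioms assms(2)] max.cobounded1 max.cobounded2)+
    then have "a \<in> torsion_level R I M (max m n)" "b \<in> torsion_level R I M (max m n)"
      using mn by blast+
    then have "a \<oplus>\<^bsub>M\<^esub> b \<in> torsion_level R I M (max m n)" by (rule T(5))
    then show "a \<oplus>\<^bsub>M\<^esub> b \<in> torsion R I M" by (auto simp: torsion_eq_Un)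
  qed
qed

lemma mod_hom_torsion:
  assumes "Module.module R M" "Module.module R N" "ideal I R" "h \<in> mod_hom R M N" "x \<in> torsion R I M"
  shows "h x \<in> torsion R I N"
proof -
  interpret M: Module.module R M by fact
  obtain n where n: "x \<in> carrier M" "\<And>r. r \<in> ideal_power R I n \<Longrightarrow> r \<odot>\<^bsub>M\<^esub> x = \<zero>\<^bsub>M\<^esub>"
    using assms(5) by (auto simp: torsion_def)
  have "r \<odot>\<^bsub>N\<^esub> h x = \<zero>\<^bsub>N\<^esub>" if r: "r \<in> ideal_power R I n" for r
  proof -
    have "r \<in> carrier R"
      using ideal.Icarr[OF M.R.ideal_power_ideal[OF assms(3)] r] .
    then have "r \<odot>\<^bsub>N\<^esub> h x = h (r \<odot>\<^bsub>M\<^esub> x)" using mod_hom_smult[OF assms(4)] n(1) by simp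
    then show ?thesis using n(2)[OF r] mod_hom_zero[OF assms(1,2,4)] by simp
  qed
  then show ?thesis using mod_hom_closed[OF assms(4) n(1)] by (auto simp: torsion_def)
qed

section \<open>Annihilators of the cohomology of a free complex\<close>

primrec interval_prod :: "('a, 'c) ring_scheme \<Rightarrow> (nat \<Rightarrow> 'a) \<Rightarrow> nat \<Rightarrow> nat \<Rightarrow> 'a" where
  "interval_prod R c q 0 = \<one>\<^bsub>R\<^esub>"
| "interval_prod R c q (Suc m) = c q \<otimes>\<^bsub>R\<^esub> interval_prod R c (Suc q) m"

text \<open>\<open>K\<close> with the differential \<open>D\<close> is a complex with all its terms taken together, and \<open>\<pi> m\<close> is the
  projection to the terms of index less than \<open>m\<close>. The homomorphisms from \<open>K\<close> to \<open>E q\<close> are the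
  cochains, with differential \<open>u \<mapsto> u \<circ> D\<close>. The assumption \<open>projective\<close> says that \<open>Hom(K, _)\<close> is
  exact, \<open>torsion_split\<close> that \<open>Hom(K, E q / T q)\<close> is acyclic, and \<open>kill\<close> that \<open>C q\<close> annihilates the
  \<open>q\<close>-th cohomology of the complex of the \<open>T q\<close>.\<close>
locale torsion_approximation =
  fixes R :: "('a, 'c) ring_scheme" and K :: "('a, 'm) module" and D :: "'m \<Rightarrow> 'm"
    and \<pi> :: "nat \<Rightarrow> 'm \<Rightarrow> 'm" and E :: "nat \<Rightarrow> ('a, 'b) module" and \<delta> :: "nat \<Rightarrow> 'b \<Rightarrow> 'b"
    and T :: "nat \<Rightarrow> 'b set" and C :: "nat \<Rightarrow> 'a set" and d :: nat
  assumes K: "Module.module R K"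
    and D: "D \<in> mod_hom R K K" "\<And>f. f \<in> carrier K \<Longrightarrow> D (D f) = \<zero>\<^bsub>K\<^esub>"
    and \<pi>: "\<And>m. \<pi> m \<in> mod_hom R K K" "\<And>f. f \<in> carrier K \<Longrightarrow> \<pi> 0 f = \<zero>\<^bsub>K\<^esub>"
      "\<And>m f. f \<in> carrier K \<Longrightarrow> \<pi> m (D f) = D (\<pi> (Suc m) f)"
      "\<And>m f. f \<in> carrier K \<Longrightarrow> \<pi> m (\<pi> m f) = \<pi> m f"
    and E: "\<And>q. Module.module R (E q)"
    and \<delta>: "\<And>q. \<delta> q \<in> mod_hom R (E q) (E (Suc q))"
      "\<And>q x. x \<in> carrier (E q) \<Longrightarrow> \<delta> (Suc q) (\<delta> q x) = \<zero>\<^bsub>E (Suc (Suc q))\<^esub>"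
      "\<And>q x. x \<in> carrier (E (Suc q)) \<Longrightarrow> \<delta> (Suc q) x = \<zero>\<^bsub>E (Suc (Suc q))\<^esub> \<Longrightarrow> x \<in> \<delta> q ` carrier (E q)"
    and T: "\<And>q. submodule (T q) R (E q)" "\<And>q x. x \<in> T q \<Longrightarrow> \<delta> q x \<in> T (Suc q)"
    and projective: "\<And>q B g. g \<in> mod_hom R K (E (Suc q)) \<Longrightarrow> submodule B R (E q) \<Longrightarrow>
        (\<And>f. f \<in> carrier K \<Longrightarrow> g f \<in> \<delta> q ` B) \<Longrightarrow>
        \<exists>h\<in>mod_hom R K (E q). \<forall>f\<in>carrier K. h f \<in> B \<and> \<delta> q (h f) = g f"
    and torsion_split: "\<And>q u. u \<in> mod_hom R K (E q) \<Longrightarrow> (\<And>f. f \<in> carrier K \<Longrightarrow> u (D f) \<in> T q) \<Longrightarrow>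
        \<exists>u'\<in>mod_hom R K (E q). \<exists>w\<in>mod_hom R K (E q).
          \<forall>f\<in>carrier K. u' f \<in> T q \<and> u f = u' f \<oplus>\<^bsub>E q\<^esub> w (D f)"
    and C: "\<And>q. C q \<subseteq> carrier R"
    and kill: "\<And>q c x. q < d \<Longrightarrow> c \<in> C q \<Longrightarrow> x \<in> T q \<Longrightarrow> \<delta> q x = \<zero>\<^bsub>E (Suc q)\<^esub> \<Longrightarrow>
        c \<odot>\<^bsub>E q\<^esub> x \<in> (case q of 0 \<Rightarrow> {\<zero>\<^bsub>E 0\<^esub>} | Suc i \<Rightarrow> \<delta> i ` T i)"
begin

definition bd :: "nat \<Rightarrow> 'b set" where
  "bd q = (case q of 0 \<Rightarrow> {\<zero>\<^bsub>E 0\<^esub>} | Suc i \<Rightarrow> \<delta> i ` T i)"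

lemma bd_T: "x \<in> bd q \<Longrightarrow> x \<in> T q"
  using T(2) subgroup.one_closed[OF submodule.axioms(1)[OF T(1)[of 0]]]
  by (cases q) (auto simp: bd_def)

lemma interval_prod_carrier:
  "(\<And>i. i < m \<Longrightarrow> c (q + i) \<in> C (q + i)) \<Longrightarrow> interval_prod R c q m \<in> carrier R"
proof (induction m arbitrary: q)
  case 0
  interpret Module.module R K by (rule K)
  show ?case by simp
next
  case (Suc m)
  interpret Module.module R K by (rule K)
  have "c q \<in> carrier R" using Suc.prems[of 0] C by auto
  moreover have "interval_prod R c (Suc q) m \<in> carrier R"
    using Suc.prems[of "Suc _"] by (intro Suc.IH) simp
  ultimately show ?case by simp
qed

text \<open>A cochain \<open>z\<close> with values in the kernel of \<open>\<delta> q\<close> and with \<open>z \<circ> D\<close> in \<open>bd q\<close> is a cocycle with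
  values in \<open>U q\<close>, the kernel of \<open>\<delta> q\<close> modulo \<open>bd q\<close>. Modulo torsion it is \<open>w \<circ> D\<close>, by acyclicity.
  Then \<open>\<delta> q \<circ> w\<close> is a cocycle with values in \<open>U (q + 1)\<close> and of degree one less, to which the
  induction hypothesis applies. Pulled back along \<open>\<delta> q\<close>, this shows that a multiple of \<open>z\<close> is a
  coboundary up to a torsion cochain that \<open>\<delta> q\<close> maps to \<open>0\<close>, and \<open>c q\<close> takes the latter to \<open>bd q\<close>.\<close>
theorem annihilate:
  assumes "q + m \<le> d" and "z \<in> mod_hom R K (E q)"
    and "\<And>f. f \<in> carrier K \<Longrightarrow> z (\<pi> m f) = z f"
    and "\<And>f. f \<in> carrier K \<Longrightarrow> \<delta> q (z f) = \<zero>\<^bsub>E (Suc q)\<^esub>"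
    and "\<And>f. f \<in> carrier K \<Longrightarrow> z (D f) \<in> bd q"
    and "\<And>i. i < m \<Longrightarrow> c (q + i) \<in> C (q + i)"
  shows "\<exists>w\<in>mod_hom R K (E q). \<forall>f\<in>carrier K. \<delta> q (w f) = \<zero>\<^bsub>E (Suc q)\<^esub> \<and>
    interval_prod R c q m \<odot>\<^bsub>E q\<^esub> z f \<ominus>\<^bsub>E q\<^esub> w (D f) \<in> bd q"
  using assms
proof (induction m arbitrary: q z)
  case 0
  interpret Eq: Module.module R "E q" by (rule E)
  interpret Eq': Module.module R "E (Suc q)" by (rule E)
  have z: "z f = \<zero>\<^bsub>E q\<^esub>" if "f \<in> carrier K" for f
    using "0.prems"(3)[OF that] \<pi>(2)[OF that] mod_hom_zero[OF K E "0.prems"(2)] by simp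
  have "(\<lambda>_. \<zero>\<^bsub>E q\<^esub>) \<in> mod_hom R K (E q)" by (simp add: mod_hom_iff)
  moreover have "\<zero>\<^bsub>E q\<^esub> \<in> bd q"
    using "0.prems"(5) z mod_hom_closed[OF D(1)] Module.module.carrier_is_submodule[OF K]
    by (metis abelian_monoid.zero_closed K Module.module_def abelian_group_def)
  ultimately show ?case
    using mod_hom_zero[OF E E \<delta>(1), of q]
    by (intro bexI[of _ "\<lambda>_. \<zero>\<^bsub>E q\<^esub>"]) (auto simp: z a_minus_def Eq.M.minus_zero_eq)
next
  case (Suc m)
  interpret K: Module.module R K by (rule K)
  interpret Eq: Module.module R "E q" by (rule E)
  interpret Eq': Module.module R "E (Suc q)" by (rule E)
  let ?E = "E q" and ?E' = "E (Suc q)"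
  define c' where "c' = interval_prod R c (Suc q) m"
  have prems': "c (Suc q + i) \<in> C (Suc q + i)" if "i < m" for i
    using Suc.prems(6)[of "Suc i"] that by simp
  have c': "c' \<in> carrier R" unfolding c'_def by (rule interval_prod_carrier) (rule prems')
  have cq: "c q \<in> C q" "c q \<in> carrier R" using Suc.prems(6)[of 0] C by auto
  have z_T: "z (D f) \<in> T q" if "f \<in> carrier K" for f
    using Suc.prems(5) bd_T that by blast
  obtain z1 w1 where zw: "z1 \<in> mod_hom R K ?E" "w1 \<in> mod_hom R K ?E"
    "\<And>f. f \<in> carrier K \<Longrightarrow> z1 f \<in> T q" "\<And>f. f \<in> carrier K \<Longrightarrow> z f = z1 f \<oplus>\<^bsub>?E\<^esub> w1 (D f)"
    using torsion_split[OF Suc.prems(2) z_T] by metis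
  \<comment> \<open>\<open>z\<close> is determined by the terms of index at most \<open>m\<close>, so the decomposition can be cut off there\<close>
  define z0 where "z0 f = z1 (\<pi> (Suc m) f)" for f
  define w where "w f = w1 (\<pi> m f)" for f
  have z0: "z0 \<in> mod_hom R K ?E" unfolding z0_def by (rule mod_hom_comp[OF zw(1) \<pi>(1)])
  have w: "w \<in> mod_hom R K ?E" unfolding w_def by (rule mod_hom_comp[OF zw(2) \<pi>(1)])
  have \<pi>_car: "\<pi> k f \<in> carrier K" if "f \<in> carrier K" for k f using mod_hom_closed[OF \<pi>(1) that] .
  have D_car: "D f \<in> carrier K" if "f \<in> carrier K" for f using mod_hom_closed[OF D(1) that] .
  have z0T: "z0 f \<in> T q" if "f \<in> carrier K" for f using zw(3) \<pi>_car that by (simp add: z0_def)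
  have z_eq: "z f = z0 f \<oplus>\<^bsub>?E\<^esub> w (D f)" if f: "f \<in> carrier K" for f
    using zw(4)[OF \<pi>_car[OF f, of "Suc m"]] Suc.prems(3)[OF f] \<pi>(3)[OF f] by (simp add: z0_def w_def)
  have car: "z f \<in> carrier ?E" "z0 f \<in> carrier ?E" "w f \<in> carrier ?E" if "f \<in> carrier K" for f
    using that Suc.prems(2) z0 w by (auto simp: mod_hom_closed)
  have \<delta>_car: "\<delta> q x \<in> carrier ?E'" if "x \<in> carrier ?E" for x using mod_hom_closed[OF \<delta>(1) that] .
  have \<delta>w: "(\<lambda>f. \<delta> q (w f)) \<in> mod_hom R K ?E'" by (rule mod_hom_comp[OF \<delta>(1) w])
  have "\<exists>g\<in>mod_hom R K ?E'. \<forall>f\<in>carrier K. \<delta> (Suc q) (g f) = \<zero>\<^bsub>E (Suc (Suc q))\<^esub> \<and>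
    interval_prod R c (Suc q) m \<odot>\<^bsub>?E'\<^esub> \<delta> q (w f) \<ominus>\<^bsub>?E'\<^esub> g (D f) \<in> bd (Suc q)"
  proof (rule Suc.IH)
    show "Suc q + m \<le> d" using Suc.prems(1) by simp
    show "(\<lambda>f. \<delta> q (w f)) \<in> mod_hom R K ?E'" by (rule \<delta>w)
    show "\<delta> q (w (\<pi> m f)) = \<delta> q (w f)" if "f \<in> carrier K" for f
      using that by (simp add: w_def \<pi>(4))
    show "\<delta> (Suc q) (\<delta> q (w f)) = \<zero>\<^bsub>E (Suc (Suc q))\<^esub>" if "f \<in> carrier K" for f
      using car that by (intro \<delta>(2))
    show "\<delta> q (w (D f)) \<in> bd (Suc q)" if f: "f \<in> carrier K" for f
    proof -
      have "\<delta> q (z0 f) \<oplus>\<^bsub>?E'\<^esub> \<delta> q (w (D f)) = \<zero>\<^bsub>?E'\<^esub>"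
        using Suc.prems(4)[OF f] z_eq[OF f] car[OF f] car[OF D_car[OF f]]
        by (simp add: mod_hom_add[OF \<delta>(1)])
      then have "\<delta> q (w (D f)) = \<ominus>\<^bsub>?E'\<^esub> \<delta> q (z0 f)"
        using car[OF f] car[OF D_car[OF f]] \<delta>_car
        by (metis Eq'.M.minus_equality Eq'.M.a_comm)
      also have "\<dots> = \<delta> q ((\<ominus>\<^bsub>R\<^esub> \<one>\<^bsub>R\<^esub>) \<odot>\<^bsub>?E\<^esub> z0 f)"
        using car[OF f] \<delta>_car by (simp add: mod_hom_smult[OF \<delta>(1)] Eq'.smult_l_minus)
      also have "\<dots> \<in> bd (Suc q)"
        using Eq.submoduleE(4)[OF T(1)] z0T[OF f] by (simp add: bd_def)
      finally show ?thesis .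
    qed
  qed (rule prems')
  then obtain g where g: "g \<in> mod_hom R K ?E'"
    "\<And>f. f \<in> carrier K \<Longrightarrow> \<delta> (Suc q) (g f) = \<zero>\<^bsub>E (Suc (Suc q))\<^esub>"
    "\<And>f. f \<in> carrier K \<Longrightarrow> c' \<odot>\<^bsub>?E'\<^esub> \<delta> q (w f) \<ominus>\<^bsub>?E'\<^esub> g (D f) \<in> \<delta> q ` T q"
    unfolding c'_def bd_def by auto
  have "g f \<in> \<delta> q ` carrier ?E" if "f \<in> carrier K" for f
    using g(2)[OF that] mod_hom_closed[OF g(1) that] by (intro \<delta>(3))
  from projective[OF g(1) Eq.carrier_is_submodule this]
  obtain h where h: "h \<in> mod_hom R K ?E" "\<And>f. f \<in> carrier K \<Longrightarrow> \<delta> q (h f) = g f" by blast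
  have "(\<lambda>f. c' \<odot>\<^bsub>?E'\<^esub> \<delta> q (w f) \<ominus>\<^bsub>?E'\<^esub> g (D f)) \<in> mod_hom R K ?E'"
    by (intro mod_hom_diff K E mod_hom_scale \<delta>w c' mod_hom_comp[OF g(1) D(1)])
  from projective[OF this T(1) g(3)]
  obtain t where t: "t \<in> mod_hom R K ?E" "\<And>f. f \<in> carrier K \<Longrightarrow> t f \<in> T q"
    "\<And>f. f \<in> carrier K \<Longrightarrow> \<delta> q (t f) = c' \<odot>\<^bsub>?E'\<^esub> \<delta> q (w f) \<ominus>\<^bsub>?E'\<^esub> g (D f)" by blast
  define w' where "w' f = (c' \<odot>\<^bsub>?E\<^esub> w f \<ominus>\<^bsub>?E\<^esub> h (D f)) \<ominus>\<^bsub>?E\<^esub> t f" for f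
  have w': "w' \<in> mod_hom R K ?E"
    unfolding w'_def by (intro mod_hom_diff K E mod_hom_scale w c' mod_hom_comp[OF h(1) D(1)] t(1))
  have car': "h f \<in> carrier ?E" "t f \<in> carrier ?E" "w' f \<in> carrier ?E" if "f \<in> carrier K" for f
    using that h(1) t(1) w' by (auto simp: mod_hom_closed)
  have \<delta>w': "\<delta> q (w' f) = \<zero>\<^bsub>?E'\<^esub>" if f: "f \<in> carrier K" for f
  proof -
    have "\<delta> q (w' f) = (c' \<odot>\<^bsub>?E'\<^esub> \<delta> q (w f) \<ominus>\<^bsub>?E'\<^esub> g (D f)) \<ominus>\<^bsub>?E'\<^esub> \<delta> q (t f)"
      unfolding w'_def using car[OF f] car'[OF f] car'[OF D_car[OF f]] c' h(2)[OF D_car[OF f]]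
      by (simp add: mod_hom_minus[OF E E \<delta>(1)] mod_hom_smult[OF \<delta>(1)])
    then show ?thesis using \<delta>_car[OF car'(2)[OF f]] t(3)[OF f] by (simp add: a_minus_def Eq'.M.r_neg)
  qed
  have main: "c' \<odot>\<^bsub>?E\<^esub> z f \<ominus>\<^bsub>?E\<^esub> w' (D f) = c' \<odot>\<^bsub>?E\<^esub> z0 f \<oplus>\<^bsub>?E\<^esub> t (D f)" if f: "f \<in> carrier K" for f
  proof -
    have "h (D (D f)) = \<zero>\<^bsub>?E\<^esub>" using D(2)[OF f] mod_hom_zero[OF K E h(1)] by simp
    then have "w' (D f) = c' \<odot>\<^bsub>?E\<^esub> w (D f) \<ominus>\<^bsub>?E\<^esub> t (D f)"
      using car[OF D_car[OF f]] c' by (simp add: w'_def a_minus_def Eq.M.minus_zero_eq)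
    then show ?thesis
      using car[OF f] car[OF D_car[OF f]] car'[OF D_car[OF f]] c'
      by (simp add: z_eq[OF f] Eq.smult_r_distr a_minus_def Eq.M.minus_add Eq.M.a_assoc
          Eq.M.r_neg2 Eq.M.r_neg1)
  qed
  define w'' where "w'' f = c q \<odot>\<^bsub>?E\<^esub> w' f" for f
  have w'': "w'' \<in> mod_hom R K ?E" unfolding w''_def by (intro mod_hom_scale E w' cq)
  have "\<delta> q (w'' f) = \<zero>\<^bsub>?E'\<^esub>" if "f \<in> carrier K" for f
    using that car' cq \<delta>w' by (simp add: w''_def mod_hom_smult[OF \<delta>(1)])
  moreover have "interval_prod R c q (Suc m) \<odot>\<^bsub>?E\<^esub> z f \<ominus>\<^bsub>?E\<^esub> w'' (D f) \<in> bd q"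
    if f: "f \<in> carrier K" for f
  proof -
    let ?x = "c' \<odot>\<^bsub>?E\<^esub> z f \<ominus>\<^bsub>?E\<^esub> w' (D f)"
    have "?x \<in> T q"
      unfolding main[OF f] using z0T[OF f] t(2)[OF D_car[OF f]] c' Eq.submoduleE(4,5)[OF T(1)] by blast
    moreover have "\<delta> q ?x = \<zero>\<^bsub>?E'\<^esub>"
      using car[OF f] car'[OF D_car[OF f]] c' Suc.prems(4)[OF f] \<delta>w'[OF D_car[OF f]]
      by (simp add: mod_hom_minus[OF E E \<delta>(1)] mod_hom_smult[OF \<delta>(1)])
        (simp add: a_minus_def Eq'.M.minus_zero_eq)
    ultimately have "c q \<odot>\<^bsub>?E\<^esub> ?x \<in> bd q"
      using Suc.prems(1) cq(1) unfolding bd_def by (intro kill) auto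
    moreover have "c q \<odot>\<^bsub>?E\<^esub> ?x = interval_prod R c q (Suc m) \<odot>\<^bsub>?E\<^esub> z f \<ominus>\<^bsub>?E\<^esub> w'' (D f)"
      using car[OF f] car'[OF D_car[OF f]] c' cq(2)
      by (simp add: w''_def c'_def[symmetric] Eq.smult_assoc1 a_minus_def Eq.smult_r_distr Eq.smult_r_minus)
    ultimately show ?thesis by simp
  qed
  ultimately show ?case using w'' by blast
qed

end

section \<open>The Koszul complex over a ring of invariants\<close>

definition koszul_module :: "('i::finite, 'k::comm_ring_1) mpol set \<Rightarrow> nat \<Rightarrow>
    (('i, 'k) mpol, nat set \<Rightarrow> ('i, 'k) mpol) module" where
  "koszul_module S d = \<lparr>carrier = koszul S d, mult = undefined, one = undefined, zero = 0,
     add = (+), smult = fsmult\<rparr>"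

lemma koszul_module_simps [simp]:
  "carrier (koszul_module S d) = koszul S d" "zero (koszul_module S d) = 0"
  "add (koszul_module S d) = (+)" "smult (koszul_module S d) = fsmult"
  by (simp_all add: koszul_module_def)

definition koszul_basis :: "nat set \<Rightarrow> nat set \<Rightarrow> 'a::zero_neq_one" where
  "koszul_basis J = (\<lambda>J'. if J' = J then 1 else 0)"

interpretation inv: graded_subring "carrier (invariant_ring G :: ('n::finite, 'k::{field,finite}) mpol ring)"
  for G :: "('k::{field,finite} ^ 'n::finite ^ 'n) set"
  by unfold_locales (simp_all add: invariant_closed)

lemma interval_prod_invariant: "interval_prod (invariant_ring G) c q m = (\<Prod>i<m. c (q + i))"
proof (induction m arbitrary: q)
  case (Suc m)
  then show ?case by (simp add: prod.lessThan_Suc_shift del: prod.lessThan_Suc)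
qed simp

context
  fixes G :: "('k::{field,finite} ^ 'n::finite ^ 'n) set"
begin

abbreviation (input) R :: "('n, 'k) mpol ring" where "R \<equiv> invariant_ring G"
abbreviation (input) S :: "('n, 'k) mpol set" where "S \<equiv> carrier (invariant_ring G)"

lemma koszul_module: "Module.module R (koszul_module S d)"
proof (rule moduleI)
  show "cring R" by (rule cring_invariant)
  show "abelian_group (koszul_module S d)"
  proof (rule abelian_groupI)
    fix f assume "f \<in> carrier (koszul_module S d)"
    then have "0 - f \<in> koszul S d" by (intro inv.koszul_diff inv.koszul_0) simp
    then show "\<exists>g\<in>carrier (koszul_module S d). g \<oplus>\<^bsub>koszul_module S d\<^esub> f = \<zero>\<^bsub>koszul_module S d\<^esub>"
      by (intro bexI[of _ "0 - f"]) (simp_all only: koszul_module_simps diff_add_cancel)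
  qed (auto simp: inv.koszul_add inv.koszul_0 add_ac simp del: plus_fun_apply zero_fun_apply)
qed (auto simp: inv.koszul_fsmult fun_eq_iff algebra_simps)

lemma koszul_basis_in: "J \<subseteq> {1..d} \<Longrightarrow> koszul_basis J \<in> koszul S d"
  by (auto simp: koszul_def koszul_basis_def inv.S_0 inv.S_1)

text \<open>Over a finite field both the Koszul complex and the polynomial ring are countable, and the
  polynomial ring is infinite. The injection serves to apply the lifting property of injective modules.\<close>
lemma koszul_inj: "\<exists>\<phi> :: (nat set \<Rightarrow> ('n, 'k) mpol) \<Rightarrow> ('n, 'k) mpol. inj_on \<phi> (koszul S d)"
proof -
  have "countable (PiE (Pow {1..d}) (\<lambda>_. UNIV :: ('n, 'k) mpol set))"
    by (intro countable_PiE countable_mpol) simp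
  moreover have "(\<lambda>f. restrict f (Pow {1..d})) ` koszul S d \<subseteq> PiE (Pow {1..d}) (\<lambda>_. UNIV)"
    by (rule image_subsetI) (rule restrict_PiE_iff[THEN iffD2], simp)
  ultimately have "countable ((\<lambda>f. restrict f (Pow {1..d})) ` koszul S d)"
    by (rule countable_subset[rotated])
  moreover have "inj_on (\<lambda>f. restrict f (Pow {1..d})) (koszul S d)"
  proof (rule inj_onI, rule ext)
    fix f g J assume f: "f \<in> koszul S d" "g \<in> koszul S d"
      and eq: "restrict f (Pow {1..d}) = restrict g (Pow {1..d})"
    show "f J = g J"
      using f fun_cong[OF eq, of J] by (cases "J \<subseteq> {1..d}") (auto simp: koszul_def)
  qed
  ultimately have "countable (koszul S d)" by (simp add: countable_image_inj_eq)
  then obtain \<alpha> :: "_ \<Rightarrow> nat" where "inj_on \<alpha> (koszul S d)" by (auto simp: countable_def)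
  moreover have "inj (\<lambda>n::nat. single (single (undefined :: 'n) n) (1 :: 'k))" by (rule inj_power_Var)
  ultimately have "inj_on ((\<lambda>n::nat. single (single (undefined :: 'n) n) (1 :: 'k)) \<circ> \<alpha>) (koszul S d)"
    by (intro comp_inj_on) (auto intro: inj_on_subset)
  then show ?thesis by blast
qed

lemma koszul_hom_expand:
  assumes M: "Module.module R M" and v: "v \<in> mod_hom R (koszul_module S d) M"
    and f: "f \<in> koszul S d"
  shows "v f = (\<Oplus>\<^bsub>M\<^esub>J\<in>Pow {1..d}. f J \<odot>\<^bsub>M\<^esub> v (koszul_basis J))"
proof -
  interpret M: Module.module R M by fact
  have vb: "v (koszul_basis J) \<in> carrier M" if "J \<subseteq> {1..d}" for J
    using mod_hom_closed[OF v] koszul_basis_in[OF that] by simp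
  have fS: "f J \<in> carrier R" for J using f by (simp add: koszul_def)
  have "finite A \<Longrightarrow> A \<subseteq> Pow {1..d} \<Longrightarrow>
      (\<lambda>J. if J \<in> A then f J else 0) \<in> koszul S d \<and>
      v (\<lambda>J. if J \<in> A then f J else 0) = (\<Oplus>\<^bsub>M\<^esub>J\<in>A. f J \<odot>\<^bsub>M\<^esub> v (koszul_basis J))" for A
  proof (induction A rule: finite_induct)
    case empty
    have "v 0 = \<zero>\<^bsub>M\<^esub>" using mod_hom_zero[OF koszul_module M v] by simp
    moreover have "(\<lambda>J. if J \<in> {} then f J else 0) = 0" by (simp add: fun_eq_iff)
    ultimately show ?case by (simp only: M.M.finsum_empty inv.koszul_0 simp_thms)
  next
    case (insert J A)
    let ?g = "\<lambda>J. if J \<in> A then f J else 0"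
    have g: "?g \<in> koszul S d" "v ?g = (\<Oplus>\<^bsub>M\<^esub>J\<in>A. f J \<odot>\<^bsub>M\<^esub> v (koszul_basis J))"
      using insert by auto
    have b: "koszul_basis J \<in> koszul S d" using insert.prems by (intro koszul_basis_in) simp
    then have fb: "fsmult (f J) (koszul_basis J) \<in> koszul S d"
      using fS[of J] by (intro inv.koszul_fsmult) simp_all
    have eq: "(\<lambda>J'. if J' \<in> insert J A then f J' else 0) = fsmult (f J) (koszul_basis J) + ?g"
      using insert.hyps by (auto simp: fun_eq_iff koszul_basis_def)
    have "v (fsmult (f J) (koszul_basis J) + ?g) = v (fsmult (f J) (koszul_basis J)) \<oplus>\<^bsub>M\<^esub> v ?g"
      using mod_hom_add[OF v] fb g(1) by simp
    also have "v (fsmult (f J) (koszul_basis J)) = f J \<odot>\<^bsub>M\<^esub> v (koszul_basis J)"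
      using mod_hom_smult[OF v fS, of "koszul_basis J" J] b by simp
    also have "f J \<odot>\<^bsub>M\<^esub> v (koszul_basis J) \<oplus>\<^bsub>M\<^esub> v ?g
        = (\<Oplus>\<^bsub>M\<^esub>J\<in>insert J A. f J \<odot>\<^bsub>M\<^esub> v (koszul_basis J))"
      unfolding g(2) using insert fS vb by (subst M.M.finsum_insert) auto
    finally show ?case
      unfolding eq using fb g(1) by (simp only: inv.koszul_add simp_thms)
  qed
  from this[of "Pow {1..d}"] have "v (\<lambda>J. if J \<in> Pow {1..d} then f J else 0)
    = (\<Oplus>\<^bsub>M\<^esub>J\<in>Pow {1..d}. f J \<odot>\<^bsub>M\<^esub> v (koszul_basis J))" by simp
  moreover have "(\<lambda>J. if J \<in> Pow {1..d} then f J else 0) = f"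
    using f by (auto simp: koszul_def)
  ultimately show ?thesis by simp
qed

lemma finsum_submodule:
  assumes M: "Module.module R M" and B: "submodule B R M" and "finite A" "\<And>i. i \<in> A \<Longrightarrow> g i \<in> B"
  shows "finsum M g A \<in> B"
proof -
  interpret M: Module.module R M by fact
  have "B \<subseteq> carrier M" using M.submoduleE(1)[OF B] .
  with assms(3,4) show ?thesis
    by (induction A rule: finite_induct)
      (auto simp: M.submodule_zero[OF B] M.submoduleE(5)[OF B] M.M.finsum_insert Pi_def subset_iff)
qed

lemma koszul_hom_into_submodule:
  assumes M: "Module.module R M" and B: "submodule B R M"
    and v: "v \<in> mod_hom R (koszul_module S d) M" "\<And>J. J \<subseteq> {1..d} \<Longrightarrow> v (koszul_basis J) \<in> B"
    and f: "f \<in> koszul S d"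
  shows "v f \<in> B"
proof -
  interpret M: Module.module R M by fact
  have fS: "f J \<in> carrier R" for J using f by (simp add: koszul_def)
  show ?thesis
    unfolding koszul_hom_expand[OF M v(1) f]
    using v(2) fS by (intro finsum_submodule[OF M B]) (auto intro: M.submoduleE(4)[OF B])
qed

lemma koszul_free:
  assumes M: "Module.module R M" and b: "\<And>J. J \<subseteq> {1..d} \<Longrightarrow> b J \<in> carrier M"
  shows "\<exists>h\<in>mod_hom R (koszul_module S d) M. \<forall>J. J \<subseteq> {1..d} \<longrightarrow> h (koszul_basis J) = b J"
proof -
  interpret M: Module.module R M by fact
  define h where "h f = (\<Oplus>\<^bsub>M\<^esub>J\<in>Pow {1..d}. f J \<odot>\<^bsub>M\<^esub> b J)" for f :: "nat set \<Rightarrow> ('n, 'k) mpol"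
  have fS: "f J \<in> carrier R" if "f \<in> koszul S d" for f J using that by (simp add: koszul_def)
  have c: "(\<lambda>J. f J \<odot>\<^bsub>M\<^esub> b J) \<in> Pow {1..d} \<rightarrow> carrier M" if "f \<in> koszul S d" for f
    using fS[OF that] b by auto
  have "h \<in> mod_hom R (koszul_module S d) M"
    unfolding mod_hom_iff
  proof (intro conjI ballI)
    fix f assume "f \<in> carrier (koszul_module S d)"
    then show "h f \<in> carrier M" unfolding h_def using c by (intro M.M.finsum_closed) simp
  next
    fix f g assume f: "f \<in> carrier (koszul_module S d)" and g: "g \<in> carrier (koszul_module S d)"
    have "h (f + g) = (\<Oplus>\<^bsub>M\<^esub>J\<in>Pow {1..d}. f J \<odot>\<^bsub>M\<^esub> b J \<oplus>\<^bsub>M\<^esub> g J \<odot>\<^bsub>M\<^esub> b J)"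
      unfolding h_def
    proof (rule M.M.finsum_cong')
      fix J assume "J \<in> Pow {1..d}"
      then show "(f + g) J \<odot>\<^bsub>M\<^esub> b J = f J \<odot>\<^bsub>M\<^esub> b J \<oplus>\<^bsub>M\<^esub> g J \<odot>\<^bsub>M\<^esub> b J"
        using M.smult_l_distr[of "f J" "g J" "b J"] fS f g b by simp
    qed (use c f g in auto)
    also have "\<dots> = h f \<oplus>\<^bsub>M\<^esub> h g"
      unfolding h_def using c f g by (intro M.M.finsum_addf) auto
    finally show "h (f \<oplus>\<^bsub>koszul_module S d\<^esub> g) = h f \<oplus>\<^bsub>M\<^esub> h g" by simp
  next
    fix r f assume r: "r \<in> carrier R" and f: "f \<in> carrier (koszul_module S d)"
    have "h (fsmult r f) = (\<Oplus>\<^bsub>M\<^esub>J\<in>Pow {1..d}. r \<odot>\<^bsub>M\<^esub> (f J \<odot>\<^bsub>M\<^esub> b J))"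
      unfolding h_def
    proof (rule M.M.finsum_cong')
      fix J assume "J \<in> Pow {1..d}"
      then show "fsmult r f J \<odot>\<^bsub>M\<^esub> b J = r \<odot>\<^bsub>M\<^esub> (f J \<odot>\<^bsub>M\<^esub> b J)"
        using M.smult_assoc1[of r "f J" "b J"] fS f r b by simp
    qed (use c f r in auto)
    also have "\<dots> = r \<odot>\<^bsub>M\<^esub> h f"
      unfolding h_def using c f r by (intro M.finsum_smult_ldistr[symmetric]) auto
    finally show "h (r \<odot>\<^bsub>koszul_module S d\<^esub> f) = r \<odot>\<^bsub>M\<^esub> h f" by simp
  qed
  moreover have "h (koszul_basis J) = b J" if J: "J \<subseteq> {1..d}" for J
  proof -
    have "h (koszul_basis J) = (\<Oplus>\<^bsub>M\<^esub>J'\<in>Pow {1..d}. if J = J' then b J' else \<zero>\<^bsub>M\<^esub>)"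
      unfolding h_def
    proof (rule M.M.finsum_cong')
      fix J' assume "J' \<in> Pow {1..d}"
      then show "koszul_basis J J' \<odot>\<^bsub>M\<^esub> b J' = (if J = J' then b J' else \<zero>\<^bsub>M\<^esub>)"
        using b M.smult_one[of "b J'"] M.smult_l_null[of "b J'"]
        by (auto simp: koszul_basis_def)
    qed (use b in auto)
    also have "\<dots> = b J" using J b by (intro M.M.finsum_singleton) auto
    finally show ?thesis .
  qed
  ultimately show ?thesis by blast
qed

lemma koszul_projective:
  assumes M: "Module.module R M" and N: "Module.module R N" and p: "p \<in> mod_hom R M N"
    and B: "submodule B R M" and g: "g \<in> mod_hom R (koszul_module S d) N"
      "\<And>f. f \<in> koszul S d \<Longrightarrow> g f \<in> p ` B"
  shows "\<exists>h\<in>mod_hom R (koszul_module S d) M. \<forall>f\<in>koszul S d. h f \<in> B \<and> p (h f) = g f"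
proof -
  interpret M: Module.module R M by fact
  have "\<forall>J. \<exists>b. J \<subseteq> {1..d} \<longrightarrow> b \<in> B \<and> p b = g (koszul_basis J)"
  proof
    fix J
    show "\<exists>b. J \<subseteq> {1..d} \<longrightarrow> b \<in> B \<and> p b = g (koszul_basis J)"
    proof (cases "J \<subseteq> {1..d}")
      case True
      from g(2)[OF koszul_basis_in[OF True]] show ?thesis by force
    qed simp
  qed
  then obtain b where b: "\<And>J. J \<subseteq> {1..d} \<Longrightarrow> b J \<in> B" "\<And>J. J \<subseteq> {1..d} \<Longrightarrow> p (b J) = g (koszul_basis J)"
    by metis
  have "b J \<in> carrier M" if "J \<subseteq> {1..d}" for J using b(1)[OF that] M.submoduleE(1)[OF B] by blast
  then have "\<exists>h\<in>mod_hom R (koszul_module S d) M. \<forall>J. J \<subseteq> {1..d} \<longrightarrow> h (koszul_basis J) = b J"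
    by (rule koszul_free[OF M])
  then obtain h where h: "h \<in> mod_hom R (koszul_module S d) M"
    "\<And>J. J \<subseteq> {1..d} \<Longrightarrow> h (koszul_basis J) = b J" by blast
  have "h f \<in> B" if "f \<in> koszul S d" for f
  proof (rule koszul_hom_into_submodule[OF M B h(1) _ that])
    show "h (koszul_basis J) \<in> B" if "J \<subseteq> {1..d}" for J
      using h(2)[OF that] b(1)[OF that] by simp
  qed
  moreover have "p (h f) = g f" if f: "f \<in> koszul S d" for f
  proof -
    interpret N: Module.module R N by fact
    have fS: "f J \<in> carrier R" for J using f by (simp add: koszul_def)
    have ph: "(\<lambda>f. p (h f)) \<in> mod_hom R (koszul_module S d) N" by (rule mod_hom_comp[OF p h(1)])
    show ?thesis
      unfolding koszul_hom_expand[OF N ph f] koszul_hom_expand[OF N g(1) f]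
      using h(2) b(2) fS mod_hom_closed[OF g(1)] koszul_basis_in
      by (intro N.M.finsum_cong') auto
  qed
  ultimately show ?thesis using h(1) by blast
qed

lemma R_ring: "ring R" by (rule cring.axioms(1)[OF cring_invariant])

lemma invariant_idealI:
  assumes "J \<subseteq> S" "0 \<in> J" "\<And>a b. a \<in> J \<Longrightarrow> b \<in> J \<Longrightarrow> a + b \<in> J"
    "\<And>a b. a \<in> S \<Longrightarrow> b \<in> J \<Longrightarrow> a * b \<in> J"
  shows "ideal J R"
proof (rule idealI)
  show "ring R" by (rule R_ring)
  interpret R: ring R by (rule R_ring)
  show "Group.subgroup J (add_monoid R)"
  proof (rule R.add.subgroupI)
    fix a assume a: "a \<in> J"
    have "0 - 1 \<in> S" by (intro invariant_closed)
    then have "- a \<in> J" using assms(4)[of "-1" a] a by simp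
    moreover have "\<ominus>\<^bsub>R\<^esub> a = - a"
      using assms(1) a \<open>- a \<in> J\<close> by (intro R.minus_equality) auto
    ultimately show "\<ominus>\<^bsub>R\<^esub> a \<in> J" by simp
  qed (use assms in auto)
next
  fix a x assume "a \<in> J" "x \<in> carrier R"
  then have "x * a \<in> J" by (intro assms(4)) auto
  then show "x \<otimes>\<^bsub>R\<^esub> a \<in> J" "a \<otimes>\<^bsub>R\<^esub> x \<in> J" by (simp_all add: mult.commute)
qed

lemma genideal_finite_sums:
  assumes A: "finite A" and y: "\<And>j. j \<in> A \<Longrightarrow> y j \<in> S"
  shows "genideal R (y ` A) = {\<Sum>j\<in>A. s j * y j | s. \<forall>j\<in>A. s j \<in> S}" (is "_ = ?J")
proof
  interpret R: ring R by (rule R_ring)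
  have yS: "y ` A \<subseteq> S" using y by auto
  show "genideal R (y ` A) \<subseteq> ?J"
  proof (rule R.genideal_minimal)
    show "ideal ?J R"
    proof (rule invariant_idealI)
      show "?J \<subseteq> S" using y by (auto intro!: inv.S_sum inv.S_mult)
      show "0 \<in> ?J" by (auto intro!: exI[of _ "\<lambda>_. 0"] inv.S_0)
      fix a b
      show "a + b \<in> ?J" if ab: "a \<in> ?J" "b \<in> ?J"
      proof -
        obtain s s' where "a = (\<Sum>j\<in>A. s j * y j)" "b = (\<Sum>j\<in>A. s' j * y j)"
          "\<forall>j\<in>A. s j \<in> S" "\<forall>j\<in>A. s' j \<in> S" using ab by auto
        then have "a + b = (\<Sum>j\<in>A. (s j + s' j) * y j)" "\<forall>j\<in>A. s j + s' j \<in> S"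
          by (auto simp: sum.distrib algebra_simps inv.S_add)
        then show ?thesis by (intro CollectI exI[of _ "\<lambda>j. s j + s' j"] conjI)
      qed
      show "a * b \<in> ?J" if ab: "a \<in> S" "b \<in> ?J"
      proof -
        obtain s where "b = (\<Sum>j\<in>A. s j * y j)" "\<forall>j\<in>A. s j \<in> S" using ab by auto
        then have "a * b = (\<Sum>j\<in>A. (a * s j) * y j)" "\<forall>j\<in>A. a * s j \<in> S"
          using ab(1) by (auto simp: sum_distrib_left mult_ac inv.S_mult)
        then show ?thesis by (intro CollectI exI[of _ "\<lambda>j. a * s j"] conjI)
      qed
    qed
    show "y ` A \<subseteq> ?J"
    proof (rule image_subsetI)
      fix i assume i: "i \<in> A"
      have "(if j = i then 1 else 0) * y j = (if j = i then y j else 0)" for j by simp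
      then have "y i = (\<Sum>j\<in>A. (if j = i then 1 else 0) * y j)" using A i by simp
      moreover have "\<forall>j\<in>A. (if j = i then 1 else 0 :: ('n, 'k) mpol) \<in> S"
        by (auto simp: inv.S_0 inv.S_1)
      ultimately show "y i \<in> ?J" by (intro CollectI exI[of _ "\<lambda>j. if j = i then 1 else 0"] conjI)
    qed
  qed
  interpret I: ideal "genideal R (y ` A)" R by (rule R.genideal_ideal[OF yS])
  show "?J \<subseteq> genideal R (y ` A)"
  proof clarify
    fix s assume s: "\<forall>j\<in>A. s j \<in> S"
    have "finite B \<Longrightarrow> B \<subseteq> A \<Longrightarrow> (\<Sum>j\<in>B. s j * y j) \<in> genideal R (y ` A)" for B
    proof (induction B rule: finite_induct)
      case empty then show ?case using I.zero_closed by simp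
    next
      case (insert j B)
      then have "y j \<in> genideal R (y ` A)" "s j \<in> S" using R.genideal_self[OF yS] s by auto
      then have "s j * y j \<in> genideal R (y ` A)" using I.I_l_closed[of "y j" "s j"] by simp
      then show ?case using insert I.a_closed[of "s j * y j" "\<Sum>j\<in>B. s j * y j"] by simp
    qed
    then show "(\<Sum>j\<in>A. s j * y j) \<in> genideal R (y ` A)" using A by blast
  qed
qed

lemma irrelevant_ideal: "ideal (irrelevant_ideal G) R"
  unfolding irrelevant_ideal_def by (rule ring.genideal_ideal[OF R_ring]) auto

lemma homogeneous_in_irrelevant:
  "f \<in> S \<Longrightarrow> homogeneous n f \<Longrightarrow> 0 < n \<Longrightarrow> f \<in> irrelevant_ideal G"
  unfolding irrelevant_ideal_def
  by (rule subsetD[OF ring.genideal_self[OF R_ring]]) auto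

lemma deg_ge_mult_left: "deg_ge n f \<Longrightarrow> deg_ge n (g * f)" for f g :: "('n, 'k) mpol"
  using deg_ge_mult[of 0 g n f] by (simp add: deg_ge_def)

lemma irrelevant_deg_ge: "f \<in> irrelevant_ideal G \<Longrightarrow> deg_ge 1 f"
proof -
  have "irrelevant_ideal G \<subseteq> {f \<in> S. deg_ge 1 f}"
    unfolding irrelevant_ideal_def
  proof (rule ring.genideal_minimal[OF R_ring])
    show "ideal {f \<in> S. deg_ge 1 f} R"
      by (rule invariant_idealI) (auto simp: invariant_closed deg_ge_add deg_ge_mult_left)
    show "{f \<in> S. \<exists>n>0. homogeneous n f} \<subseteq> {f \<in> S. deg_ge 1 f}"
      by (auto simp: homogeneous_iff deg_ge_def)
  qed
  then show "f \<in> irrelevant_ideal G \<Longrightarrow> deg_ge 1 f" by blast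
qed

lemma irrelevant_power_deg_ge: "f \<in> ideal_power R (irrelevant_ideal G) n \<Longrightarrow> deg_ge n f"
proof (induction n arbitrary: f)
  case 0 then show ?case by (simp add: deg_ge_def)
next
  case (Suc n)
  from Suc.prems show ?case
    unfolding ideal_power_Suc
  proof (induction f rule: ideal_prod.induct)
    case (prod i j)
    then show ?case using deg_ge_mult[OF Suc.IH irrelevant_deg_ge] by simp
  next
    case (sum f g) then show ?case by (simp add: deg_ge_add)
  qed
qed

lemma power_in_ideal_power: "f \<in> I \<Longrightarrow> f ^ n \<in> ideal_power R I n"
proof (induction n)
  case 0 then show ?case by (simp add: ideal_power_0 invariant_closed)
next
  case (Suc n)
  then have "f ^ n \<otimes>\<^bsub>R\<^esub> f \<in> ideal_power R I (Suc n)"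
    unfolding ideal_power_Suc by (intro ideal_prod.prod) auto
  then show ?case by (simp add: mult.commute)
qed

lemma koszul_d_hom:
  assumes "\<And>j. j \<in> {1..d} \<Longrightarrow> y j \<in> S"
  shows "koszul_d d y \<in> mod_hom R (koszul_module S d) (koszul_module S d)"
proof -
  have "koszul_d d y f \<in> koszul S d" if "f \<in> koszul S d" for f
    using assms that by (rule inv.koszul_koszul_d)
  then show ?thesis
    by (simp add: mod_hom_iff koszul_d_add koszul_d_fsmult del: plus_fun_apply)
qed

lemma trunc_hom: "trunc m \<in> mod_hom R (koszul_module S d) (koszul_module S d)"
  by (simp add: mod_hom_iff inv.koszul_trunc trunc_add trunc_fsmult del: plus_fun_apply)

text \<open>If \<open>u\<close> is torsion on the boundaries then it differs from a torsion homomorphism \<open>u'\<close> by one that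
  factors through the differential. Since \<open>y i\<close> maps the module \<open>Z\<close> of cycles to the boundaries, \<open>u\<close>
  vanishes on \<open>x i ^ L\<close> times \<open>Z\<close> for some \<open>L\<close>, and by \<open>graded_artin_rees\<close> it vanishes on the
  cycles of high degree. So there is \<open>u'\<close> that agrees with \<open>u\<close> on \<open>Z\<close> and vanishes on everything
  of high degree, which makes it a torsion homomorphism; and \<open>u\<close> minus \<open>u'\<close> vanishes on \<open>Z\<close>.\<close>
lemma koszul_torsion_approximation:
  fixes M :: "(('n, 'k) mpol, 'b) module" and x :: "nat \<Rightarrow> ('n, 'k) mpol"
  assumes M: "injective_module R M"
    and x: "\<And>j. j \<in> {1..d} \<Longrightarrow> homogeneous (nx j) (x j)" "\<And>j. j \<in> {1..d} \<Longrightarrow> 0 < nx j"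
      "\<And>j. j \<in> {1..d} \<Longrightarrow> x j \<in> S"
    and B: "finite B" "B \<subseteq> S"
      "\<And>f. f \<in> S \<Longrightarrow> \<exists>c. (\<forall>b\<in>B. c b \<in> poly_subst x ` polys_in d) \<and> f = (\<Sum>b\<in>B. c b * b)"
    and y: "\<And>j. j \<in> {1..d} \<Longrightarrow> y j = x j ^ N j" "\<And>j. j \<in> {1..d} \<Longrightarrow> 0 < N j"
    and u: "u \<in> mod_hom R (koszul_module S d) M"
      "\<And>f. f \<in> koszul S d \<Longrightarrow> u (koszul_d d y f) \<in> torsion R (irrelevant_ideal G) M"
  shows "\<exists>u'\<in>mod_hom R (koszul_module S d) M. \<exists>w\<in>mod_hom R (koszul_module S d) M.
    \<forall>f\<in>koszul S d. u' f \<in> torsion R (irrelevant_ideal G) M \<and>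
      u f = u' f \<oplus>\<^bsub>M\<^esub> w (koszul_d d y f)"
proof -
  let ?K = "koszul_module S d" and ?I = "irrelevant_ideal G" and ?d = "koszul_d d y"
  have Mm: "Module.module R M" using M by (simp add: injective_module_def)
  interpret M: Module.module R M by (rule Mm)
  obtain \<phi> :: "(nat set \<Rightarrow> ('n, 'k) mpol) \<Rightarrow> ('n, 'k) mpol" where \<phi>: "inj_on \<phi> (carrier ?K)"
    using koszul_inj by force
  have yS: "y j \<in> S" if "j \<in> {1..d}" for j using y(1) x(3) that by (simp add: inv.S_power)
  have yh: "homogeneous (N j * nx j) (y j)" if "j \<in> {1..d}" for j
    using y(1) x(1) that by (simp add: homogeneous_power)
  have yI: "y j \<in> ?I" if "j \<in> {1..d}" for j
    by (rule homogeneous_in_irrelevant[OF yS[OF that] yh[OF that]]) (use y(2) x(2) that in simp)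
  have dK: "?d \<in> mod_hom R ?K ?K" by (rule koszul_d_hom) (rule yS)
  have dK_in: "?d f \<in> koszul S d" if "f \<in> koszul S d" for f using mod_hom_closed[OF dK] that by simp
  have u_add: "u (f + g) = u f \<oplus>\<^bsub>M\<^esub> u g" if "f \<in> koszul S d" "g \<in> koszul S d" for f g
    using mod_hom_add[OF u(1)] that by simp
  have u_smult: "u (fsmult r f) = r \<odot>\<^bsub>M\<^esub> u f" if "r \<in> S" "f \<in> koszul S d" for r f
    using mod_hom_smult[OF u(1)] that by simp
  have u_car: "u f \<in> carrier M" if "f \<in> koszul S d" for f using mod_hom_closed[OF u(1)] that by simp
  have u_0: "u 0 = \<zero>\<^bsub>M\<^esub>" using mod_hom_zero[OF koszul_module Mm u(1)] by simp
  obtain n where n: "\<And>f. f \<in> koszul S d \<Longrightarrow> u (?d f) \<in> torsion_level R ?I M n"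
  proof -
    have "\<forall>J. \<exists>n. J \<subseteq> {1..d} \<longrightarrow> u (?d (koszul_basis J)) \<in> torsion_level R ?I M n"
    proof
      fix J
      show "\<exists>n. J \<subseteq> {1..d} \<longrightarrow> u (?d (koszul_basis J)) \<in> torsion_level R ?I M n"
      proof (cases "J \<subseteq> {1..d}")
        case True
        from u(2)[OF koszul_basis_in[OF this]] show ?thesis by (auto simp: torsion_eq_Un)
      qed simp
    qed
    then obtain m where m: "\<And>J. J \<subseteq> {1..d} \<Longrightarrow> u (?d (koszul_basis J)) \<in> torsion_level R ?I M (m J)"
      by metis
    define n where "n = Max (m ` Pow {1..d})"
    have le: "torsion_level R ?I M (m J) \<subseteq> torsion_level R ?I M n" if "J \<subseteq> {1..d}" for J
      by (rule torsion_level_mono[OF R_ring irrelevant_ideal]) (use that in \<open>simp add: n_def\<close>)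
    have "u (?d f) \<in> torsion_level R ?I M n" if "f \<in> koszul S d" for f
    proof (rule koszul_hom_into_submodule[OF Mm _ _ _ that])
      show "submodule (torsion_level R ?I M n) R M"
        by (rule torsion_level_submodule[OF Mm irrelevant_ideal])
      show "(\<lambda>f. u (?d f)) \<in> mod_hom R ?K M" by (rule mod_hom_comp[OF u(1) dK])
      show "u (?d (koszul_basis J)) \<in> torsion_level R ?I M n" if "J \<subseteq> {1..d}" for J
        using le[OF that] m[OF that] by blast
    qed
    then show thesis by (rule that)
  qed
  define Z where "Z = {f \<in> koszul S d. ?d f = 0}"
  \<comment> \<open>\<open>x i ^ L\<close> is a multiple of \<open>y i ^ Suc n\<close>: one factor \<open>y i\<close> takes cycles to boundaries, and the
    other \<open>n\<close> factors annihilate \<open>u\<close> on boundaries\<close>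
  define L where "L = (\<Sum>j\<in>{1..d}. N j) * Suc n + 1"
  have u_power: "u (fsmult (x i ^ L) z) = \<zero>\<^bsub>M\<^esub>" if i: "i \<in> {1..d}" and z: "z \<in> Z" for i z
  proof -
    have "N i \<le> (\<Sum>j\<in>{1..d}. N j)" using i by (intro member_le_sum) auto
    then have "N i * Suc n \<le> L" unfolding L_def by (metis mult_le_mono1 trans_le_add1)
    then have "x i ^ L = x i ^ (N i * Suc n) * x i ^ (L - N i * Suc n)"
      by (simp add: power_add[symmetric] del: mult_Suc_right)
    also have "x i ^ (N i * Suc n) = y i ^ n * y i"
      using y(1)[OF i] by (simp only: power_mult power_Suc mult.commute)
    finally have xL: "x i ^ L = y i ^ n * (y i * x i ^ (L - N i * Suc n))" by (simp add: mult_ac)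
    define z' where "z' = fsmult (x i ^ (L - N i * Suc n)) z"
    have z': "z' \<in> koszul S d" "?d z' = 0"
      using z x(3)[OF i] by (auto simp: z'_def Z_def koszul_d_fsmult fun_eq_iff
          intro!: inv.koszul_fsmult inv.S_power)
    note w = inv.koszul_cycle_mult[OF i z']
    have "fsmult (x i ^ L) z = fsmult (y i ^ n) (fsmult (y i) z')"
      by (simp add: xL z'_def fun_eq_iff mult_ac)
    then have "u (fsmult (x i ^ L) z) = u (fsmult (y i ^ n) (fsmult (y i) z'))" by simp
    also have "\<dots> = y i ^ n \<odot>\<^bsub>M\<^esub> u (?d (koszul_wedge i z'))"
      unfolding w(2) using yS[OF i] z'(1)
      by (intro u_smult inv.S_power inv.koszul_fsmult)
    also have "\<dots> = \<zero>\<^bsub>M\<^esub>"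
      using n[OF w(1)] power_in_ideal_power[OF yI[OF i], of n] by (simp add: torsion_level_def)
    finally show ?thesis .
  qed
  have Z_diff: "f - g \<in> Z" if "f \<in> Z" "g \<in> Z" for f g
    using that unfolding Z_def by (simp add: inv.koszul_diff koszul_d_diff)
  have Z_smult: "fsmult r f \<in> Z" if "r \<in> S" "f \<in> Z" for r f
    using that unfolding Z_def by (simp add: inv.koszul_fsmult koszul_d_fsmult fun_eq_iff)
  have Z_add: "f + g \<in> Z" if "f \<in> Z" "g \<in> Z" for f g
    using that unfolding Z_def by (simp add: inv.koszul_add koszul_d_add del: plus_fun_apply)
  have Z_0: "0 \<in> Z" unfolding Z_def by (simp add: inv.koszul_0)
  have ZK: "f \<in> koszul S d" if "f \<in> Z" for f using that by (simp add: Z_def)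
  have "\<exists>M'. \<forall>w\<in>Z. (\<forall>J. deg_ge M' (w J)) \<longrightarrow>
    (\<exists>z. (\<forall>i\<in>{1..d}. z i \<in> Z) \<and> w = (\<Sum>i\<in>{1..d}. fsmult (x i ^ L) (z i)))"
  proof (rule inv.graded_artin_rees[where nx = nx and n = "\<lambda>j. N j * nx j"])
    show "kpart (\<lambda>j. N j * nx j) e f \<in> Z" if "f \<in> Z" for e f
    proof -
      have "?d (kpart (\<lambda>j. N j * nx j) e f) = kpart (\<lambda>j. N j * nx j) e (?d f)"
        by (rule kpart_koszul_d[symmetric]) (rule yh)
      then show ?thesis using that unfolding Z_def by (simp add: inv.koszul_kpart)
    qed
  qed (use x B Z_0 Z_diff Z_smult ZK in \<open>auto simp: L_def\<close>)
  then obtain M' where M': "\<And>w. w \<in> Z \<Longrightarrow> (\<And>J. deg_ge M' (w J)) \<Longrightarrow>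
    \<exists>z. (\<forall>i\<in>{1..d}. z i \<in> Z) \<and> w = (\<Sum>i\<in>{1..d}. fsmult (x i ^ L) (z i))" by blast
  define H where "H = {h \<in> koszul S d. \<forall>J. deg_ge M' (h J)}"
  have u_high: "u w = \<zero>\<^bsub>M\<^esub>" if w: "w \<in> Z" "w \<in> H" for w
  proof -
    obtain z where z: "\<forall>i\<in>{1..d}. z i \<in> Z" "w = (\<Sum>i\<in>{1..d}. fsmult (x i ^ L) (z i))"
      using M'[OF w(1)] w(2) unfolding H_def by blast
    have "finite A \<Longrightarrow> A \<subseteq> {1..d} \<Longrightarrow> (\<Sum>i\<in>A. fsmult (x i ^ L) (z i)) \<in> koszul S d \<and>
        u (\<Sum>i\<in>A. fsmult (x i ^ L) (z i)) = \<zero>\<^bsub>M\<^esub>" for A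
    proof (induction A rule: finite_induct)
      case empty
      show ?case by (simp only: sum.empty u_0 inv.koszul_0 simp_thms)
    next
      case (insert i A)
      let ?s = "\<Sum>i\<in>A. fsmult (x i ^ L) (z i)"
      have s: "?s \<in> koszul S d" "u ?s = \<zero>\<^bsub>M\<^esub>" using insert.IH insert.prems by blast+
      have i: "i \<in> {1..d}" "z i \<in> Z" using insert.prems z(1) by auto
      have zi: "fsmult (x i ^ L) (z i) \<in> koszul S d"
        by (intro inv.koszul_fsmult inv.S_power x(3) i(1) ZK i(2))
      have "fsmult (x i ^ L) (z i) + ?s \<in> koszul S d" by (intro inv.koszul_add zi s(1))
      moreover have "u (fsmult (x i ^ L) (z i) + ?s) = \<zero>\<^bsub>M\<^esub>"
        unfolding u_add[OF zi s(1)] u_power[OF i] s(2) by (rule M.M.l_zero) (rule M.M.zero_closed)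
      ultimately show ?case by (simp only: sum.insert[OF insert.hyps] simp_thms)
    qed
    then show ?thesis unfolding z(2) by blast
  qed
  have H_add: "f + g \<in> H" if "f \<in> H" "g \<in> H" for f g
    using that unfolding H_def by (auto intro!: inv.koszul_add deg_ge_add)
  have H_smult: "fsmult r f \<in> H" if "r \<in> S" "f \<in> H" for r f
    using that unfolding H_def by (auto intro!: inv.koszul_fsmult deg_ge_mult_left)
  have H_0: "0 \<in> H" unfolding H_def by (simp add: inv.koszul_0)
  have HK: "h \<in> koszul S d" if "h \<in> H" for h using that by (simp add: H_def)
  \<comment> \<open>\<open>u\<close> on the cycles and \<open>0\<close> on the elements of high degree\<close>
  define \<Gamma> where "\<Gamma> = {(z + h, u z) |z h. z \<in> Z \<and> h \<in> H}"
  have "\<exists>g\<in>mod_hom R ?K M. \<forall>(f, e)\<in>\<Gamma>. g f = e"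
  proof (rule injective_module_extend_graph[OF M koszul_module \<phi>])
    show "\<Gamma> \<subseteq> carrier ?K \<times> carrier M"
      unfolding \<Gamma>_def using ZK HK u_car by (auto intro!: inv.koszul_add)
    have "(0 + 0, u 0) \<in> \<Gamma>" unfolding \<Gamma>_def using Z_0 H_0 by blast
    then show "(\<zero>\<^bsub>?K\<^esub>, \<zero>\<^bsub>M\<^esub>) \<in> \<Gamma>" by (simp add: u_0)
  next
    fix f e g e' assume "(f, e) \<in> \<Gamma>" "(g, e') \<in> \<Gamma>"
    then obtain z h z' h' where *: "f = z + h" "e = u z" "g = z' + h'" "e' = u z'"
      "z \<in> Z" "h \<in> H" "z' \<in> Z" "h' \<in> H" unfolding \<Gamma>_def by blast
    have "((z + z') + (h + h'), u (z + z')) \<in> \<Gamma>" unfolding \<Gamma>_def using * Z_add H_add by blast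
    moreover have "f + g = (z + z') + (h + h')" unfolding * by (simp only: add_ac)
    ultimately show "(f \<oplus>\<^bsub>?K\<^esub> g, e \<oplus>\<^bsub>M\<^esub> e') \<in> \<Gamma>"
      using * by (simp only: u_add ZK koszul_module_simps)
  next
    fix r f e assume r: "r \<in> carrier R" and "(f, e) \<in> \<Gamma>"
    then obtain z h where *: "f = z + h" "e = u z" "z \<in> Z" "h \<in> H" unfolding \<Gamma>_def by blast
    have "(fsmult r z + fsmult r h, u (fsmult r z)) \<in> \<Gamma>"
      unfolding \<Gamma>_def using * r Z_smult H_smult by blast
    moreover have "fsmult r f = fsmult r z + fsmult r h"
      unfolding * by (simp add: fun_eq_iff distrib_left)
    ultimately show "(r \<odot>\<^bsub>?K\<^esub> f, r \<odot>\<^bsub>M\<^esub> e) \<in> \<Gamma>"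
      using * r by (simp only: u_smult ZK koszul_module_simps)
  next
    fix e assume "(\<zero>\<^bsub>?K\<^esub>, e) \<in> \<Gamma>"
    then obtain z h where *: "0 = z + h" "e = u z" "z \<in> Z" "h \<in> H" unfolding \<Gamma>_def by auto
    have "0 - 1 \<in> S" by (intro invariant_closed)
    then have "fsmult (0 - 1) h \<in> H" using *(4) by (rule H_smult)
    moreover have "fsmult (0 - 1) h = z"
    proof -
      have "z = 0 - h" using *(1) by (metis add_diff_cancel_right')
      then show ?thesis by (simp add: fun_eq_iff)
    qed
    ultimately show "e = \<zero>\<^bsub>M\<^esub>" using u_high[OF *(3)] *(2) by simp
  qed
  then obtain u' where u': "u' \<in> mod_hom R ?K M" "\<forall>(f, e)\<in>\<Gamma>. u' f = e" by blast
  have u'_Z: "u' z = u z" if "z \<in> Z" for z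
  proof -
    have "(z + 0, u z) \<in> \<Gamma>" unfolding \<Gamma>_def using that H_0 by blast
    then show ?thesis using u'(2) by auto
  qed
  have u'_H: "u' h = \<zero>\<^bsub>M\<^esub>" if "h \<in> H" for h
  proof -
    have "(0 + h, u 0) \<in> \<Gamma>" unfolding \<Gamma>_def using that Z_0 by blast
    then show ?thesis using u'(2) u_0 by auto
  qed
  have u'_car: "u' f \<in> carrier M" if "f \<in> koszul S d" for f using mod_hom_closed[OF u'(1)] that by simp
  have u'_torsion: "u' f \<in> torsion R ?I M" if f: "f \<in> koszul S d" for f
  proof -
    have "r \<odot>\<^bsub>M\<^esub> u' f = \<zero>\<^bsub>M\<^esub>" if r: "r \<in> ideal_power R ?I M'" for r
    proof -
      have rS: "r \<in> S" using ideal.Icarr[OF ring.ideal_power_ideal[OF R_ring irrelevant_ideal] r] .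
      have "deg_ge (M' + 0) (r * f J)" for J
        using irrelevant_power_deg_ge[OF r] by (rule deg_ge_mult) (simp add: deg_ge_def)
      then have "fsmult r f \<in> H" using rS f by (simp add: H_def inv.koszul_fsmult)
      then show ?thesis using u'_H mod_hom_smult[OF u'(1), of r f] rS f by simp
    qed
    then show ?thesis using u'_car[OF f] by (auto simp: torsion_def)
  qed
  define v where "v f = u f \<ominus>\<^bsub>M\<^esub> u' f" for f
  have v: "v \<in> mod_hom R ?K M" unfolding v_def by (rule mod_hom_diff[OF koszul_module Mm u(1) u'(1)])
  \<comment> \<open>\<open>v\<close> vanishes on the cycles, so it induces a homomorphism on the boundaries\<close>
  define \<Delta> where "\<Delta> = {(?d f, v f) |f. f \<in> koszul S d}"
  have "\<exists>g\<in>mod_hom R ?K M. \<forall>(f, e)\<in>\<Delta>. g f = e"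
  proof (rule injective_module_extend_graph[OF M koszul_module \<phi>])
    show "\<Delta> \<subseteq> carrier ?K \<times> carrier M"
      unfolding \<Delta>_def using dK_in mod_hom_closed[OF v] by auto
    have "(?d 0, v 0) \<in> \<Delta>" unfolding \<Delta>_def using inv.koszul_0 by blast
    then show "(\<zero>\<^bsub>?K\<^esub>, \<zero>\<^bsub>M\<^esub>) \<in> \<Delta>" using mod_hom_zero[OF koszul_module Mm v] by simp
  next
    fix f e g e' assume "(f, e) \<in> \<Delta>" "(g, e') \<in> \<Delta>"
    then obtain a b where *: "f = ?d a" "e = v a" "g = ?d b" "e' = v b"
      "a \<in> koszul S d" "b \<in> koszul S d" unfolding \<Delta>_def by blast
    have "(?d (a + b), v (a + b)) \<in> \<Delta>" unfolding \<Delta>_def using * inv.koszul_add by blast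
    moreover have "v (a + b) = v a \<oplus>\<^bsub>M\<^esub> v b" using mod_hom_add[OF v] * by simp
    ultimately show "(f \<oplus>\<^bsub>?K\<^esub> g, e \<oplus>\<^bsub>M\<^esub> e') \<in> \<Delta>"
      unfolding * by (simp only: koszul_d_add koszul_module_simps)
  next
    fix r f e assume r: "r \<in> carrier R" and "(f, e) \<in> \<Delta>"
    then obtain a where *: "f = ?d a" "e = v a" "a \<in> koszul S d" unfolding \<Delta>_def by blast
    have "(?d (fsmult r a), v (fsmult r a)) \<in> \<Delta>" unfolding \<Delta>_def using * r inv.koszul_fsmult by blast
    moreover have "v (fsmult r a) = r \<odot>\<^bsub>M\<^esub> v a" using mod_hom_smult[OF v, of r a] * r by simp
    ultimately show "(r \<odot>\<^bsub>?K\<^esub> f, r \<odot>\<^bsub>M\<^esub> e) \<in> \<Delta>"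
      unfolding * by (simp only: koszul_d_fsmult koszul_module_simps)
  next
    fix e assume "(\<zero>\<^bsub>?K\<^esub>, e) \<in> \<Delta>"
    then obtain a where *: "?d a = 0" "e = v a" "a \<in> koszul S d" unfolding \<Delta>_def by auto
    then have "a \<in> Z" by (simp add: Z_def)
    then show "e = \<zero>\<^bsub>M\<^esub>" using *(2) u'_Z u_car[OF *(3)] by (simp add: v_def a_minus_def M.M.r_neg)
  qed
  then obtain w where w: "w \<in> mod_hom R ?K M" "\<forall>(f, e)\<in>\<Delta>. w f = e" by blast
  have "u f = u' f \<oplus>\<^bsub>M\<^esub> w (?d f)" if f: "f \<in> koszul S d" for f
  proof -
    have "w (?d f) = u f \<ominus>\<^bsub>M\<^esub> u' f" using w(2) f by (auto simp: \<Delta>_def v_def)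
    then show ?thesis
      using u_car[OF f] u'_car[OF f] by (simp add: a_minus_def M.M.a_lcomm[of "u' f"] M.M.r_neg)
  qed
  then show ?thesis using u'(1) w(1) u'_torsion by blast
qed

lemma koszul_d_basis:
  assumes t: "t \<in> {1..d}"
  shows "koszul_d d y (koszul_basis ({1..d} - {t})) =
    (\<Sum>j\<in>{1..d} - {t}. fsmult (y j) (fsmult (koszul_sign j ({1..d} - {t} - {j}))
      (koszul_basis ({1..d} - {t} - {j}) :: _ \<Rightarrow> ('n, 'k) mpol)))"
proof
  fix L
  let ?D = "{1..d} - {t}"
  have "koszul_d d y (koszul_basis ?D) L = (\<Sum>j\<in>{1..d}.
      if j \<in> ?D \<and> L = ?D - {j} then y j * koszul_sign j (?D - {j}) else (0 :: ('n, 'k) mpol))"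
  proof (cases "L \<subseteq> {1..d}")
    case True
    have "koszul_d d y (koszul_basis ?D) L =
      (\<Sum>j\<in>{1..d} - L. koszul_sign j L * y j * (if insert j L = ?D then 1 else 0))"
      using True by (simp only: koszul_d_def koszul_basis_def if_True)
    also have "\<dots> = (\<Sum>j\<in>{1..d}. if j \<in> ?D \<and> L = ?D - {j} then y j * koszul_sign j (?D - {j}) else 0)"
      by (rule sum.mono_neutral_cong_left) (auto simp: mult.commute)
    finally show ?thesis .
  next
    case False
    then have "(if j \<in> ?D \<and> L = ?D - {j} then y j * koszul_sign j (?D - {j}) else 0) = (0 :: ('n, 'k) mpol)" for j
      by auto
    then show ?thesis using False by (simp only: koszul_d_def if_False sum.neutral_const)
  qed
  also have "\<dots> = (\<Sum>j\<in>?D. fsmult (y j) (fsmult (koszul_sign j (?D - {j})) (koszul_basis (?D - {j}))) L)"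
    by (rule sum.mono_neutral_cong_right) (auto simp: koszul_basis_def)
  finally show "koszul_d d y (koszul_basis ?D) L =
    (\<Sum>j\<in>?D. fsmult (y j) (fsmult (koszul_sign j (?D - {j})) (koszul_basis (?D - {j})))) L"
    by (simp only: sum_apply)
qed

text \<open>The relation \<open>s\<close> defines a cocycle \<open>z\<close> of degree \<open>d - 1\<close> on the Koszul complex of \<open>y\<close>, whose value
  on the basis element of \<open>{1..d} - {t}\<close> is \<open>s t\<close> up to sign. By
  \<open>torsion_approximation.annihilate\<close>, the product of the \<open>c j\<close> times \<open>z\<close> is \<open>\<sigma>\<close> after the
  differential for a homomorphism \<open>\<sigma>\<close> into the ring, and the boundary of this basis element is a
  combination of the \<open>y j\<close> with \<open>j \<noteq> t\<close>.\<close>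
lemma annihilator_products_colon:
  fixes E :: "nat \<Rightarrow> (('n, 'k) mpol, 'b) module" and \<delta> :: "nat \<Rightarrow> 'b \<Rightarrow> 'b"
    and \<epsilon> :: "('n, 'k) mpol \<Rightarrow> 'b" and x :: "nat \<Rightarrow> ('n, 'k) mpol"
  assumes res: "injective_resolution R (regular_module R) E \<delta> \<epsilon>"
    and C: "\<And>j. j < d \<Longrightarrow> C j \<subseteq> annihilator R (local_cohomology R (irrelevant_ideal G) E \<delta> j)"
    and x: "\<And>j. j \<in> {1..d} \<Longrightarrow> homogeneous (nx j) (x j)" "\<And>j. j \<in> {1..d} \<Longrightarrow> 0 < nx j"
      "\<And>j. j \<in> {1..d} \<Longrightarrow> x j \<in> S"
    and B: "finite B" "B \<subseteq> S"
      "\<And>f. f \<in> S \<Longrightarrow> \<exists>c. (\<forall>b\<in>B. c b \<in> poly_subst x ` polys_in d) \<and> f = (\<Sum>b\<in>B. c b * b)"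
    and y: "\<And>j. j \<in> {1..d} \<Longrightarrow> y j = x j ^ N j" "\<And>j. j \<in> {1..d} \<Longrightarrow> 0 < N j"
    and t: "t \<in> {1..d}" and c: "\<And>j. j < d \<Longrightarrow> c j \<in> C j"
    and syz: "\<And>j. j \<in> {1..d} \<Longrightarrow> s j \<in> S" "(\<Sum>j\<in>{1..d}. s j * y j) = 0"
  shows "(\<Prod>j<d. c j) * s t \<in> genideal R (y ` ({1..d} - {t}))"
proof -
  let ?K = "koszul_module S d" and ?I = "irrelevant_ideal G" and ?d = "koszul_d d y"
  let ?D = "{1..d} - {t}"
  have inj: "injective_module R (E q)" for q using res by (simp add: injective_resolution_def)
  have E: "Module.module R (E q)" for q using inj by (simp add: injective_module_def)
  have \<delta>: "\<delta> q \<in> mod_hom R (E q) (E (Suc q))" for q using res by (simp add: injective_resolution_def)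
  have exact: "\<delta> q ` carrier (E q) = {e \<in> carrier (E (Suc q)). \<delta> (Suc q) e = \<zero>\<^bsub>E (Suc (Suc q))\<^esub>}" for q
    using res by (simp add: injective_resolution_def a_kernel_def')
  have \<epsilon>: "\<epsilon> \<in> mod_hom R (regular_module R) (E 0)" "inj_on \<epsilon> S"
    "\<epsilon> ` S = {e \<in> carrier (E 0). \<delta> 0 e = \<zero>\<^bsub>E (Suc 0)\<^esub>}"
    using res by (simp_all add: injective_resolution_def a_kernel_def')
  have reg: "Module.module R (regular_module R)" by (rule regular_module_module[OF cring_invariant])
  have \<epsilon>_simps: "\<epsilon> f \<in> carrier (E 0)" "\<epsilon> (f + g) = \<epsilon> f \<oplus>\<^bsub>E 0\<^esub> \<epsilon> g" "\<epsilon> (f * g) = f \<odot>\<^bsub>E 0\<^esub> \<epsilon> g"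
    if "f \<in> S" "g \<in> S" for f g
    using mod_hom_closed[OF \<epsilon>(1), of f] mod_hom_add[OF \<epsilon>(1), of f g] mod_hom_smult[OF \<epsilon>(1), of f g] that
    by simp_all
  have \<epsilon>_0: "\<epsilon> 0 = \<zero>\<^bsub>E 0\<^esub>" using mod_hom_zero[OF reg E \<epsilon>(1)] by simp
  have yS: "y j \<in> S" if "j \<in> {1..d}" for j using y(1) x(3) that by (simp add: inv.S_power)
  have dK: "?d \<in> mod_hom R ?K ?K" by (rule koszul_d_hom) (rule yS)
  have dK_in: "?d f \<in> koszul S d" if "f \<in> koszul S d" for f using mod_hom_closed[OF dK] that by simp
  define T where "T q = torsion R ?I (E q)" for q
  have T: "submodule (T q) R (E q)" for q unfolding T_def by (rule torsion_submodule[OF E irrelevant_ideal])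
  have T\<delta>: "\<delta> q e \<in> T (Suc q)" if "e \<in> T q" for q e
    using that unfolding T_def by (rule mod_hom_torsion[OF E E irrelevant_ideal \<delta>])
  \<comment> \<open>the hypothesis on \<open>C\<close> is limited to indices less than \<open>d\<close>\<close>
  define C' where "C' q = (if q < d then C q else {})" for q
  interpret ta: torsion_approximation R ?K ?d trunc E \<delta> T C' d
  proof (rule torsion_approximation.intro)
    show "Module.module R ?K" by (rule koszul_module)
    show "?d \<in> mod_hom R ?K ?K" by (rule dK)
    show "?d (?d f) = \<zero>\<^bsub>?K\<^esub>" for f by (simp only: koszul_d_d koszul_module_simps)
    show "trunc m \<in> mod_hom R ?K ?K" for m by (rule trunc_hom)
    show "trunc 0 f = \<zero>\<^bsub>?K\<^esub>" for f by (simp only: trunc_0 koszul_module_simps)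
    show "trunc m (?d f) = ?d (trunc (Suc m) f)" for m f by (rule trunc_koszul_d)
    show "trunc m (trunc m f) = trunc m f" for m and f :: "nat set \<Rightarrow> ('n, 'k) mpol" by (rule trunc_trunc)
    show "Module.module R (E q)" for q by (rule E)
    show "\<delta> q \<in> mod_hom R (E q) (E (Suc q))" for q by (rule \<delta>)
    show "\<delta> (Suc q) (\<delta> q e) = \<zero>\<^bsub>E (Suc (Suc q))\<^esub>" if "e \<in> carrier (E q)" for q e
      using exact[of q] that by blast
    show "e \<in> \<delta> q ` carrier (E q)"
      if "e \<in> carrier (E (Suc q))" "\<delta> (Suc q) e = \<zero>\<^bsub>E (Suc (Suc q))\<^esub>" for q e
      using exact[of q] that by blast
    show "submodule (T q) R (E q)" for q by (rule T)
    show "\<delta> q e \<in> T (Suc q)" if "e \<in> T q" for q e using that by (rule T\<delta>)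
    show "\<exists>h\<in>mod_hom R ?K (E q). \<forall>f\<in>carrier ?K. h f \<in> Q \<and> \<delta> q (h f) = g f"
      if "g \<in> mod_hom R ?K (E (Suc q))" "submodule Q R (E q)"
        "\<And>f. f \<in> carrier ?K \<Longrightarrow> g f \<in> \<delta> q ` Q" for q Q g
      using koszul_projective[OF E E \<delta> that(2,1)] that(3) by simp
    show "\<exists>u'\<in>mod_hom R ?K (E q). \<exists>w\<in>mod_hom R ?K (E q).
        \<forall>f\<in>carrier ?K. u' f \<in> T q \<and> u f = u' f \<oplus>\<^bsub>E q\<^esub> w (?d f)"
      if "u \<in> mod_hom R ?K (E q)" "\<And>f. f \<in> carrier ?K \<Longrightarrow> u (?d f) \<in> T q" for q u
      using koszul_torsion_approximation[OF inj x B y that(1)] that(2) by (simp add: T_def)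
    show "C' q \<subseteq> carrier R" for q
      using C[of q] by (auto simp: C'_def annihilator_def)
    show "e \<odot>\<^bsub>E q\<^esub> z \<in> (case q of 0 \<Rightarrow> {\<zero>\<^bsub>E 0\<^esub>} | Suc i \<Rightarrow> \<delta> i ` T i)"
      if q: "q < d" and e: "e \<in> C' q" and z: "z \<in> T q" "\<delta> q z = \<zero>\<^bsub>E (Suc q)\<^esub>" for q e z
    proof (rule annihilator_subquotientD[OF E])
      show "e \<in> annihilator R (subquotient (E q) {z \<in> torsion R ?I (E q). \<delta> q z = \<zero>\<^bsub>E (Suc q)\<^esub>}
          (case q of 0 \<Rightarrow> {\<zero>\<^bsub>E 0\<^esub>} | Suc i \<Rightarrow> \<delta> i ` T i))"
        using C[OF q] e q unfolding C'_def local_cohomology_def T_def by auto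
      show "z \<in> {z \<in> torsion R ?I (E q). \<delta> q z = \<zero>\<^bsub>E (Suc q)\<^esub>}" using z by (simp add: T_def)
      show "{z \<in> torsion R ?I (E q). \<delta> q z = \<zero>\<^bsub>E (Suc q)\<^esub>} \<subseteq> carrier (E q)" by (auto simp: torsion_def)
      show "submodule (case q of 0 \<Rightarrow> {\<zero>\<^bsub>E 0\<^esub>} | Suc i \<Rightarrow> \<delta> i ` T i) R (E q)"
      proof (cases q)
        case 0
        interpret E0: Module.module R "E 0" by (rule E)
        show ?thesis unfolding 0 by (simp, rule E0.submoduleI) (auto simp: E0.M.minus_zero_eq)
      next
        case (Suc i)
        have "submodule (\<delta> i ` T i) R (E (Suc i))" by (rule mod_hom_image_submodule[OF E E \<delta> T])
        then show ?thesis by (simp add: Suc)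
      qed
    qed
  qed
  \<comment> \<open>the signs are those with which \<open>y i\<close> occurs in the boundary of the top basis element\<close>
  define \<zeta> where "\<zeta> i = koszul_sign i ({1..d} - {i}) * s i" for i
  have \<zeta>S: "\<zeta> i \<in> S" if "i \<in> {1..d}" for i
    unfolding \<zeta>_def using syz(1)[OF that] by (intro inv.S_mult inv.S_sign)
  define z where "z f = (\<Sum>i\<in>{1..d}. \<zeta> i * f ({1..d} - {i}))" for f :: "nat set \<Rightarrow> ('n, 'k) mpol"
  have zS: "z f \<in> S" if "f \<in> koszul S d" for f
    unfolding z_def using that \<zeta>S by (intro inv.S_sum inv.S_mult) (auto simp: koszul_def)
  have z_hom: "z \<in> mod_hom R ?K (regular_module R)"
    unfolding mod_hom_iff using zS
    by (auto simp: z_def sum.distrib distrib_left sum_distrib_left mult_ac)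
  have z_d: "z (?d f) = 0" for f
  proof -
    have "z (?d f) = (\<Sum>i\<in>{1..d}. s i * y i * f {1..d})"
      unfolding z_def
    proof (intro sum.cong refl)
      fix i assume i: "i \<in> {1..d}"
      let ?c = "koszul_sign i ({1..d} - {i}) :: ('n, 'k) mpol"
      have "{1..d} - ({1..d} - {i}) = {i}" "insert i ({1..d} - {i}) = {1..d}" using i by auto
      then have "?d f ({1..d} - {i}) = ?c * y i * f {1..d}"
        unfolding koszul_d_def by (simp only: Diff_subset if_True) simp
      then have "\<zeta> i * ?d f ({1..d} - {i}) = (?c * ?c) * (s i * y i * f {1..d})"
        by (simp only: \<zeta>_def mult_ac)
      then show "\<zeta> i * ?d f ({1..d} - {i}) = s i * y i * f {1..d}" by simp
    qed
    then show ?thesis using syz(2) by (simp add: sum_distrib_right[symmetric])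
  qed
  have z_trunc: "z (trunc d f) = z f" for f
    unfolding z_def by (intro sum.cong refl) (auto simp: trunc_def)
  have bd0: "ta.bd 0 = {\<zero>\<^bsub>E 0\<^esub>}" by (simp add: ta.bd_def)
  have "\<exists>w\<in>mod_hom R ?K (E 0). \<forall>f\<in>carrier ?K. \<delta> 0 (w f) = \<zero>\<^bsub>E (Suc 0)\<^esub> \<and>
    interval_prod R c 0 d \<odot>\<^bsub>E 0\<^esub> \<epsilon> (z f) \<ominus>\<^bsub>E 0\<^esub> w (?d f) \<in> ta.bd 0"
  proof (rule ta.annihilate)
    show "(\<lambda>f. \<epsilon> (z f)) \<in> mod_hom R ?K (E 0)" by (rule mod_hom_comp[OF \<epsilon>(1) z_hom])
    show "\<epsilon> (z (trunc d f)) = \<epsilon> (z f)" for f by (simp only: z_trunc)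
    show "\<delta> 0 (\<epsilon> (z f)) = \<zero>\<^bsub>E (Suc 0)\<^esub>" if "f \<in> carrier ?K" for f
      using \<epsilon>(3) zS that by auto
    show "\<epsilon> (z (?d f)) \<in> ta.bd 0" for f by (simp add: z_d \<epsilon>_0 bd0)
    show "c (0 + i) \<in> C' (0 + i)" if "i < d" for i using c[OF that] that by (simp add: C'_def)
  qed simp
  then obtain w where w: "w \<in> mod_hom R ?K (E 0)"
    "\<And>f. f \<in> koszul S d \<Longrightarrow> \<delta> 0 (w f) = \<zero>\<^bsub>E (Suc 0)\<^esub>"
    "\<And>f. f \<in> koszul S d \<Longrightarrow> (\<Prod>i<d. c i) \<odot>\<^bsub>E 0\<^esub> \<epsilon> (z f) \<ominus>\<^bsub>E 0\<^esub> w (?d f) = \<zero>\<^bsub>E 0\<^esub>"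
    by (auto simp: bd0 interval_prod_invariant)
  interpret E0: Module.module R "E 0" by (rule E)
  have w_car: "w f \<in> carrier (E 0)" if "f \<in> koszul S d" for f using mod_hom_closed[OF w(1)] that by simp
  define \<sigma> where "\<sigma> f = inv_into S \<epsilon> (w f)" for f
  have \<sigma>: "\<sigma> f \<in> S" "\<epsilon> (\<sigma> f) = w f" if "f \<in> koszul S d" for f
  proof -
    have "w f \<in> \<epsilon> ` S" using \<epsilon>(3) w(2) w_car that by auto
    then show "\<sigma> f \<in> S" "\<epsilon> (\<sigma> f) = w f"
      unfolding \<sigma>_def by (rule inv_into_into, rule f_inv_into_f)
  qed
  have \<sigma>_eq: "\<sigma> f = r" if "f \<in> koszul S d" "r \<in> S" "\<epsilon> r = w f" for f r
    using \<sigma>[OF that(1)] that by (intro inj_onD[OF \<epsilon>(2)]) simp_all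
  have \<sigma>_add: "\<sigma> (f + g) = \<sigma> f + \<sigma> g" if fg: "f \<in> koszul S d" "g \<in> koszul S d" for f g
  proof (rule \<sigma>_eq)
    show "\<epsilon> (\<sigma> f + \<sigma> g) = w (f + g)"
      using mod_hom_add[OF w(1), of f g] fg \<sigma>[OF fg(1)] \<sigma>[OF fg(2)] \<epsilon>_simps(2)[of "\<sigma> f" "\<sigma> g"] by simp
  qed (use fg \<sigma> in \<open>auto intro: inv.koszul_add inv.S_add\<close>)
  have \<sigma>_smult: "\<sigma> (fsmult r f) = r * \<sigma> f" if rf: "r \<in> S" "f \<in> koszul S d" for r f
  proof (rule \<sigma>_eq)
    show "\<epsilon> (r * \<sigma> f) = w (fsmult r f)"
      using mod_hom_smult[OF w(1), of r f] rf \<sigma>[OF rf(2)] \<epsilon>_simps(3)[of r "\<sigma> f"] by simp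
  qed (use rf \<sigma> in \<open>auto intro: inv.koszul_fsmult inv.S_mult\<close>)
  have cS: "(\<Prod>i<d. c i) \<in> S"
  proof (rule inv.S_prod)
    fix i assume "i \<in> {..<d}"
    then have "c i \<in> annihilator R (local_cohomology R ?I E \<delta> i)" using C c by blast
    then show "c i \<in> S" unfolding annihilator_def by blast
  qed
  let ?b = "koszul_basis ?D :: nat set \<Rightarrow> ('n, 'k) mpol"
  let ?J = "genideal R (y ` ?D)"
  have b: "?b \<in> koszul S d" by (rule koszul_basis_in) (rule Diff_subset)
  have zb: "z ?b = \<zeta> t"
  proof -
    have "\<zeta> i * ?b ({1..d} - {i}) = (if i = t then \<zeta> t else 0)" if "i \<in> {1..d}" for i
    proof -
      have "{1..d} - {i} = ?D \<longleftrightarrow> i = t"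
      proof
        assume "{1..d} - {i} = ?D"
        then have "t \<notin> {1..d} - {i}" by simp
        then show "i = t" using t by simp
      qed simp
      then show ?thesis by (simp add: koszul_basis_def)
    qed
    then have "z ?b = (\<Sum>i\<in>{1..d}. if i = t then \<zeta> t else 0)" unfolding z_def by (rule sum.cong[OF refl])
    also have "\<dots> = \<zeta> t" using t by simp
    finally show ?thesis .
  qed
  have "\<epsilon> ((\<Prod>i<d. c i) * \<zeta> t) = w (?d ?b)"
  proof -
    have a: "(\<Prod>i<d. c i) \<odot>\<^bsub>E 0\<^esub> \<epsilon> (\<zeta> t) \<in> carrier (E 0)"
      using cS \<epsilon>_simps(1)[OF \<zeta>S[OF t] \<zeta>S[OF t]] by simp
    have "(\<Prod>i<d. c i) \<odot>\<^bsub>E 0\<^esub> \<epsilon> (\<zeta> t) \<ominus>\<^bsub>E 0\<^esub> w (?d ?b) = \<zero>\<^bsub>E 0\<^esub>"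
      using w(3)[OF b] by (simp only: zb)
    then have "(\<Prod>i<d. c i) \<odot>\<^bsub>E 0\<^esub> \<epsilon> (\<zeta> t) = w (?d ?b)"
      using a w_car[OF dK_in[OF b]] by (rule E0.M.eq_if_minus_eq_zero)
    then show ?thesis using \<epsilon>_simps(3)[OF cS \<zeta>S[OF t]] by simp
  qed
  then have c\<zeta>: "(\<Prod>i<d. c i) * \<zeta> t = \<sigma> (?d ?b)"
    using \<sigma>_eq[OF dK_in[OF b] inv.S_mult[OF cS \<zeta>S[OF t]]] by simp
  have J: "ideal ?J R" by (rule ring.genideal_ideal[OF R_ring]) (use yS in auto)
  interpret J: ideal ?J R by (rule J)
  have "finite A \<Longrightarrow> A \<subseteq> ?D \<Longrightarrow>
    (\<Sum>j\<in>A. fsmult (y j) (fsmult (koszul_sign j (?D - {j})) (koszul_basis (?D - {j})))) \<in> koszul S d \<and>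
    \<sigma> (\<Sum>j\<in>A. fsmult (y j) (fsmult (koszul_sign j (?D - {j})) (koszul_basis (?D - {j})))) \<in> ?J" for A
  proof (induction A rule: finite_induct)
    case empty
    have "\<sigma> 0 = 0" by (rule \<sigma>_eq) (simp_all add: inv.koszul_0 inv.S_0 \<epsilon>_0 mod_hom_zero[OF koszul_module E w(1), simplified])
    then show ?case using J.zero_closed by (simp only: sum.empty inv.koszul_0 invariant_simps simp_thms)
  next
    case (insert j A)
    let ?g = "\<lambda>j. fsmult (koszul_sign j (?D - {j})) (koszul_basis (?D - {j})) :: nat set \<Rightarrow> ('n, 'k) mpol"
    have IH: "(\<Sum>j\<in>A. fsmult (y j) (?g j)) \<in> koszul S d" "\<sigma> (\<Sum>j\<in>A. fsmult (y j) (?g j)) \<in> ?J"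
      using insert.IH insert.prems by blast+
    have j: "j \<in> ?D" "j \<in> {1..d}" using insert.prems by auto
    have g: "?g j \<in> koszul S d" by (intro inv.koszul_fsmult inv.S_sign koszul_basis_in) auto
    have yg: "fsmult (y j) (?g j) \<in> koszul S d" by (intro inv.koszul_fsmult yS j g)
    have "y ` ?D \<subseteq> carrier R" using yS by blast
    from subsetD[OF ring.genideal_self[OF R_ring this]] j(1) have "y j \<in> ?J" by blast
    then have "y j * \<sigma> (?g j) \<in> ?J" using J.I_r_closed[of "y j" "\<sigma> (?g j)"] \<sigma>(1)[OF g] by simp
    then have "\<sigma> (fsmult (y j) (?g j)) \<in> ?J" by (simp only: \<sigma>_smult[OF yS[OF j(2)] g])
    then have "\<sigma> (fsmult (y j) (?g j) + (\<Sum>j\<in>A. fsmult (y j) (?g j))) \<in> ?J"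
      using J.a_closed[OF _ IH(2)] \<sigma>_add[OF yg IH(1)] by simp
    moreover have "fsmult (y j) (?g j) + (\<Sum>j\<in>A. fsmult (y j) (?g j)) \<in> koszul S d"
      by (rule inv.koszul_add[OF yg IH(1)])
    ultimately show ?case by (simp only: sum.insert[OF insert.hyps] simp_thms)
  qed
  from this[of ?D] have "\<sigma> (?d ?b) \<in> ?J" unfolding koszul_d_basis[OF t] by blast
  then have "(\<Prod>i<d. c i) * \<zeta> t \<in> ?J" by (simp only: c\<zeta>)
  then have "koszul_sign t ({1..d} - {t}) * ((\<Prod>i<d. c i) * \<zeta> t) \<in> ?J"
    using J.I_l_closed[OF _ inv.S_sign] by simp
  moreover have "koszul_sign t ({1..d} - {t}) * ((\<Prod>i<d. c i) * \<zeta> t) =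
    (koszul_sign t ({1..d} - {t}) * koszul_sign t ({1..d} - {t})) * ((\<Prod>i<d. c i) * s t)"
    by (simp only: \<zeta>_def mult_ac)
  ultimately show ?thesis by simp
qed

text \<open>A case of Krull's intersection theorem: when \<open>N\<close> exceeds the degree of \<open>f\<close>, the powers \<open>x j ^ N\<close>
  with \<open>j\<close> in \<open>A'\<close> contribute nothing to the homogeneous components of \<open>f\<close>.\<close>
lemma mem_genideal_if_mem_modulo_powers:
  assumes x: "\<And>j. j \<in> A \<union> A' \<Longrightarrow> x j \<in> S" "\<And>j. j \<in> A \<union> A' \<Longrightarrow> homogeneous (nx j) (x j)"
      "\<And>j. j \<in> A' \<Longrightarrow> 0 < nx j"
    and A: "finite A" "finite A'" "A \<inter> A' = {}"
    and f: "\<And>N. 0 < N \<Longrightarrow> f \<in> genideal R ((\<lambda>j. x j ^ (if j \<in> A then 1 else N)) ` (A \<union> A'))"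
  shows "f \<in> genideal R (x ` A)"
proof -
  obtain b where b: "deg_le b f" using deg_le_exists by blast
  have "genideal R ((\<lambda>j. x j ^ (if j \<in> A then 1 else Suc b)) ` (A \<union> A')) =
    {\<Sum>j\<in>A \<union> A'. s j * x j ^ (if j \<in> A then 1 else Suc b) |s. \<forall>j\<in>A \<union> A'. s j \<in> S}"
    by (rule genideal_finite_sums) (use A x(1) in \<open>auto intro: inv.S_power inv.S_mult\<close>)
  with f[of "Suc b"]
  have "f \<in> {\<Sum>j\<in>A \<union> A'. s j * x j ^ (if j \<in> A then 1 else Suc b) |s. \<forall>j\<in>A \<union> A'. s j \<in> S}"
    by blast
  then obtain s where s: "\<forall>j\<in>A \<union> A'. s j \<in> S"
    "f = (\<Sum>j\<in>A \<union> A'. s j * x j ^ (if j \<in> A then 1 else Suc b))" by auto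
  have part: "hpart e f = (\<Sum>j\<in>A. (if nx j \<le> e then hpart (e - nx j) (s j) else 0) * x j)"
    if e: "e \<le> b" for e
  proof -
    have "f = (\<Sum>j\<in>A. x j * s j) + (\<Sum>j\<in>A'. x j ^ Suc b * s j)"
      unfolding s(2) using A by (subst sum.union_disjoint) (auto simp: mult.commute intro!: sum.cong)
    then have "hpart e f = (\<Sum>j\<in>A. hpart e (x j * s j)) + (\<Sum>j\<in>A'. hpart e (x j ^ Suc b * s j))"
      by (simp only: hpart_add hpart_sum)
    also have "(\<Sum>j\<in>A'. hpart e (x j ^ Suc b * s j)) = 0"
    proof (rule sum.neutral, rule ballI)
      fix j assume j: "j \<in> A'"
      have "e < Suc b * 1" using e by simp
      also have "\<dots> \<le> Suc b * nx j" by (rule mult_le_mono2) (use x(3)[OF j] in simp)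
      finally have "e < Suc b * nx j" .
      then have "\<not> Suc b * nx j \<le> e" by (simp only: not_le)
      then show "hpart e (x j ^ Suc b * s j) = 0"
        using hpart_mult[OF homogeneous_power[OF x(2), of j "Suc b"], of e "s j"] j by simp
    qed
    also have "(\<Sum>j\<in>A. hpart e (x j * s j)) =
      (\<Sum>j\<in>A. (if nx j \<le> e then hpart (e - nx j) (s j) else 0) * x j)"
    proof (rule sum.cong[OF refl])
      fix j assume "j \<in> A"
      then show "hpart e (x j * s j) = (if nx j \<le> e then hpart (e - nx j) (s j) else 0) * x j"
        using hpart_mult[OF x(2), of j e "s j"] by (simp add: mult.commute)
    qed
    finally show ?thesis by simp
  qed
  define r where "r j = (\<Sum>e\<le>b. if nx j \<le> e then hpart (e - nx j) (s j) else 0)" for j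
  have "f = (\<Sum>e\<le>b. hpart e f)" using sum_hpart[OF b] by simp
  also have "\<dots> = (\<Sum>e\<le>b. \<Sum>j\<in>A. (if nx j \<le> e then hpart (e - nx j) (s j) else 0) * x j)"
    by (intro sum.cong refl part) simp
  also have "\<dots> = (\<Sum>j\<in>A. r j * x j)"
    unfolding r_def by (subst sum.swap) (simp only: sum_distrib_right)
  finally have "f = (\<Sum>j\<in>A. r j * x j)" .
  moreover have "\<forall>j\<in>A. r j \<in> S"
    unfolding r_def using s(1) by (auto intro!: inv.S_sum inv.S_hpart inv.S_0)
  ultimately have "f \<in> {\<Sum>j\<in>A. r j * x j |r. \<forall>j\<in>A. r j \<in> S}"
    by (intro CollectI exI[of _ r] conjI)
  then show ?thesis using A x(1) by (subst genideal_finite_sums) auto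
qed

text \<open>A product of ideals consists of the sums of products of elements, by definition of
  \<open>ideal_prod\<close>, so it is enough to consider products of elements.\<close>
lemma finprod_ideals_subset:
  fixes i :: nat
  assumes I: "\<And>j. ideal (I j) R"
    and J: "\<And>a b. a \<in> J \<Longrightarrow> b \<in> J \<Longrightarrow> a + b \<in> J"
    and prods: "\<And>c. (\<And>j. j \<le> i \<Longrightarrow> c j \<in> I j) \<Longrightarrow> (\<Prod>j\<le>i. c j) \<in> J"
  shows "(\<Otimes>\<^bsub>ideals_set R\<^esub>j\<in>{..i}. I j) \<subseteq> J"
  using J prods
proof (induction i arbitrary: J)
  case 0
  interpret M: comm_monoid "ideals_set R" by (rule cring.ideals_set_is_comm_monoid[OF cring_invariant])
  have "(\<Otimes>\<^bsub>ideals_set R\<^esub>j\<in>{..0}. I j) = I 0"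
    by (rule M.finprod_0) (simp add: ideals_set_def I)
  moreover have "f \<in> J" if "f \<in> I 0" for f using "0.prems"(2)[of "\<lambda>_. f"] that by simp
  ultimately show ?case by blast
next
  case (Suc i)
  interpret M: comm_monoid "ideals_set R" by (rule cring.ideals_set_is_comm_monoid[OF cring_invariant])
  have "(\<Otimes>\<^bsub>ideals_set R\<^esub>j\<in>{..Suc i}. I j) =
      ideal_prod R (I (Suc i)) (\<Otimes>\<^bsub>ideals_set R\<^esub>j\<in>{..i}. I j)"
    using M.finprod_Suc[of I i] by (simp add: ideals_set_def I)
  moreover have "f \<in> J" if "f \<in> ideal_prod R (I (Suc i)) (\<Otimes>\<^bsub>ideals_set R\<^esub>j\<in>{..i}. I j)" for f
    using that
  proof (induction f rule: ideal_prod.induct)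
    case (prod a b)
    have "(\<Otimes>\<^bsub>ideals_set R\<^esub>j\<in>{..i}. I j) \<subseteq> {b. a * b \<in> J}"
    proof (rule Suc.IH)
      show "b + b' \<in> {b. a * b \<in> J}" if "b \<in> {b. a * b \<in> J}" "b' \<in> {b. a * b \<in> J}" for b b'
        using that Suc.prems(1) by (simp add: distrib_left)
      fix c assume c: "\<And>j. j \<le> i \<Longrightarrow> c j \<in> I j"
      have "(\<Prod>j\<le>Suc i. (c(Suc i := a)) j) \<in> J"
        using c prod(1) by (intro Suc.prems(2)) (auto simp: le_Suc_eq)
      moreover have "(\<Prod>j\<le>Suc i. (c(Suc i := a)) j) = a * (\<Prod>j\<le>i. c j)"
        by (simp add: mult.commute)
      ultimately show "(\<Prod>j\<le>i. c j) \<in> {b. a * b \<in> J}" by (simp only: mem_Collect_eq)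
    qed
    then show ?case using prod(2) by auto
  next
    case (sum f g)
    then show ?case using Suc.prems(1) by simp
  qed
  ultimately show ?case by blast
qed

end

section \<open>Colon ideals of a homogeneous system of parameters\<close>

theorem corollary1p13:
  fixes G :: "('k::{field,finite} ^ 'n::finite ^ 'n) set"
    and E :: "nat \<Rightarrow> (('n, 'k) mpol, 'b) module"
    and \<delta> :: "nat \<Rightarrow> 'b \<Rightarrow> 'b"
    and \<epsilon> :: "('n, 'k) mpol \<Rightarrow> 'b"
    and a :: "nat \<Rightarrow> nat"
    and x :: "nat \<Rightarrow> ('n, 'k) mpol"
    and t :: nat
  assumes "3 \<le> CARD('n)"
    and "subgroup G GL"
    and "injective_resolution (invariant_ring G) (regular_module (invariant_ring G)) E \<delta> \<epsilon>"
    and "\<And>j. j < CARD('n) \<Longrightarrow>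
           ideal_power (invariant_ring G) (dickson_ideal G) (a j)
             \<subseteq> annihilator (invariant_ring G)
                 (local_cohomology (invariant_ring G) (irrelevant_ideal G) E \<delta> j)"
    and "\<And>j m. j < CARD('n) \<Longrightarrow>
           ideal_power (invariant_ring G) (dickson_ideal G) m
             \<subseteq> annihilator (invariant_ring G)
                 (local_cohomology (invariant_ring G) (irrelevant_ideal G) E \<delta> j) \<Longrightarrow>
           a j \<le> m"
    and "hsop G x"
    and "t \<in> {1..CARD('n)}"
  shows "frak_q G a (CARD('n) - 1)
    \<subseteq> annihilator (invariant_ring G)
        (subquotient (regular_module (invariant_ring G))
          (ideal_colon (invariant_ring G) (Idl\<^bsub>invariant_ring G\<^esub> (x ` {1..<t})) (x t))
          (Idl\<^bsub>invariant_ring G\<^esub> (x ` {1..<t})))"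
proof -
  let ?R = "invariant_ring G" and ?d = "CARD('n)"
  let ?S = "carrier (invariant_ring G)"
  let ?J = "genideal ?R (x ` {1..<t})"
  note t = assms(7)
  define nx where "nx j = (SOME n. 0 < n \<and> homogeneous n (x j))" for j
  have x: "x j \<in> ?S" "0 < nx j" "homogeneous (nx j) (x j)" if "j \<in> {1..?d}" for j
  proof -
    have "x j \<in> ?S \<and> (\<exists>n>0. homogeneous n (x j))" using assms(6) that unfolding hsop_def by blast
    then show "x j \<in> ?S" "0 < nx j" "homogeneous (nx j) (x j)"
      unfolding nx_def using someI_ex[of "\<lambda>n. 0 < n \<and> homogeneous n (x j)"] by auto
  qed
  have "\<exists>B. finite B \<and> B \<subseteq> ?S \<and>
    (\<forall>f\<in>?S. \<exists>c. (\<forall>b\<in>B. c b \<in> poly_subst x ` polys_in ?d) \<and> f = (\<Sum>b\<in>B. c b * b))"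
    using assms(6) unfolding hsop_def by (elim conjE)
  then obtain B where B: "finite B" "B \<subseteq> ?S"
    "\<forall>f\<in>?S. \<exists>c. (\<forall>b\<in>B. c b \<in> poly_subst x ` polys_in ?d) \<and> f = (\<Sum>b\<in>B. c b * b)"
    by (elim exE conjE)
  note B = B(1,2) bspec[OF B(3)]
  have dick: "ideal (dickson_ideal G) ?R"
    unfolding dickson_ideal_def
    by (rule ring.genideal_ideal[OF R_ring]) (simp add: dickson_invariant[OF assms(2)])
  have xt: "x ` {1..<t} \<subseteq> ?S" using x(1) t by (intro image_subsetI) simp
  have J: "ideal ?J ?R" by (rule ring.genideal_ideal[OF R_ring xt])
  interpret J: ideal ?J ?R by (rule J)
  have kill: "(\<Prod>j<?d. c j) * r \<in> ?J"
    if c: "\<And>j. j < ?d \<Longrightarrow> c j \<in> ideal_power ?R (dickson_ideal G) (a j)"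
      and r: "r \<in> ?S" "r * x t \<in> ?J" for c r
  proof -
    obtain s where s: "\<forall>j\<in>{1..<t}. s j \<in> ?S" "r * x t = (\<Sum>j\<in>{1..<t}. s j * x j)"
      using r(2) x(1) t by (subst (asm) genideal_finite_sums) auto
    have D: "{1..?d} - {t} = {1..<t} \<union> {t<..?d}" using t by auto
    have "(\<Prod>j<?d. c j) * r \<in> ?J"
    proof (rule mem_genideal_if_mem_modulo_powers[where A' = "{t<..?d}" and nx = nx])
      fix N :: nat assume N: "0 < N"
      \<comment> \<open>the relation \<open>r * x t = (\<Sum>j\<in>{1..<t}. s j * x j)\<close> with all terms on one side, read as a
        relation of a sequence that agrees with \<open>x\<close> up to \<open>t\<close>\<close>
      define y where "y j = x j ^ (if j \<le> t then 1 else N)" for j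
      define s' where "s' j = (if j < t then 0 - s j else if j = t then r else 0)" for j
      have "(\<Prod>j<?d. c j) * s' t \<in> genideal ?R (y ` ({1..?d} - {t}))"
      proof (rule annihilator_products_colon[where N = "\<lambda>j. if j \<le> t then 1 else N" and nx = nx,
            OF assms(3,4) x(3,2,1) B])
        show "y j = x j ^ (if j \<le> t then 1 else N)" for j by (simp add: y_def)
        show "s' j \<in> ?S" if "j \<in> {1..?d}" for j
          using s(1) r(1) that unfolding s'_def by (simp del: diff_0) (intro conjI impI inv.S_diff inv.S_0; simp)
        have "(\<Sum>j\<in>{1..?d}. s' j * y j) = (\<Sum>j\<in>insert t {1..<t}. s' j * y j)"
          using t by (intro sum.mono_neutral_right) (auto simp: s'_def)
        also have "\<dots> = r * x t + (\<Sum>j\<in>{1..<t}. - (s j * x j))"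
          by (subst sum.insert) (auto simp: s'_def y_def intro!: sum.cong)
        also have "\<dots> = 0" unfolding s(2) by (simp add: sum_negf)
        finally show "(\<Sum>j\<in>{1..?d}. s' j * y j) = 0" .
      qed (use N t c in auto)
      moreover have "y ` ({1..?d} - {t}) = (\<lambda>j. x j ^ (if j \<in> {1..<t} then 1 else N)) ` ({1..<t} \<union> {t<..?d})"
        unfolding D by (rule image_cong[OF refl]) (auto simp: y_def)
      ultimately show "(\<Prod>j<?d. c j) * r \<in>
          genideal ?R ((\<lambda>j. x j ^ (if j \<in> {1..<t} then 1 else N)) ` ({1..<t} \<union> {t<..?d}))"
        by (simp add: s'_def)
    qed (use x t in auto)
    then show ?thesis .
  qed
  have "frak_q G a (?d - 1) \<subseteq> {f \<in> ?S. \<forall>r\<in>?S. r * x t \<in> ?J \<longrightarrow> f * r \<in> ?J}"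
    unfolding frak_q_def
  proof (rule finprod_ideals_subset)
    show "ideal (ideal_power ?R (dickson_ideal G) (a j)) ?R" for j
      by (rule ring.ideal_power_ideal[OF R_ring dick])
    show "f + g \<in> {f \<in> ?S. \<forall>r\<in>?S. r * x t \<in> ?J \<longrightarrow> f * r \<in> ?J}"
      if fg: "f \<in> {f \<in> ?S. \<forall>r\<in>?S. r * x t \<in> ?J \<longrightarrow> f * r \<in> ?J}"
        "g \<in> {f \<in> ?S. \<forall>r\<in>?S. r * x t \<in> ?J \<longrightarrow> f * r \<in> ?J}" for f g
    proof -
      have "(f + g) * r \<in> ?J" if r: "r \<in> ?S" "r * x t \<in> ?J" for r
      proof -
        have "f * r \<in> ?J" "g * r \<in> ?J" using fg r by blast+
        from additive_subgroup.a_closed[OF ideal.axioms(1)[OF J] this] show ?thesis by (simp only: distrib_right invariant_simps)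
      qed
      moreover have "f + g \<in> ?S" using fg by (intro inv.S_add) blast+
      ultimately show ?thesis by blast
    qed
    fix c assume c: "\<And>j. j \<le> ?d - 1 \<Longrightarrow> c j \<in> ideal_power ?R (dickson_ideal G) (a j)"
    have eq: "{..?d - 1} = {..<?d}" using assms(1) by auto
    have "c j \<in> ?S" if "j \<le> ?d - 1" for j
      using ideal.Icarr[OF ring.ideal_power_ideal[OF R_ring dick] c[OF that]] .
    then have "(\<Prod>j\<le>?d - 1. c j) \<in> ?S" by (intro inv.S_prod) simp
    moreover have "(\<Prod>j\<le>?d - 1. c j) * r \<in> ?J" if "r \<in> ?S" "r * x t \<in> ?J" for r
      unfolding eq using c that by (intro kill) auto
    ultimately show "(\<Prod>j\<le>?d - 1. c j) \<in> {f \<in> ?S. \<forall>r\<in>?S. r * x t \<in> ?J \<longrightarrow> f * r \<in> ?J}"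
      by blast
  qed
  moreover have "f \<in> annihilator ?R (subquotient (regular_module ?R) (ideal_colon ?R ?J (x t)) ?J)"
    if f: "f \<in> ?S" "\<forall>r\<in>?S. r * x t \<in> ?J \<longrightarrow> f * r \<in> ?J" for f
  proof (rule annihilator_subquotientI)
    show "Module.module ?R (regular_module ?R)" by (rule regular_module_module[OF cring_invariant])
    show "submodule ?J ?R (regular_module ?R)" by (rule ideal_submodule_regular[OF cring_invariant J])
  qed (use f in \<open>auto simp: ideal_colon_def\<close>)
  ultimately show ?thesis by blast
qed

end
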